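(* Assume in addition $\mathbb E X_0^3<\infty$ and $\mathbb E\varepsilon_1^3<\infty$. Then $$\begin{bmatrix}\sqrt n(\hat\alpha_n-\alpha)\\ \sqrt n(\hat\mu_{\varepsilon,n}-\mu_\varepsilon)\end{bmatrix}\to\mathcal N\Big(\begin{bmatrix}0\\0\end{bmatrix},B_{\alpha,\varepsilon}\Big)$$ in distribution as $n\to\infty$. Moreover, conditionally on the values $(Y_{s-1},Y_{s+1})$, $$\sqrt n\Big(\hat\theta_n-\Big(Y_s-\frac{\alpha}{1+\alpha^2}(Y_{s-1}+Y_{s+1})-\frac{1-\alpha}{1+\alpha^2}\mu_\varepsilon\Big)\Big)\to\mathcal N\big(0,d_{\alpha,\varepsilon}^\top B_{\alpha,\varepsilon}d_{\alpha,\varepsilon}\big),$$ where $d_{\alpha,\varepsilon}=\frac{1}{(1+\alpha^2)^2}\begin{bmatrix}(\alpha^2-1)(Y_{s-1}+Y_{s+1})+(2\alpha+1-\alpha^2)\mu_\varepsilon\\-(1+\alpha^2)(1-\alpha)\end{bmatrix}$.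
   Context: INAR(1) process: Let $\alpha\in(0,1)$. Let $(\varepsilon_k)_{k\in\mathbb N}$ be i.i.d. non-negative integer-valued random variables with $\mathbb E\varepsilon_1^2<\infty$ and $\mathbb P(\varepsilon_1\ne 0)>0$; write $\mu_\varepsilon=\mathbb E\varepsilon_1$ and $\sigma_\varepsilon^2=\operatorname{Var}\varepsilon_1$. For each $k\in\mathbb N$ let $(\xi_{k,j})_{j\in\mathbb N}$ be i.i.d. Bernoulli random variables with mean $\alpha$, these sequences being mutually independent and independent of $(\varepsilon_k)$. Let $X_0$ be a non-negative integer-valued random variable with $\mathbb E X_0^2<\infty$, independent of all $\xi_{k,j}$ and $\varepsilon_k$, and set $X_k=\sum_{j=1}^{X_{k-1}}\xi_{k,j}+\varepsilon_k$ for $k\in\mathbb N$. This Markov chain has a unique stationary distribution; $\tilde X$ denotes a random variable with that distribution, and $$A_{\alpha,\varepsilon}=\alpha(1-\alpha)\begin{bmatrix}\mathbb E\tilde X^3&\mathbb E\tilde X^2\\ \mathbb E\tilde X^2&\mathbb E\tilde X\end{bmatrix}+\sigma_\varepsilon^2\begin{bmatrix}\mathbb E\tilde X^2&\mathbb E\tilde X\\ \mathbb E\tilde X&1\end{bmatrix},\qquad B_{\alpha,\varepsilon}=\begin{bmatrix}\mathbb E\tilde X^2&\mathbb E\tilde X\\ \mathbb E\tilde X&1\end{bmatrix}^{-1}A_{\alpha,\varepsilon}\begin{bmatrix}\mathbb E\tilde X^2&\mathbb E\tilde X\\ \mathbb E\tilde X&1\end{bmatrix}^{-1}.$$ Additive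 outlier: fix a known time $s\in\mathbb N$ and size $\theta\in\mathbb N$, and let $Y_k=X_k+\delta_{k,s}\theta$, $k\in\mathbb Z_+$; $\mathbf Y_n=(Y_0,\dots,Y_n)$. For $n\ge\max(3,s+1)$, $$Q_n(\mathbf y_n;\alpha',\mu'_\varepsilon,\theta')=\sum_{\substack{k=1\\k\notin\{s,s+1\}}}^n(y_k-\alpha'y_{k-1}-\mu'_\varepsilon)^2+(y_s-\alpha'y_{s-1}-\mu'_\varepsilon-\theta')^2+(y_{s+1}-\alpha'y_s-\mu'_\varepsilon+\alpha'\theta')^2,$$ and $(\hat\alpha_n,\hat\mu_{\varepsilon,n},\hat\theta_n)$ is the unique global minimizer over $\mathbb R^3$ of $(\alpha',\mu'_\varepsilon,\theta')\mapsto Q_n(\mathbf Y_n;\alpha',\mu'_\varepsilon,\theta')$ when it exists uniquely, and $(0,0,0)$ otherwise. Conditional convergence: for random variables $\zeta_n$ and a random vector $\eta$ with values in $\mathbb Z_+^d$, "conditionally on the values $\eta$, $\zeta_n\to\mathcal N(0,v(\eta))$" means: for every $m$ with $\mathbb P(\eta=m)>0$, the conditional distribution of $\zeta_n$ given $\{\eta=m\}$ converges weakly to $\mathcal N(0,v(m))$. *)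

theory Defs
  imports "HOL-Probability.Probability"
begin

fun inar :: "('a \<Rightarrow> nat) \<Rightarrow> (nat \<Rightarrow> 'a \<Rightarrow> nat) \<Rightarrow> (nat \<Rightarrow> nat \<Rightarrow> 'a \<Rightarrow> nat) \<Rightarrow> nat \<Rightarrow> 'a \<Rightarrow> nat" where
  "inar X0 eps xi 0 \<omega> = X0 \<omega>"
| "inar X0 eps xi (Suc k) \<omega> = (\<Sum>j\<in>{1..inar X0 eps xi k \<omega>}. xi (Suc k) j \<omega>) + eps (Suc k) \<omega>"

definition inar_family :: "('a \<Rightarrow> nat) \<Rightarrow> (nat \<Rightarrow> 'a \<Rightarrow> nat) \<Rightarrow> (nat \<Rightarrow> nat \<Rightarrow> 'a \<Rightarrow> nat) \<Rightarrow> nat + nat \<times> nat \<Rightarrow> 'a \<Rightarrow> nat" where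
  "inar_family X0 eps xi i = (case i of Inl k \<Rightarrow> (if k = 0 then X0 else eps k) | Inr (k, j) \<Rightarrow> xi k j)"

definition inar_index :: "(nat + nat \<times> nat) set" where
  "inar_index = range Inl \<union> Inr ` {(k, j). 1 \<le> k \<and> 1 \<le> j}"

definition inar_step :: "real \<Rightarrow> nat pmf \<Rightarrow> nat \<Rightarrow> nat pmf" where
  "inar_step \<alpha> pe x = map_pmf (\<lambda>(b, e). b + e) (pair_pmf (binomial_pmf x \<alpha>) pe)"

definition inar_stationary :: "real \<Rightarrow> nat pmf \<Rightarrow> nat pmf \<Rightarrow> bool" where
  "inar_stationary \<alpha> pe \<pi> \<longleftrightarrow> bind_pmf \<pi> (inar_step \<alpha> pe) = \<pi>"

definition stat_moment :: "real \<Rightarrow> nat pmf \<Rightarrow> nat \<Rightarrow> real" where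
  "stat_moment \<alpha> pe k = measure_pmf.expectation (THE \<pi>. inar_stationary \<alpha> pe \<pi>) (\<lambda>x. real x ^ k)"

definition mat2 :: "real \<Rightarrow> real \<Rightarrow> real \<Rightarrow> real \<Rightarrow> real^2^2" where
  "mat2 a b c d = vector [vector [a, b], vector [c, d]]"

definition inar_S :: "real \<Rightarrow> nat pmf \<Rightarrow> real^2^2" where
  "inar_S \<alpha> pe = mat2 (stat_moment \<alpha> pe 2) (stat_moment \<alpha> pe 1) (stat_moment \<alpha> pe 1) 1"

definition inar_A :: "real \<Rightarrow> nat pmf \<Rightarrow> real^2^2" where
  "inar_A \<alpha> pe =
     (\<alpha> * (1 - \<alpha>)) *\<^sub>R mat2 (stat_moment \<alpha> pe 3) (stat_moment \<alpha> pe 2) (stat_moment \<alpha> pe 2) (stat_moment \<alpha> pe 1)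
     + measure_pmf.variance pe real *\<^sub>R inar_S \<alpha> pe"

definition inar_B :: "real \<Rightarrow> nat pmf \<Rightarrow> real^2^2" where
  "inar_B \<alpha> pe = matrix_inv (inar_S \<alpha> pe) ** inar_A \<alpha> pe ** matrix_inv (inar_S \<alpha> pe)"

definition cls_Q :: "nat \<Rightarrow> nat \<Rightarrow> (nat \<Rightarrow> real) \<Rightarrow> real \<times> real \<times> real \<Rightarrow> real" where
  "cls_Q n s y p = (case p of (a, m, t) \<Rightarrow>
     (\<Sum>k\<in>{1..n} - {s, s+1}. (y k - a * y (k-1) - m)^2)
     + (y s - a * y (s-1) - m - t)^2 + (y (s+1) - a * y s - m + a * t)^2)"

definition cls_est :: "nat \<Rightarrow> nat \<Rightarrow> (nat \<Rightarrow> real) \<Rightarrow> real \<times> real \<times> real" where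
  "cls_est n s y =
     (if \<exists>!p. \<forall>q. cls_Q n s y p \<le> cls_Q n s y q
      then THE p. \<forall>q. cls_Q n s y p \<le> cls_Q n s y q else (0, 0, 0))"

text \<open>Centered Gaussian law on a Euclidean space with covariance quadratic form q
  (characterised by its characteristic function exp(-q(t)/2)); allows degenerate cases.\<close>
definition centered_gaussian :: "('b::euclidean_space \<Rightarrow> real) \<Rightarrow> 'b measure \<Rightarrow> bool" where
  "centered_gaussian q N \<longleftrightarrow> prob_space N \<and> sets N = sets borel \<and>
     (\<forall>t. (CLINT x|N. iexp (t \<bullet> x)) = complex_of_real (exp (- q t / 2)))"

definition weak_conv_vec :: "(nat \<Rightarrow> 'b::euclidean_space measure) \<Rightarrow> 'b measure \<Rightarrow> bool" where
  "weak_conv_vec Ns N \<longleftrightarrow> (\<forall>f :: 'b \<Rightarrow> real. continuous_on UNIV f \<and> bounded (range f) \<longrightarrow>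
     (\<lambda>n. \<integral>x. f x \<partial>Ns n) \<longlonglongrightarrow> (\<integral>x. f x \<partial>N))"

end

theory Submission
  imports Defs
begin

text \<open>
  One step of the chain shrinks increments of functions by the factor alpha, so bounded functions
  of the chain mix geometrically, and its first three moments satisfy affine recurrences with
  limits equal to the stationary moments. Convergence of the third moment replaces uniform
  integrability, whence laws of large numbers for functions of cubic growth.

  The score of the least squares problem is a martingale. Truncating its predictable factor to
  states at most L leaves finitely many one-step characteristic functions and a bounded
  compensator, so the product of the characteristic exponential with the exponentiated compensator
  is almost a martingale; the remainder is small in L2 uniformly in time. Carrying along a bounded
  function of the first s + 2 states gives the conditional version at no extra cost.

  Minimising over the outlier size turns the objective into a quadratic form of order n plus a
  nonnegative smooth perturbation independent of n. In the scale of 1 / sqrt n the perturbation is asymptotically constant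
  and its failure of convexity is of order 1 / n, hence the minimiser is unique and close
  to the solution of the limiting normal equations. The size estimator is a smooth function of the
  other two given the neighbouring observations.
\<close>

section \<open>Mass functions and affine recurrences\<close>

text \<open>The third moment is exactly what the score demands: its predictable factor is affine in
  the state and the conditional variance of a residual is affine too, so the compensator grows like
  the cube of the state. All states are natural numbers and histories are finite lists, so every
  quantity depending on the past is a function on a countable set, integrated against the kernel.

  The estimator is defined through a unique global minimiser, with (0,0,0) otherwise, and the
  objective is not jointly convex because the outlier size is multiplied by the autoregressive
  coefficient. Uniqueness must be won with probability tending to one; it is isolated in a
  deterministic statement whose thresholds depend on the data only through the two neighbours of the
  outlier time. These neighbours are tight, so finitely many thresholds suffice.

  The outlier disturbs only the residuals at \<open>s\<close> and \<open>s + 1\<close>, and the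
  conditioning pair is known at time \<open>s + 1\<close>. The score after that time is
  asymptotically insensitive to any event of that past, so one limit theorem yields both
  claims.\<close>

lemma integral_bind_pmf_real:
  fixes f :: "'b \<Rightarrow> real"
  assumes "integrable (measure_pmf (bind_pmf p k)) f"
  shows "measure_pmf.expectation (bind_pmf p k) f =
    measure_pmf.expectation p (\<lambda>x. measure_pmf.expectation (k x) f)"
proof -
  \<comment> \<open>\<open>f\<close> is integrable only under the mixture, so under
    \<open>k x\<close> it may fail to be integrable on a \<open>p\<close>-null set. Positive and
    negative parts are handled in the extended nonnegative reals and subtracted at the end.\<close>
  define gp where "gp x = (\<integral>\<^sup>+y. ennreal (f y) \<partial>measure_pmf (k x))" for x
  define gm where "gm x = (\<integral>\<^sup>+y. ennreal (- f y) \<partial>measure_pmf (k x))" for x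
  have P: "(\<integral>\<^sup>+x. gp x \<partial>measure_pmf p) < \<infinity>" "(\<integral>\<^sup>+x. gm x \<partial>measure_pmf p) < \<infinity>"
    using integrableD(2)[OF assms] integrableD(3)[OF assms] by (auto simp: gp_def gm_def less_top)
  have AE: "AE x in measure_pmf p. gp x \<noteq> \<infinity>" "AE x in measure_pmf p. gm x \<noteq> \<infinity>"
    using P by (auto intro!: nn_integral_PInf_AE[simplified] simp: less_top[symmetric])
  have I: "integrable (measure_pmf p) (\<lambda>x. enn2real (gp x))" "integrable (measure_pmf p) (\<lambda>x. enn2real (gm x))"
    and E: "(\<integral>x. enn2real (gp x) \<partial>measure_pmf p) = enn2real (\<integral>\<^sup>+x. gp x \<partial>measure_pmf p)"
      "(\<integral>x. enn2real (gm x) \<partial>measure_pmf p) = enn2real (\<integral>\<^sup>+x. gm x \<partial>measure_pmf p)"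
  proof -
    have e: "(\<integral>\<^sup>+x. ennreal (enn2real (gp x)) \<partial>measure_pmf p) = (\<integral>\<^sup>+x. gp x \<partial>measure_pmf p)"
      "(\<integral>\<^sup>+x. ennreal (enn2real (gm x)) \<partial>measure_pmf p) = (\<integral>\<^sup>+x. gm x \<partial>measure_pmf p)"
      using AE by (auto intro!: nn_integral_cong_AE simp: less_top)
    show "integrable (measure_pmf p) (\<lambda>x. enn2real (gp x))" "integrable (measure_pmf p) (\<lambda>x. enn2real (gm x))"
      using P e by (auto intro!: integrableI_nonneg)
    show "(\<integral>x. enn2real (gp x) \<partial>measure_pmf p) = enn2real (\<integral>\<^sup>+x. gp x \<partial>measure_pmf p)"
      "(\<integral>x. enn2real (gm x) \<partial>measure_pmf p) = enn2real (\<integral>\<^sup>+x. gm x \<partial>measure_pmf p)"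
      using e by (simp_all add: integral_eq_nn_integral)
  qed
  have "measure_pmf.expectation p (\<lambda>x. measure_pmf.expectation (k x) f)
      = (\<integral>x. enn2real (gp x) - enn2real (gm x) \<partial>measure_pmf p)"
  proof (rule integral_cong_AE)
    show "AE x in measure_pmf p. measure_pmf.expectation (k x) f = enn2real (gp x) - enn2real (gm x)"
      using AE
    proof eventually_elim
      case (elim x)
      have "integrable (measure_pmf (k x)) f"
        using elim by (auto simp: gp_def gm_def real_integrable_def)
      then show ?case by (simp add: real_lebesgue_integral_def gp_def gm_def)
    qed
  qed auto
  also have "\<dots> = enn2real (\<integral>\<^sup>+x. gp x \<partial>measure_pmf p) - enn2real (\<integral>\<^sup>+x. gm x \<partial>measure_pmf p)"
    using I E by simp
  also have "\<dots> = measure_pmf.expectation (bind_pmf p k) f"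
    using assms by (simp add: real_lebesgue_integral_def gp_def gm_def)
  finally show ?thesis by simp
qed

lemma integrable_pmf_bounded:
  fixes f :: "'b \<Rightarrow> 'c::{banach, second_countable_topology}"
  assumes "\<And>x. norm (f x) \<le> C"
  shows "integrable (measure_pmf p) f"
  by (rule measure_pmf.integrable_const_bound[where B=C]) (use assms in auto)

lemma expectation_pmf_bounded:
  fixes f :: "'b \<Rightarrow> real"
  assumes "\<And>x. \<bar>f x\<bar> \<le> C"
  shows "\<bar>measure_pmf.expectation p f\<bar> \<le> C"
proof -
  have "\<bar>measure_pmf.expectation p f\<bar> \<le> measure_pmf.expectation p (\<lambda>x. \<bar>f x\<bar>)"
    using integral_norm_bound[of "measure_pmf p" f] by simp
  also have "\<dots> \<le> measure_pmf.expectation p (\<lambda>x. C)"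
    by (rule integral_mono) (use assms in \<open>auto intro!: integrable_pmf_bounded[where C=C]\<close>)
  finally show ?thesis by simp
qed

lemma integrable_power_le3:
  assumes "integrable (measure_pmf p) (\<lambda>x. real x ^ 3)" "j \<le> 3"
  shows "integrable (measure_pmf p) (\<lambda>x. real x ^ j)"
proof (rule Bochner_Integration.integrable_bound[where f="\<lambda>x. 1 + real x ^ 3"])
  show "integrable (measure_pmf p) (\<lambda>x. 1 + real x ^ 3)" using assms by auto
  show "AE x in measure_pmf p. norm (real x ^ j) \<le> norm (1 + real x ^ 3)"
  proof (rule AE_I2)
    fix x
    have "real x ^ j \<le> 1 + real x ^ 3"
      using power_increasing[OF assms(2), of "real x"] by (cases "x = 0") (auto simp: power_0_left)
    then show "norm (real x ^ j) \<le> norm (1 + real x ^ 3)" by simp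
  qed
qed auto

text \<open>The limit is the fixed point of \<open>x = r * x + l\<close>, and the distance to it
  contracts by \<open>|r|\<close> up to an error tending to 0. Applied with \<open>r\<close> equal
  to \<alpha>, its square and its cube, where \<open>w\<close> collects the lower moments.\<close>

lemma LIMSEQ_affine_recurrence:
  fixes u w :: "nat \<Rightarrow> real"
  assumes r: "\<bar>r\<bar> < 1" and u: "\<And>k. u (Suc k) = r * u k + w k" and w: "w \<longlonglongrightarrow> l"
  shows "u \<longlonglongrightarrow> l / (1 - r)"
proof -
  define c where "c = l / (1 - r)"
  define v where "v k = \<bar>u k - c\<bar>" for k
  have c: "c = r * c + l" using r by (simp add: c_def field_simps)
  have step: "v (Suc k) \<le> \<bar>r\<bar> * v k + \<bar>w k - l\<bar>" for k
  proof -
    have "u (Suc k) - c = r * (u k - c) + (w k - l)" using u[of k] c by (simp add: algebra_simps)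
    then show ?thesis unfolding v_def by (metis abs_mult abs_triangle_ineq)
  qed
  have "v \<longlonglongrightarrow> 0"
  proof (rule LIMSEQ_I)
    fix e :: real assume e: "0 < e"
    \<comment> \<open>Chosen so that \<open>e / 2\<close> is the fixed point of
      \<open>x = |r| * x + d\<close>; past \<open>N\<close> the recursion stays below
      \<open>e / 2\<close> plus a geometric term.\<close>
    define d where "d = e / 2 * (1 - \<bar>r\<bar>)"
    have d: "d > 0" using e r by (simp add: d_def)
    obtain N where N: "\<And>k. k \<ge> N \<Longrightarrow> \<bar>w k - l\<bar> < d" using LIMSEQ_D[OF w d] by auto
    have b: "v (N + m) \<le> \<bar>r\<bar> ^ m * v N + e / 2" for m
    proof (induction m)
      case 0 then show ?case using e by simp
    next
      case (Suc m)
      have "v (N + Suc m) \<le> \<bar>r\<bar> * v (N + m) + d" using step[of "N+m"] N[of "N+m"] by simp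
      also have "\<dots> \<le> \<bar>r\<bar> * (\<bar>r\<bar> ^ m * v N + e / 2) + d" using Suc by (intro add_right_mono mult_left_mono) auto
      also have "\<dots> = \<bar>r\<bar> ^ Suc m * v N + e / 2" by (simp add: d_def field_simps)
      finally show ?case .
    qed
    have "(\<lambda>m. \<bar>r\<bar> ^ m * v N) \<longlonglongrightarrow> 0" using LIMSEQ_power_zero[of "\<bar>r\<bar>"] r by (auto intro!: tendsto_mult_left_zero)
    from LIMSEQ_D[OF this, of "e/2"] e obtain m0 where m0: "\<And>m. m \<ge> m0 \<Longrightarrow> \<bar>r\<bar> ^ m * v N < e / 2" by (auto simp: v_def abs_mult)
    have "norm (v n - 0) < e" if "n \<ge> N + m0" for n
      using b[of "n - N"] m0[of "n - N"] that by (simp add: v_def le_diff_conv2)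
    then show "\<exists>no. \<forall>n\<ge>no. norm (v n - 0) < e" by blast
  qed
  then have "(\<lambda>k. u k - c) \<longlonglongrightarrow> 0" unfolding v_def by (rule tendsto_rabs_zero_cancel)
  then show ?thesis unfolding c_def using LIM_zero_iff by blast
qed

text \<open>Since the limit is itself a probability mass function, no mass escapes: the tail of
  \<open>p k\<close> beyond \<open>N\<close> is one minus a finite sum and converges to the tail of
  \<open>q\<close>. Pointwise convergence thus controls all bounded functions.\<close>

lemma pmf_pointwise_imp_expectation:
  fixes f :: "nat \<Rightarrow> real"
  assumes q: "\<And>x. (\<lambda>k. pmf (p k) x) \<longlonglongrightarrow> pmf q x" and f: "\<And>x. \<bar>f x\<bar> \<le> C"
  shows "(\<lambda>k. measure_pmf.expectation (p k) f) \<longlonglongrightarrow> measure_pmf.expectation q f"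
proof (rule LIMSEQ_I)
  fix e :: real assume e: "0 < e"
  have C: "0 \<le> C" using f[of 0] by simp
  \<comment> \<open>\<open>C + 1\<close> rather than \<open>C\<close> keeps the denominator positive
    when \<open>f\<close> vanishes; each of the two tails costs at most \<open>e / 4\<close>, the
    finite part \<open>e / 2\<close>.\<close>
  define d where "d = e / (4 * (C + 1))"
  have d: "d > 0" using e C by (simp add: d_def)
  have dC: "d * C \<le> e/4" using e C by (simp add: d_def field_simps)
  have split: "measure_pmf.expectation r f = (\<Sum>x\<le>N. f x * pmf r x) + measure_pmf.expectation r (\<lambda>x. f x * indicator {N<..} x)" for r N
  proof -
    have "measure_pmf.expectation r f = measure_pmf.expectation r (\<lambda>x. f x * indicator {..N} x + f x * indicator {N<..} x)"
      by (intro Bochner_Integration.integral_cong) (auto simp: indicator_def)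
    also have "\<dots> = measure_pmf.expectation r (\<lambda>x. f x * indicator {..N} x) + measure_pmf.expectation r (\<lambda>x. f x * indicator {N<..} x)"
      by (intro Bochner_Integration.integral_add integrable_pmf_bounded[where C=C]) (use f C in \<open>auto simp: indicator_def\<close>)
    also have "measure_pmf.expectation r (\<lambda>x. f x * indicator {..N} x) = (\<Sum>x\<le>N. f x * pmf r x)"
      by (subst integral_measure_pmf_real[where A="{..N}"]) (auto simp: indicator_def)
    finally show ?thesis .
  qed
  have tail: "\<bar>measure_pmf.expectation r (\<lambda>x. f x * indicator {N<..} x)\<bar> \<le> C * (1 - (\<Sum>x\<le>N. pmf r x))" for r N
  proof -
    have "\<bar>measure_pmf.expectation r (\<lambda>x. f x * indicator {N<..} x)\<bar> \<le> measure_pmf.expectation r (\<lambda>x. \<bar>f x * indicator {N<..} x\<bar>)"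
      using integral_norm_bound[of "measure_pmf r" "\<lambda>x. f x * indicator {N<..} x"] by simp
    also have "\<dots> \<le> measure_pmf.expectation r (\<lambda>x. C * indicator {N<..} x)"
      by (intro integral_mono integrable_pmf_bounded[where C=C]) (use f C in \<open>auto simp: indicator_def\<close>)
    also have "\<dots> = C * measure_pmf.prob r {N<..}" by simp
    also have "measure_pmf.prob r {N<..} = 1 - measure_pmf.prob r {..N}"
      using measure_pmf.prob_compl[of "{..N}" r] by (auto simp: Compl_eq_Diff_UNIV[symmetric] Compl_atMost)
    also have "measure_pmf.prob r {..N} = (\<Sum>x\<le>N. pmf r x)" by (simp add: measure_measure_pmf_finite)
    finally show ?thesis .
  qed
  have "(\<lambda>N. measure_pmf.prob q {..N}) \<longlonglongrightarrow> measure_pmf.prob q (\<Union>N. {..N})"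
    by (intro measure_pmf.finite_Lim_measure_incseq) (auto simp: incseq_def)
  moreover have "(\<Union>N. {..N}) = (UNIV::nat set)" by auto
  ultimately have "(\<lambda>N. measure_pmf.prob q {..N}) \<longlonglongrightarrow> 1" by simp
  from LIMSEQ_D[OF this d] obtain N where "\<bar>measure_pmf.prob q {..N} - 1\<bar> < d" by auto
  then have N: "1 - (\<Sum>x\<le>N. pmf q x) < d" by (simp add: measure_measure_pmf_finite)
  have s: "(\<lambda>k. (\<Sum>x\<le>N. pmf (p k) x)) \<longlonglongrightarrow> (\<Sum>x\<le>N. pmf q x)" by (intro tendsto_sum q)
  have ev1: "eventually (\<lambda>k. 1 - (\<Sum>x\<le>N. pmf (p k) x) < d) sequentially"
    using order_tendstoD(1)[OF s, of "1 - d"] N by (auto elim: eventually_mono)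
  have "(\<lambda>k. (\<Sum>x\<le>N. f x * pmf (p k) x)) \<longlonglongrightarrow> (\<Sum>x\<le>N. f x * pmf q x)" by (intro tendsto_sum tendsto_mult q tendsto_const)
  then have ev2: "eventually (\<lambda>k. \<bar>(\<Sum>x\<le>N. f x * pmf (p k) x) - (\<Sum>x\<le>N. f x * pmf q x)\<bar> < e/2) sequentially"
    using e half_gt_zero[OF e] unfolding tendsto_iff dist_real_def by blast
  have "eventually (\<lambda>k. \<bar>measure_pmf.expectation (p k) f - measure_pmf.expectation q f\<bar> < e) sequentially"
    using ev1 ev2
  proof eventually_elim
    case (elim k)
    have "C * (1 - (\<Sum>x\<le>N. pmf (p k) x)) \<le> C * d" "C * (1 - (\<Sum>x\<le>N. pmf q x)) \<le> C * d"
      using elim N C by (auto intro!: mult_left_mono)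
    moreover have "C * d \<le> e / 4" using dC by (simp add: mult.commute)
    ultimately show ?case using elim(2) tail[of "p k" N] tail[of q N] unfolding split[of "p k" N] split[of q N] by linarith
  qed
  then show "\<exists>no. \<forall>n\<ge>no. norm (measure_pmf.expectation (p n) f - measure_pmf.expectation q f) < e"
    by (simp add: eventually_sequentially)
qed

section \<open>The INAR(1) kernel and its stationary law\<close>

lemma LIMSEQ_upper_bound:
  fixes u :: "nat \<Rightarrow> real"
  assumes "u \<longlonglongrightarrow> l"
  obtains B where "\<And>k. u k \<le> B"
proof -
  have "Bseq u" using assms by (intro convergent_imp_Bseq convergentI)
  then obtain B where "\<And>k. norm (u k) \<le> B" unfolding Bseq_def by blast
  then have "u k \<le> B" for k using abs_le_D1[of "u k" B] by simp
  then show ?thesis by (rule that)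
qed

text \<open>\<open>mean_pos\<close> is the form in which the nonvanishing of the innovations enters.
  It makes the stationary variance positive and hence the limiting normal equations
  solvable.\<close>

locale inar_kernel =
  fixes \<alpha> :: real and pe :: "nat pmf"
  assumes \<alpha>: "0 < \<alpha>" "\<alpha> < 1"
    and pe3: "integrable (measure_pmf pe) (\<lambda>x. real x ^ 3)"
    and mean_pos: "0 < measure_pmf.expectation pe real"
begin

abbreviation K :: "nat \<Rightarrow> nat pmf" where "K \<equiv> inar_step \<alpha> pe"
definition "\<mu> = measure_pmf.expectation pe real"
definition "e2 = measure_pmf.expectation pe (\<lambda>x. real x ^ 2)"
definition "e3 = measure_pmf.expectation pe (\<lambda>x. real x ^ 3)"
definition "\<sigma>2 = measure_pmf.variance pe real"
text \<open>The transition operator; \<open>(P ^^ k) f x\<close> is the expectation of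
  \<open>f\<close> at time \<open>k\<close> for the chain started at \<open>x\<close>.\<close>

definition P :: "(nat \<Rightarrow> real) \<Rightarrow> nat \<Rightarrow> real" where "P f x = measure_pmf.expectation (K x) f"

lemma \<alpha>_atLeastAtMost: "\<alpha> \<in> {0..1}" using \<alpha> by simp

lemma pe1: "integrable (measure_pmf pe) real" and pe2: "integrable (measure_pmf pe) (\<lambda>x. real x ^ 2)"
  using integrable_power_le3[OF pe3, of 1] integrable_power_le3[OF pe3, of 2] by auto

lemma \<sigma>2_eq: "\<sigma>2 = e2 - \<mu>^2"
  unfolding \<sigma>2_def e2_def \<mu>_def using pe1 pe2 by (simp add: measure_pmf.variance_eq)

lemma \<sigma>2_nonneg: "0 \<le> \<sigma>2" unfolding \<sigma>2_def by simp

lemma \<mu>_pos: "0 < \<mu>" using mean_pos by (simp add: \<mu>_def)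

section \<open>The one-step kernel and its first three moments\<close>

lemma K_0: "K 0 = pe"
  using \<alpha>_atLeastAtMost by (simp add: inar_step_def binomial_pmf_0 pair_return_pmf1 map_pmf_comp)

text \<open>One further individual adds one independent Bernoulli survivor. The moment formulas, the
  contraction of increments and the law of an innovation all rest on this identity, so binomial sums
  are never expanded.\<close>

lemma K_Suc: "K (Suc x) = bind_pmf (bernoulli_pmf \<alpha>) (\<lambda>b. map_pmf (\<lambda>y. of_bool b + y) (K x))"
  unfolding inar_step_def binomial_pmf_Suc[OF \<alpha>_atLeastAtMost]
  by (simp add: pair_pmf_def map_pmf_def bind_assoc_pmf bind_return_pmf of_bool_def add.assoc cong: if_cong)

lemma integrable_K_Suc:
  fixes f :: "nat \<Rightarrow> real"
  assumes "integrable (K x) f" "integrable (K x) (\<lambda>y. f (Suc y))"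
  shows "integrable (K (Suc x)) f"
proof (rule integrableI_bounded)
  have "(\<integral>\<^sup>+y. norm (f y) \<partial>K (Suc x)) = ennreal \<alpha> * (\<integral>\<^sup>+y. norm (f (Suc y)) \<partial>K x) + ennreal (1 - \<alpha>) * (\<integral>\<^sup>+y. norm (f y) \<partial>K x)"
    unfolding K_Suc using \<alpha> by (simp add: nn_integral_bernoulli_pmf mult.commute)
  also have "\<dots> < \<infinity>" using assms by (auto simp: integrable_iff_bounded ennreal_mult_less_top)
  finally show "(\<integral>\<^sup>+y. norm (f y) \<partial>K (Suc x)) < \<infinity>" .
qed simp

lemma P_Suc:
  assumes "integrable (K x) f" "integrable (K x) (\<lambda>y. f (Suc y))"
  shows "P f (Suc x) = \<alpha> * P (\<lambda>y. f (Suc y)) x + (1 - \<alpha>) * P f x"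
proof -
  have "P f (Suc x) = measure_pmf.expectation (bernoulli_pmf \<alpha>) (\<lambda>b. measure_pmf.expectation (map_pmf (\<lambda>y. of_bool b + y) (K x)) f)"
    unfolding P_def using integrable_K_Suc[OF assms] unfolding K_Suc by (rule integral_bind_pmf_real)
  also have "\<dots> = \<alpha> * P (\<lambda>y. f (Suc y)) x + (1 - \<alpha>) * P f x"
    using \<alpha> by (simp add: P_def)
  finally show ?thesis .
qed

lemma integrable_K3: "integrable (K x) (\<lambda>y. real y ^ 3)"
proof (induction x)
  case 0 then show ?case using pe3 by (simp add: K_0)
next
  case (Suc x)
  note I = integrable_power_le3[OF Suc]
  have "integrable (K x) (\<lambda>y. real y ^ 3 + 3 * real y ^ 2 + 3 * real y ^ 1 + 1)"
    by (intro Bochner_Integration.integrable_add integrable_mult_right I) auto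
  then have "integrable (K x) (\<lambda>y. real (Suc y) ^ 3)"
    by (rule Bochner_Integration.integrable_cong[THEN iffD1, rotated -1]) (auto simp: power3_eq_cube power2_eq_square algebra_simps)
  with Suc show ?case by (rule integrable_K_Suc)
qed

lemma integrable_K1: "integrable (K x) real" and integrable_K2: "integrable (K x) (\<lambda>y. real y ^ 2)"
  using integrable_power_le3[OF integrable_K3, of 1] integrable_power_le3[OF integrable_K3, of 2] by auto

lemma integrable_K_shift:
  "integrable (K x) (\<lambda>y. real (Suc y))" "integrable (K x) (\<lambda>y. real (Suc y) ^ 2)" "integrable (K x) (\<lambda>y. real (Suc y) ^ 3)"
proof -
  show "integrable (K x) (\<lambda>y. real (Suc y))" using integrable_K1 by simp
  have "integrable (K x) (\<lambda>y. real y ^ 2 + 2 * real y + 1)"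
    by (intro Bochner_Integration.integrable_add integrable_mult_right integrable_K1 integrable_K2) auto
  then show "integrable (K x) (\<lambda>y. real (Suc y) ^ 2)"
    by (rule Bochner_Integration.integrable_cong[THEN iffD1, rotated -1]) (auto simp: power2_eq_square algebra_simps)
  have "integrable (K x) (\<lambda>y. real y ^ 3 + 3 * real y ^ 2 + 3 * real y + 1)"
    by (intro Bochner_Integration.integrable_add integrable_mult_right integrable_K1 integrable_K2 integrable_K3) auto
  then show "integrable (K x) (\<lambda>y. real (Suc y) ^ 3)"
    by (rule Bochner_Integration.integrable_cong[THEN iffD1, rotated -1]) (auto simp: power3_eq_cube power2_eq_square algebra_simps)
qed

lemma P_1: "P real x = \<alpha> * real x + \<mu>"
proof (induction x)
  case 0 then show ?case by (simp add: P_def K_0 \<mu>_def)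
next
  case (Suc x)
  have "P (\<lambda>y. real (Suc y)) x = P real x + 1" unfolding P_def using integrable_K1 by (simp add: add.commute)
  then have "P real (Suc x) = \<alpha> * (P real x + 1) + (1 - \<alpha>) * P real x"
    using P_Suc[OF integrable_K1[of x] integrable_K_shift(1)[of x]] by simp
  then show ?case unfolding Suc by (simp add: algebra_simps)
qed

lemma P_2: "P (\<lambda>y. real y ^ 2) x = \<alpha>^2 * real x ^ 2 + (\<alpha> * (1 - \<alpha>) + 2 * \<alpha> * \<mu>) * real x + e2"
proof (induction x)
  case 0 then show ?case by (simp add: P_def K_0 e2_def)
next
  case (Suc x)
  have "P (\<lambda>y. real (Suc y) ^ 2) x = P (\<lambda>y. real y ^ 2 + 2 * real y + 1) x"
    unfolding P_def by (intro Bochner_Integration.integral_cong) (auto simp: power2_eq_square algebra_simps)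
  also have "\<dots> = P (\<lambda>y. real y ^ 2) x + 2 * P real x + 1"
    unfolding P_def using integrable_K1 integrable_K2 by simp
  finally have "P (\<lambda>y. real y ^ 2) (Suc x) = \<alpha> * (P (\<lambda>y. real y ^ 2) x + 2 * P real x + 1) + (1 - \<alpha>) * P (\<lambda>y. real y ^ 2) x"
    using P_Suc[OF integrable_K2[of x] integrable_K_shift(2)[of x]] by simp
  then show ?case unfolding Suc P_1 by (simp add: algebra_simps power2_eq_square)
qed

definition "\<beta>2 = \<alpha> * (1 - \<alpha>) + 2 * \<alpha> * \<mu>"
text \<open>\<open>\<gamma>2\<close> and \<open>\<gamma>1\<close> are the coefficients forced by
  matching powers of \<open>x\<close> in the recursion for the third moment: raising
  \<open>x\<close> by one must add \<alpha> times the expectation of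
  \<open>3 * y^2 + 3 * y + 1\<close> under \<open>K x\<close>.\<close>

definition "\<gamma>2 = (3 * \<alpha> * \<beta>2 + 3 * \<alpha>^2 - 3 * \<alpha>^3) / 2"
definition "\<gamma>1 = \<alpha> * (3 * e2 + 3 * \<mu> + 1) - \<alpha>^3 - \<gamma>2"

lemma P_3: "P (\<lambda>y. real y ^ 3) x = \<alpha>^3 * real x ^ 3 + \<gamma>2 * real x ^ 2 + \<gamma>1 * real x + e3"
proof (induction x)
  case 0 then show ?case by (simp add: P_def K_0 e3_def)
next
  case (Suc x)
  have "P (\<lambda>y. real (Suc y) ^ 3) x = P (\<lambda>y. real y ^ 3 + 3 * real y ^ 2 + 3 * real y + 1) x"
    unfolding P_def by (intro Bochner_Integration.integral_cong) (auto simp: power2_eq_square power3_eq_cube algebra_simps)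
  also have "\<dots> = P (\<lambda>y. real y ^ 3) x + 3 * P (\<lambda>y. real y ^ 2) x + 3 * P real x + 1"
    unfolding P_def using integrable_K1 integrable_K2 integrable_K3 by simp
  finally have "P (\<lambda>y. real y ^ 3) (Suc x) = P (\<lambda>y. real y ^ 3) x + \<alpha> * (3 * P (\<lambda>y. real y ^ 2) x + 3 * P real x + 1)"
    using P_Suc[OF integrable_K3[of x] integrable_K_shift(3)[of x]] by (simp add: left_diff_distrib distrib_left)
  also have "\<dots> = \<alpha>^3 * real x ^ 3 + \<gamma>2 * real x ^ 2 + \<gamma>1 * real x + e3 + \<alpha> * (3 * (\<alpha>^2 * real x ^ 2 + \<beta>2 * real x + e2) + 3 * (\<alpha> * real x + \<mu>) + 1)"
    using Suc P_2[of x] P_1[of x] by (simp add: \<beta>2_def)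
  also have "\<dots> = \<alpha>^3 * real (Suc x) ^ 3 + \<gamma>2 * real (Suc x) ^ 2 + \<gamma>1 * real (Suc x) + e3"
  proof -
    have "\<beta>2 * \<alpha> = (2 * \<gamma>2 - 3 * \<alpha>^2 + 3 * \<alpha>^3) / 3" by (simp add: \<gamma>2_def field_simps)
    moreover have "\<gamma>1 = \<alpha> * (3 * e2 + 3 * \<mu> + 1) - \<alpha>^3 - \<gamma>2" by (rule \<gamma>1_def)
    ultimately show ?thesis by (simp only: of_nat_Suc) algebra
  qed
  finally show ?case .
qed

section \<open>Contraction of increments under the transition operator\<close>

lemma P_bounded: assumes "\<And>x. \<bar>f x\<bar> \<le> C" shows "\<bar>P f x\<bar> \<le> C"
  unfolding P_def by (rule expectation_pmf_bounded) fact

text \<open>Chains started from \<open>x\<close> and \<open>x + 1\<close> can share all other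
  individuals, so after one step they differ by one exactly when the extra individual survives,
  which has probability \<alpha>. This is the source of all mixing.\<close>

lemma P_diff:
  assumes "\<And>x. \<bar>f x\<bar> \<le> C"
  shows "P f (Suc x) - P f x = \<alpha> * P (\<lambda>y. f (Suc y) - f y) x"
proof -
  have I: "integrable (K x) f" "integrable (K x) (\<lambda>y. f (Suc y))"
    using assms by (auto intro!: integrable_pmf_bounded[where C=C])
  have "P (\<lambda>y. f (Suc y) - f y) x = P (\<lambda>y. f (Suc y)) x - P f x" unfolding P_def using I by simp
  then have e: "P (\<lambda>y. f (Suc y)) x = P (\<lambda>y. f (Suc y) - f y) x + P f x" by simp
  show ?thesis unfolding P_Suc[OF I] e by (simp add: algebra_simps)
qed

lemma Pn_bounded: assumes "\<And>x. \<bar>f x\<bar> \<le> C" shows "\<bar>(P ^^ k) f x\<bar> \<le> C"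
proof (induction k arbitrary: x)
  case (Suc k) then show ?case using P_bounded[of "(P^^k) f" C] by simp
qed (use assms in simp)

lemma Pn_increment:
  assumes "\<And>x. \<bar>f x\<bar> \<le> C" shows "\<bar>(P ^^ k) f (Suc x) - (P ^^ k) f x\<bar> \<le> 2 * C * \<alpha> ^ k"
proof (induction k arbitrary: x)
  case 0 then show ?case using assms[of x] assms[of "Suc x"] by simp
next
  case (Suc k)
  have "\<bar>(P ^^ Suc k) f (Suc x) - (P ^^ Suc k) f x\<bar> = \<alpha> * \<bar>P (\<lambda>y. (P ^^ k) f (Suc y) - (P ^^ k) f y) x\<bar>"
    using P_diff[of "(P^^k) f" C x] Pn_bounded[of f C k] assms \<alpha> by (simp add: abs_mult)
  also have "\<dots> \<le> \<alpha> * (2 * C * \<alpha> ^ k)" using Suc \<alpha> by (intro mult_left_mono P_bounded) auto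
  finally show ?case by (simp add: algebra_simps)
qed

lemma Pn_lipschitz:
  assumes "\<And>x. \<bar>f x\<bar> \<le> C" shows "\<bar>(P ^^ k) f x - (P ^^ k) f y\<bar> \<le> 2 * C * \<alpha> ^ k * \<bar>real x - real y\<bar>"
proof -
  have up: "\<bar>(P ^^ k) f (y + m) - (P ^^ k) f y\<bar> \<le> 2 * C * \<alpha> ^ k * real m" for y m
  proof (induction m)
    case (Suc m)
    then show ?case using Pn_increment[of f C k "y + m"] assms by (simp add: algebra_simps)
  qed simp
  show ?thesis
  proof (cases "x \<le> y")
    case True then show ?thesis using up[of x "y - x"] by (simp add: abs_minus_commute of_nat_diff)
  next
    case False then show ?thesis using up[of y "x - y"] by (simp add: of_nat_diff)
  qed
qed

section \<open>Laws of the chain from an arbitrary start and the limits of their moments\<close>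

primrec law :: "nat pmf \<Rightarrow> nat \<Rightarrow> nat pmf" where
  "law p 0 = p"
| "law p (Suc k) = bind_pmf (law p k) K"

lemma expectation_law:
  assumes "\<And>x. \<bar>f x\<bar> \<le> C"
  shows "measure_pmf.expectation (law p k) f = measure_pmf.expectation p ((P ^^ k) f)"
  using assms
proof (induction k arbitrary: f)
  case (Suc k)
  have "measure_pmf.expectation (law p (Suc k)) f = measure_pmf.expectation (law p k) (P f)"
    using integral_bind_pmf_real[of "law p k" K f] integrable_pmf_bounded[of f C] Suc.prems by (simp add: P_def[abs_def])
  then show ?case using Suc.IH[of "P f"] P_bounded[of f C] Suc.prems by (simp add: funpow_swap1)
qed simp

lemma law_moment_step:
  assumes "integrable (measure_pmf p) (\<lambda>x. real x ^ 3)"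
  shows "integrable (measure_pmf (bind_pmf p K)) (\<lambda>x. real x ^ 3)"
proof (rule integrableI_bounded)
  have I: "integrable (measure_pmf p) (\<lambda>x. P (\<lambda>y. real y ^ 3) x)"
    unfolding P_3 using integrable_power_le3[OF assms, of 2] integrable_power_le3[OF assms, of 1] assms by auto
  have nn: "0 \<le> P (\<lambda>y. real y ^ 3) x" for x unfolding P_def by simp
  have "(\<integral>\<^sup>+x. norm (real x ^ 3) \<partial>bind_pmf p K) = (\<integral>\<^sup>+x. (\<integral>\<^sup>+y. ennreal (real y ^ 3) \<partial>K x) \<partial>p)" by simp
  also have "\<dots> = (\<integral>\<^sup>+x. ennreal (P (\<lambda>y. real y ^ 3) x) \<partial>p)"
    unfolding P_def by (intro nn_integral_cong nn_integral_eq_integral integrable_K3) auto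
  also have "\<dots> < \<infinity>" using I nn by (simp add: nn_integral_eq_integral)
  finally show "(\<integral>\<^sup>+x. norm (real x ^ 3) \<partial>bind_pmf p K) < \<infinity>" .
qed simp

lemma integrable_law3:
  assumes "integrable (measure_pmf p) (\<lambda>x. real x ^ 3)"
  shows "integrable (measure_pmf (law p k)) (\<lambda>x. real x ^ 3)"
  by (induction k) (use assms law_moment_step in auto)

text \<open>Fixed points of the affine recurrences for the first three moments. They are defined
  before the stationary law is available and identified with its moments in
  \<open>stat_law_moments\<close>.\<close>

definition "l1 = \<mu> / (1 - \<alpha>)"
definition "l2 = (\<beta>2 * l1 + e2) / (1 - \<alpha>^2)"
definition "l3 = (\<gamma>2 * l2 + \<gamma>1 * l1 + e3) / (1 - \<alpha>^3)"

text \<open>The recurrence for each moment is driven by the lower ones, so the limits are obtained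
  in increasing order. They do not depend on the initial law.\<close>

lemma law_moments_tendsto:
  assumes p: "integrable (measure_pmf p) (\<lambda>x. real x ^ 3)"
  shows "(\<lambda>k. measure_pmf.expectation (law p k) real) \<longlonglongrightarrow> l1"
    and "(\<lambda>k. measure_pmf.expectation (law p k) (\<lambda>x. real x ^ 2)) \<longlonglongrightarrow> l2"
    and "(\<lambda>k. measure_pmf.expectation (law p k) (\<lambda>x. real x ^ 3)) \<longlonglongrightarrow> l3"
proof -
  define m where "m j k = measure_pmf.expectation (law p k) (\<lambda>x. real x ^ j)" for j k
  note I3 = integrable_law3[OF p]
  have I: "integrable (law p k) real" "integrable (law p k) (\<lambda>x. real x ^ 2)" for k
    using integrable_power_le3[OF I3, of 1] integrable_power_le3[OF I3, of 2] by auto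
  have s: "m j (Suc k) = measure_pmf.expectation (law p k) (P (\<lambda>y. real y ^ j))" if "j \<le> 3" for j k
    unfolding m_def law.simps P_def[abs_def]
    using integral_bind_pmf_real[of "law p k" K "\<lambda>x. real x ^ j"] integrable_power_le3[OF I3[of "Suc k"] that] by simp
  have r1: "m 1 (Suc k) = \<alpha> * m 1 k + \<mu>" for k
    using s[of 1 k] I by (simp add: P_1[abs_def] m_def)
  have r2: "m 2 (Suc k) = \<alpha>^2 * m 2 k + (\<beta>2 * m 1 k + e2)" for k
    using s[of 2 k] I by (simp add: P_2[abs_def] m_def \<beta>2_def)
  have r3: "m 3 (Suc k) = \<alpha>^3 * m 3 k + (\<gamma>2 * m 2 k + \<gamma>1 * m 1 k + e3)" for k
    using s[of 3 k] I I3 by (simp add: P_3[abs_def] m_def)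
  have a: "\<bar>\<alpha>^2\<bar> < 1" "\<bar>\<alpha>^3\<bar> < 1" "\<bar>\<alpha>\<bar> < 1" using \<alpha> by (auto simp: power_less_one_iff)
  have t1: "m 1 \<longlonglongrightarrow> l1" unfolding l1_def by (rule LIMSEQ_affine_recurrence[where u="m 1", OF a(3) r1]) simp
  have t2: "m 2 \<longlonglongrightarrow> l2" unfolding l2_def by (rule LIMSEQ_affine_recurrence[where u="m 2", OF a(1) r2]) (intro tendsto_intros t1)
  have t3: "m 3 \<longlonglongrightarrow> l3" unfolding l3_def by (rule LIMSEQ_affine_recurrence[where u="m 3", OF a(2) r3]) (intro tendsto_intros t1 t2)
  show "(\<lambda>k. measure_pmf.expectation (law p k) real) \<longlonglongrightarrow> l1"
    "(\<lambda>k. measure_pmf.expectation (law p k) (\<lambda>x. real x ^ 2)) \<longlonglongrightarrow> l2"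
    "(\<lambda>k. measure_pmf.expectation (law p k) (\<lambda>x. real x ^ 3)) \<longlonglongrightarrow> l3"
    using t1 t2 t3 by (simp_all add: m_def[abs_def])
qed

section \<open>Existence, uniqueness and moments of the stationary law\<close>

abbreviation "law0 \<equiv> law (return_pmf 0)"

lemma law0_moments:
  shows "(\<lambda>k. measure_pmf.expectation (law0 k) real) \<longlonglongrightarrow> l1"
    and "(\<lambda>k. measure_pmf.expectation (law0 k) (\<lambda>x. real x ^ 3)) \<longlonglongrightarrow> l3"
  by (rule law_moments_tendsto, simp add: integrable_measure_pmf_finite)+

text \<open>Two successive terms differ by the average of \<open>(P ^^ k) f y - (P ^^ k) f 0\<close>
  over one innovation \<open>y\<close>, which the Lipschitz bound makes at most
  \<open>2 * C * \<mu> * \<alpha> ^ k\<close>. The increments are therefore summable.\<close>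

lemma Pn_0_convergent:
  assumes f: "\<And>x. \<bar>f x\<bar> \<le> C" shows "convergent (\<lambda>k. (P ^^ k) f 0)"
proof -
  define a where "a k = (P ^^ k) f 0" for k
  have C: "0 \<le> C" using f[of 0] by simp
  have step: "norm (a (Suc k) - a k) \<le> 2 * C * \<mu> * \<alpha> ^ k" for k
  proof -
    have i: "integrable (K 0) (\<lambda>y. (P ^^ k) f y)"
      by (rule integrable_pmf_bounded[where C=C]) (use Pn_bounded[of f C] f in auto)
    have "a (Suc k) - a k = measure_pmf.expectation (K 0) (\<lambda>y. (P ^^ k) f y - (P ^^ k) f 0)"
      using i by (simp add: a_def P_def)
    also have "norm \<dots> \<le> measure_pmf.expectation (K 0) (\<lambda>y. norm ((P ^^ k) f y - (P ^^ k) f 0))"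
      by (rule integral_norm_bound)
    also have "\<dots> \<le> measure_pmf.expectation (K 0) (\<lambda>y. 2 * C * \<alpha> ^ k * real y)"
    proof (rule integral_mono)
      show "integrable (K 0) (\<lambda>y. norm ((P ^^ k) f y - (P ^^ k) f 0))" using i by auto
      show "integrable (K 0) (\<lambda>y. 2 * C * \<alpha> ^ k * real y)" using integrable_K1 by auto
      show "norm ((P ^^ k) f y - (P ^^ k) f 0) \<le> 2 * C * \<alpha> ^ k * real y" for y
        using Pn_lipschitz[of f C k y 0] f by simp
    qed
    also have "\<dots> = 2 * C * \<mu> * \<alpha> ^ k" using P_1[of 0] by (simp add: P_def)
    finally show ?thesis .
  qed
  have "summable (\<lambda>k. a (Suc k) - a k)"
    by (rule summable_comparison_test'[OF _ step]) (use \<alpha> in \<open>auto intro!: summable_mult summable_geometric\<close>)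
  then have "(\<lambda>n. \<Sum>k<n. a (Suc k) - a k) \<longlonglongrightarrow> (\<Sum>k. a (Suc k) - a k)" by (rule summable_LIMSEQ)
  then have "(\<lambda>n. a n - a 0) \<longlonglongrightarrow> (\<Sum>k. a (Suc k) - a k)" by (simp add: sum_lessThan_telescope)
  then have "(\<lambda>n. (a n - a 0) + a 0) \<longlonglongrightarrow> (\<Sum>k. a (Suc k) - a k) + a 0" by (intro tendsto_intros)
  then show ?thesis by (auto simp: a_def convergent_def)
qed

text \<open>The candidate masses are limits of the masses of the chain started from 0; the only
  danger is loss of mass at infinity. Bounded first moments and Markov's inequality exclude it, so
  the limits sum to one.\<close>

lemma stationary_limit_ex: "\<exists>\<pi>. \<forall>x. (\<lambda>k. pmf (law0 k) x) \<longlonglongrightarrow> pmf \<pi> x"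
proof -
  define q where "q x = lim (\<lambda>k. pmf (law0 k) x)" for x
  have "convergent (\<lambda>k. pmf (law0 k) x)" for x
  proof -
    have "pmf (law0 k) x = (P ^^ k) (indicator {x}) 0" for k
    proof -
      have "measure_pmf.expectation (law0 k) (indicator {x}) = measure_pmf.expectation (return_pmf 0) ((P ^^ k) (indicator {x}))"
        by (rule expectation_law[where C=1]) (auto simp: indicator_def)
      then show ?thesis by (simp add: measure_pmf_single)
    qed
    moreover have "convergent (\<lambda>k. (P ^^ k) (indicator {x}) 0)"
      by (rule Pn_0_convergent[where C=1]) (auto simp: indicator_def)
    ultimately show ?thesis by simp
  qed
  then have q: "(\<lambda>k. pmf (law0 k) x) \<longlonglongrightarrow> q x" for x unfolding q_def by (simp add: convergent_LIMSEQ_iff)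
  have q0: "0 \<le> q x" for x by (rule LIMSEQ_le_const[OF q]) simp
  obtain B where B: "\<And>k. measure_pmf.expectation (law0 k) real \<le> B"
    using LIMSEQ_upper_bound[OF law0_moments(1)] by blast
  have s: "(\<lambda>k. \<Sum>x\<le>N. pmf (law0 k) x) \<longlonglongrightarrow> (\<Sum>x\<le>N. q x)" for N by (intro tendsto_sum q)
  have i1: "integrable (law0 k) real" for k
  proof -
    have "integrable (law0 k) (\<lambda>x. real x ^ 3)" by (intro integrable_law3) (simp add: integrable_measure_pmf_finite)
    from integrable_power_le3[OF this, of 1] show ?thesis by simp
  qed
  have le1: "(\<Sum>x\<le>N. q x) \<le> 1" for N
  proof (rule LIMSEQ_le_const2[OF s])
    have "(\<Sum>x\<le>N. pmf (law0 k) x) = measure_pmf.prob (law0 k) {..N}" for k by (simp add: measure_measure_pmf_finite)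
    then show "\<exists>n0. \<forall>k\<ge>n0. (\<Sum>x\<le>N. pmf (law0 k) x) \<le> 1" by simp
  qed
  have ge: "1 - B / real (Suc N) \<le> (\<Sum>x\<le>N. q x)" for N
  proof (rule LIMSEQ_le_const[OF s])
    have "1 - B / real (Suc N) \<le> (\<Sum>x\<le>N. pmf (law0 k) x)" for k
    proof -
      have "1 - (\<Sum>x\<le>N. pmf (law0 k) x) = measure_pmf.prob (law0 k) {N<..}"
        using measure_pmf.prob_compl[of "{..N}" "law0 k"]
        by (simp add: Compl_eq_Diff_UNIV[symmetric] Compl_atMost measure_measure_pmf_finite)
      also have "\<dots> = measure_pmf.expectation (law0 k) (indicator {N<..})" by simp
      also have "\<dots> \<le> measure_pmf.expectation (law0 k) (\<lambda>x. real x / real (Suc N))"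
      proof (rule integral_mono)
        show "integrable (law0 k) (\<lambda>x. real x / real (Suc N))" using i1[of k] by (rule integrable_divide)
        show "indicat_real {N<..} x \<le> real x / real (Suc N)" for x by (simp add: indicator_def)
      qed (rule integrable_pmf_bounded[where C=1], simp add: indicator_def)
      also have "\<dots> \<le> B / real (Suc N)" using B[of k] by (auto intro!: divide_right_mono)
      finally show ?thesis by simp
    qed
    then show "\<exists>n0. \<forall>k\<ge>n0. 1 - B / real (Suc N) \<le> (\<Sum>x\<le>N. pmf (law0 k) x)" by blast
  qed
  have "(\<lambda>N. \<Sum>x\<le>N. q x) \<longlonglongrightarrow> 1"
  proof (rule tendsto_sandwich[where f="\<lambda>N. 1 - B / real (Suc N)" and h="\<lambda>_. 1"])
    show "(\<lambda>N. 1 - B / real (Suc N)) \<longlonglongrightarrow> 1"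
      using tendsto_diff[OF tendsto_const[of 1] LIMSEQ_Suc[OF lim_const_over_n[of B]]] by simp
    show "\<forall>\<^sub>F N in sequentially. 1 - B / real (Suc N) \<le> (\<Sum>x\<le>N. q x)" by (rule always_eventually, rule allI, rule ge)
    show "\<forall>\<^sub>F N in sequentially. (\<Sum>x\<le>N. q x) \<le> 1" by (rule always_eventually, rule allI, rule le1)
  qed simp
  then have sums: "q sums 1" by (simp add: sums_def_le)
  have "(\<integral>\<^sup>+x. q x \<partial>count_space UNIV) = 1"
  proof -
    have "(\<integral>\<^sup>+x. q x \<partial>count_space UNIV) = (\<Sum>x. ennreal (q x))" by (rule nn_integral_count_space_nat)
    also have "\<dots> = ennreal (suminf q)" by (rule suminf_ennreal2[OF q0 sums_summable[OF sums]])
    also have "suminf q = 1" using sums by (rule sums_unique[symmetric])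
    finally show ?thesis by simp
  qed
  then have "pmf (embed_pmf q) x = q x" for x by (intro pmf_embed_pmf q0) auto
  with q show ?thesis by (intro exI[of _ "embed_pmf q"]) simp
qed

lemma limit_tendsto:
  assumes q: "\<And>x. (\<lambda>k. pmf (law0 k) x) \<longlonglongrightarrow> pmf q x" and f: "\<And>x. \<bar>f x\<bar> \<le> C"
  shows "(\<lambda>k. (P ^^ k) f x) \<longlonglongrightarrow> measure_pmf.expectation q f"
proof -
  have "measure_pmf.expectation (law0 k) f = (P ^^ k) f 0" for k
    using expectation_law[of f C "return_pmf 0" k] f by simp
  with pmf_pointwise_imp_expectation[of law0 q f C] q f have 0: "(\<lambda>k. (P ^^ k) f 0) \<longlonglongrightarrow> measure_pmf.expectation q f" by simp
  have "(\<lambda>k. (P ^^ k) f x - (P ^^ k) f 0) \<longlonglongrightarrow> 0"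
  proof (rule Lim_null_comparison[where g="\<lambda>k. 2 * C * \<alpha> ^ k * real x"])
    show "\<forall>\<^sub>F k in sequentially. norm ((P ^^ k) f x - (P ^^ k) f 0) \<le> 2 * C * \<alpha> ^ k * real x"
      using Pn_lipschitz[of f C _ x 0] f by simp
    show "(\<lambda>k. 2 * C * \<alpha> ^ k * real x) \<longlonglongrightarrow> 0"
      using \<alpha> by (intro tendsto_mult_left_zero tendsto_mult_right_zero LIMSEQ_power_zero) auto
  qed
  from tendsto_add[OF this 0] show ?thesis by simp
qed

text \<open>The mass at time \<open>k + 1\<close> is the average, over the law at time
  \<open>k\<close>, of the bounded function sending \<open>x\<close> to \<open>pmf (K x) y\<close>;
  passing to the limit on both sides gives invariance.\<close>

lemma limit_stationary:
  assumes q: "\<And>x. (\<lambda>k. pmf (law0 k) x) \<longlonglongrightarrow> pmf q x"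
  shows "inar_stationary \<alpha> pe q"
  unfolding inar_stationary_def
proof (rule pmf_eqI)
  fix y
  have "(\<lambda>k. measure_pmf.expectation (law0 k) (\<lambda>x. pmf (K x) y)) \<longlonglongrightarrow> measure_pmf.expectation q (\<lambda>x. pmf (K x) y)"
    by (rule pmf_pointwise_imp_expectation[where C=1]) (use q in \<open>auto simp: pmf_le_1\<close>)
  then have "(\<lambda>k. pmf (law0 (Suc k)) y) \<longlonglongrightarrow> pmf (bind_pmf q K) y" by (simp add: pmf_bind)
  then show "pmf (bind_pmf q K) y = pmf q y" using LIMSEQ_Suc[OF q[of y]] by (rule LIMSEQ_unique)
qed

lemma law_stationary: "inar_stationary \<alpha> pe q \<Longrightarrow> law q k = q"
  by (induction k) (auto simp: inar_stationary_def)

text \<open>Under a stationary \<open>r\<close> the expectation of \<open>P ^^ k\<close> applied to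
  an indicator does not change with \<open>k\<close>, while pointwise it tends to a constant.
  Dominated convergence compares the two and asks for no moment of \<open>r\<close>.\<close>

lemma stationary_unique:
  assumes q: "\<And>x. (\<lambda>k. pmf (law0 k) x) \<longlonglongrightarrow> pmf q x" and r: "inar_stationary \<alpha> pe r"
  shows "r = q"
proof (rule pmf_eqI)
  fix y
  have "(\<lambda>k. measure_pmf.expectation r ((P ^^ k) (indicator {y}))) \<longlonglongrightarrow> measure_pmf.expectation r (\<lambda>_. measure_pmf.expectation q (indicator {y}))"
  proof (rule integral_dominated_convergence[where w="\<lambda>_. 1"])
    show "AE x in r. (\<lambda>k. (P ^^ k) (indicator {y}) x) \<longlonglongrightarrow> measure_pmf.expectation q (indicator {y})"
      by (intro AE_I2 limit_tendsto[where C=1] q) (auto simp: indicator_def)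
    show "AE x in r. norm ((P ^^ k) (indicator {y}) x) \<le> 1" for k
    proof (rule AE_I2)
      fix x
      have "\<bar>(P ^^ k) (indicator {y}) x\<bar> \<le> 1" by (rule Pn_bounded) (auto simp: indicator_def)
      then show "norm ((P ^^ k) (indicator {y}) x) \<le> 1" by simp
    qed
  qed auto
  moreover have "measure_pmf.expectation r ((P ^^ k) (indicator {y})) = pmf r y" for k
  proof -
    have "measure_pmf.expectation (law r k) (indicator {y}) = measure_pmf.expectation r ((P ^^ k) (indicator {y}))"
      by (rule expectation_law[where C=1]) (auto simp: indicator_def)
    then show ?thesis using law_stationary[OF r, of k] by (simp add: measure_pmf_single)
  qed
  ultimately have "pmf r y = measure_pmf.expectation q (indicator {y})"
    by (simp add: LIMSEQ_const_iff)
  then show "pmf r y = pmf q y" by (simp add: measure_pmf_single)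
qed

text \<open>Written with the same description operator as \<open>stat_moment\<close>, so that the
  moments in the covariance matrix unfold to expectations under this law.\<close>

definition stat_law :: "nat pmf" where "stat_law = (THE \<pi>. inar_stationary \<alpha> pe \<pi>)"

lemma stat_law_limit: "(\<lambda>k. pmf (law0 k) x) \<longlonglongrightarrow> pmf stat_law x" and stat_law_stationary: "inar_stationary \<alpha> pe stat_law"
proof -
  obtain q where q: "\<And>x. (\<lambda>k. pmf (law0 k) x) \<longlonglongrightarrow> pmf q x" using stationary_limit_ex by blast
  have "stat_law = q" unfolding stat_law_def
  proof (rule the_equality)
    show "inar_stationary \<alpha> pe q" by (rule limit_stationary[OF q])
    show "r = q" if "inar_stationary \<alpha> pe r" for r by (rule stationary_unique[OF q that])
  qed
  then show "(\<lambda>k. pmf (law0 k) x) \<longlonglongrightarrow> pmf stat_law x" "inar_stationary \<alpha> pe stat_law" using q limit_stationary[OF q] by simp_all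
qed

text \<open>Fatou's lemma along the chain started from 0, whose third moments converge and are
  therefore bounded.\<close>

lemma stat_law3: "integrable (measure_pmf stat_law) (\<lambda>x. real x ^ 3)"
proof (rule integrableI_bounded)
  obtain B where B: "\<And>k. measure_pmf.expectation (law0 k) (\<lambda>x. real x ^ 3) \<le> B"
    using LIMSEQ_upper_bound[OF law0_moments(2)] by blast
  have I: "integrable (law0 k) (\<lambda>x. real x ^ 3)" for k by (intro integrable_law3) (simp add: integrable_measure_pmf_finite)
  have "(\<integral>\<^sup>+x. ennreal (real x ^ 3) \<partial>stat_law) = (\<integral>\<^sup>+x. liminf (\<lambda>k. ennreal (pmf (law0 k) x * real x ^ 3)) \<partial>count_space UNIV)"
    unfolding nn_integral_measure_pmf
  proof (intro nn_integral_cong)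
    fix x
    have "(\<lambda>k. ennreal (pmf (law0 k) x * real x ^ 3)) \<longlonglongrightarrow> ennreal (pmf stat_law x * real x ^ 3)"
      by (intro tendsto_ennrealI tendsto_mult stat_law_limit tendsto_const)
    then show "ennreal (pmf stat_law x) * ennreal (real x ^ 3) = liminf (\<lambda>k. ennreal (pmf (law0 k) x * real x ^ 3))"
      by (simp add: lim_imp_Liminf ennreal_mult)
  qed
  also have "\<dots> \<le> liminf (\<lambda>k. \<integral>\<^sup>+x. ennreal (pmf (law0 k) x * real x ^ 3) \<partial>count_space UNIV)"
    by (rule nn_integral_liminf) simp
  also have "(\<lambda>k. \<integral>\<^sup>+x. ennreal (pmf (law0 k) x * real x ^ 3) \<partial>count_space UNIV) = (\<lambda>k. ennreal (measure_pmf.expectation (law0 k) (\<lambda>x. real x ^ 3)))"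
    using I by (simp add: ennreal_mult nn_integral_measure_pmf[symmetric] nn_integral_eq_integral)
  also have "liminf \<dots> \<le> ennreal B"
    by (intro Liminf_le always_eventually allI ennreal_leI B) simp
  finally have "(\<integral>\<^sup>+x. ennreal (real x ^ 3) \<partial>stat_law) < \<top>" using ennreal_less_top by (rule order.strict_trans1)
  then show "(\<integral>\<^sup>+x. ennreal (norm (real x ^ 3)) \<partial>stat_law) < \<infinity>" by simp
qed simp

text \<open>The chain started from its stationary law has constant moments, and
  \<open>law_moments_tendsto\<close> says where they converge.\<close>

lemma stat_law_moments:
  "measure_pmf.expectation stat_law real = l1" "measure_pmf.expectation stat_law (\<lambda>x. real x ^ 2) = l2"
  "measure_pmf.expectation stat_law (\<lambda>x. real x ^ 3) = l3"
  using law_moments_tendsto[OF stat_law3] unfolding law_stationary[OF stat_law_stationary] by (simp_all add: LIMSEQ_const_iff)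

lemma stat_law1: "integrable (measure_pmf stat_law) real" and stat_law2: "integrable (measure_pmf stat_law) (\<lambda>x. real x ^ 2)"
  using integrable_power_le3[OF stat_law3, of 1] integrable_power_le3[OF stat_law3, of 2] by auto

lemma stat_moment_eq: "stat_moment \<alpha> pe 1 = l1" "stat_moment \<alpha> pe 2 = l2" "stat_moment \<alpha> pe 3 = l3"
  using stat_law_moments by (simp_all add: stat_moment_def stat_law_def)

text \<open>The stationary expectation of \<open>f\<close> is the average of
  \<open>(P ^^ k) f y\<close> over stationary \<open>y\<close>. The Lipschitz bound is averaged with
  \<open>|x - y|\<close> replaced by \<open>x + y\<close>, which brings in the stationary mean
  \<open>l1\<close>.\<close>

lemma Pn_ergodic:
  assumes f: "\<And>x. \<bar>f x\<bar> \<le> C"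
  shows "\<bar>(P ^^ k) f x - measure_pmf.expectation stat_law f\<bar> \<le> 2 * C * \<alpha> ^ k * (real x + l1)"
proof -
  have C: "0 \<le> C" using f[of 0] by simp
  have i: "integrable stat_law (\<lambda>y. (P ^^ k) f y)"
    by (rule integrable_pmf_bounded[where C=C]) (use Pn_bounded[of f C] f in auto)
  have "measure_pmf.expectation stat_law f = measure_pmf.expectation stat_law ((P ^^ k) f)"
    using expectation_law[of f C stat_law k] f law_stationary[OF stat_law_stationary] by simp
  then have "(P ^^ k) f x - measure_pmf.expectation stat_law f = measure_pmf.expectation stat_law (\<lambda>y. (P ^^ k) f x - (P ^^ k) f y)"
    using i by simp
  also have "\<bar>\<dots>\<bar> \<le> measure_pmf.expectation stat_law (\<lambda>y. \<bar>(P ^^ k) f x - (P ^^ k) f y\<bar>)"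
    using integral_norm_bound[of stat_law "\<lambda>y. (P ^^ k) f x - (P ^^ k) f y"] by simp
  also have "\<dots> \<le> measure_pmf.expectation stat_law (\<lambda>y. 2 * C * \<alpha> ^ k * (real x + real y))"
  proof (rule integral_mono)
    show "integrable stat_law (\<lambda>y. \<bar>(P ^^ k) f x - (P ^^ k) f y\<bar>)" using i by auto
    show "integrable stat_law (\<lambda>y. 2 * C * \<alpha> ^ k * (real x + real y))" using stat_law1 by auto
    show "\<bar>(P ^^ k) f x - (P ^^ k) f y\<bar> \<le> 2 * C * \<alpha> ^ k * (real x + real y)" for y
    proof (rule order_trans[OF Pn_lipschitz[of f C k x y]])
      show "2 * C * \<alpha> ^ k * \<bar>real x - real y\<bar> \<le> 2 * C * \<alpha> ^ k * (real x + real y)"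
        using C \<alpha> by (intro mult_left_mono mult_nonneg_nonneg) auto
    qed (rule f)
  qed
  also have "\<dots> = 2 * C * \<alpha> ^ k * (real x + l1)" using stat_law1 stat_law_moments by simp
  finally show ?thesis .
qed

lemma law_tendsto_pi:
  fixes f :: "nat \<Rightarrow> real"
  assumes f: "\<And>x. \<bar>f x\<bar> \<le> C"
  shows "(\<lambda>k. measure_pmf.expectation (law p k) f) \<longlonglongrightarrow> measure_pmf.expectation stat_law f"
proof -
  have "(\<lambda>k. measure_pmf.expectation p ((P ^^ k) f)) \<longlonglongrightarrow> measure_pmf.expectation p (\<lambda>_. measure_pmf.expectation stat_law f)"
  proof (rule integral_dominated_convergence[where w="\<lambda>_. C"])
    show "AE x in p. (\<lambda>k. (P ^^ k) f x) \<longlonglongrightarrow> measure_pmf.expectation stat_law f"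
      by (intro AE_I2 limit_tendsto[where C=C] stat_law_limit f)
    show "AE x in p. norm ((P ^^ k) f x) \<le> C" for k
      by (intro AE_I2) (use Pn_bounded[of f C k] f in auto)
  qed auto
  then show ?thesis using expectation_law[of f C p] f by simp
qed

section \<open>Stationary variance and conditional variance\<close>

lemma l1_pos: "0 < l1" using \<mu>_pos \<alpha> by (simp add: l1_def)

text \<open>Balance of variance under stationarity: it equals \<open>\<alpha>^2\<close> times itself
  plus the mean conditional variance \<open>\<alpha> * (1 - \<alpha>) * l1 + \<sigma>2\<close>.
  Positivity of this number is what makes the matrix \<open>inar_S\<close> invertible.\<close>

lemma variance_pi: "l2 - l1^2 = (\<alpha> * l1 * (1 - \<alpha>) + \<sigma>2) / (1 - \<alpha>^2)"
proof -
  have a: "1 - \<alpha>^2 \<noteq> 0" "1 - \<alpha> \<noteq> 0" using \<alpha> by (auto simp: power2_eq_1_iff)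
  have m: "\<mu> = (1 - \<alpha>) * l1" using a by (simp add: l1_def)
  have "(l2 - l1^2) * (1 - \<alpha>^2) = \<alpha> * l1 * (1 - \<alpha>) + \<sigma>2"
  proof -
    have "l2 * (1 - \<alpha>^2) = \<beta>2 * l1 + e2" using a by (simp add: l2_def)
    then show ?thesis unfolding \<sigma>2_eq \<beta>2_def m by algebra
  qed
  with a show ?thesis by (simp add: field_simps)
qed

lemma variance_pi_pos: "0 < l2 - l1^2"
  unfolding variance_pi using \<alpha> l1_pos \<sigma>2_nonneg by (intro divide_pos_pos add_pos_nonneg mult_pos_pos) (auto simp: power_less_one_iff)

lemma K_variance: "measure_pmf.expectation (K x) (\<lambda>y. (real y - \<alpha> * real x - \<mu>)^2) = \<alpha> * (1 - \<alpha>) * real x + \<sigma>2"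
proof -
  have "measure_pmf.expectation (K x) (\<lambda>y. (real y - \<alpha> * real x - \<mu>)^2)
      = measure_pmf.expectation (K x) (\<lambda>y. real y ^ 2 - 2 * (\<alpha> * real x + \<mu>) * real y + (\<alpha> * real x + \<mu>)^2)"
    by (intro Bochner_Integration.integral_cong) (auto simp: power2_eq_square algebra_simps)
  also have "\<dots> = P (\<lambda>y. real y ^ 2) x - 2 * (\<alpha> * real x + \<mu>) * P real x + (\<alpha> * real x + \<mu>)^2"
    unfolding P_def using integrable_K1 integrable_K2 by simp
  also have "\<dots> = \<alpha> * (1 - \<alpha>) * real x + \<sigma>2"
    unfolding P_1 P_2 \<sigma>2_eq by (simp add: power2_eq_square algebra_simps)
  finally show ?thesis .
qed

lemma K_centered: "measure_pmf.expectation (K x) (\<lambda>y. real y - \<alpha> * real x - \<mu>) = 0"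
  using P_1[of x] integrable_K1 by (simp add: P_def)

lemma integrable_K_centered_sq: "integrable (K x) (\<lambda>y. (real y - \<alpha> * real x - \<mu>)^2)"
proof -
  have "integrable (K x) (\<lambda>y. real y ^ 2 - 2 * (\<alpha> * real x + \<mu>) * real y + (\<alpha> * real x + \<mu>)^2)"
    using integrable_K1 integrable_K2 by auto
  then show ?thesis
    by (rule Bochner_Integration.integrable_cong[THEN iffD1, rotated -1]) (auto simp: power2_eq_square algebra_simps)
qed

end

section \<open>The process and its Markov property\<close>

text \<open>The value of \<open>f\<close> ranges over a countable type, so the composite is
  measurable piece by piece; the product sigma-algebra of two count spaces is bypassed.\<close>

lemma measurable_count_space_combine:
  fixes h :: "'b::countable \<Rightarrow> 'c \<Rightarrow> 'd"
  assumes f: "f \<in> measurable N (count_space UNIV)" and g: "g \<in> measurable N (count_space UNIV)"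
  shows "(\<lambda>w. h (f w) (g w)) \<in> measurable N (count_space UNIV)"
proof (rule measurable_compose_countable[where f="\<lambda>i w. h i (g w)", OF _ f])
  show "(\<lambda>w. h i (g w)) \<in> measurable N (count_space UNIV)" for i
    by (rule measurable_compose[OF g]) simp
qed

text \<open>The points of measure zero form a countable union of null sets, so the distribution is
  carried by its atoms.\<close>

lemma (in prob_space) rv_pmf_ex:
  fixes U :: "'a \<Rightarrow> 'b::countable"
  assumes U: "U \<in> measurable M (count_space UNIV)"
  shows "\<exists>p. distr M (count_space UNIV) U = measure_pmf p"
proof -
  let ?D = "distr M (count_space UNIV) U"
  interpret D: prob_space ?D by (rule prob_space_distr[OF U])
  have "AE x in ?D. measure ?D {x} \<noteq> 0"
  proof (rule AE_I')
    have "(\<Union>x\<in>{x. measure ?D {x} = 0}. {x}) \<in> null_sets ?D"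
      by (rule null_sets_UN') (auto simp: null_sets_def D.emeasure_eq_measure)
    then show "{x. measure ?D {x} = 0} \<in> null_sets ?D" by simp
  qed auto
  then have "?D \<in> {M. prob_space M \<and> sets M = UNIV \<and> (AE x in M. measure M {x} \<noteq> 0)}"
    using D.prob_space_axioms by simp
  then have "measure_pmf (Abs_pmf ?D) = ?D" by (simp add: Abs_pmf_inverse)
  then show ?thesis by (intro exI[of _ "Abs_pmf ?D"]) simp
qed

lemma (in prob_space) distr_pair_pmf:
  fixes U V :: "'a \<Rightarrow> 'b::countable"
  assumes ind: "indep_var (count_space UNIV) U (count_space UNIV) V"
    and U: "distr M (count_space UNIV) U = measure_pmf p" and V: "distr M (count_space UNIV) V = measure_pmf q"
  shows "distr M (count_space UNIV) (\<lambda>\<omega>. (U \<omega>, V \<omega>)) = measure_pmf (pair_pmf p q)"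
proof -
  have cs: "count_space UNIV \<Otimes>\<^sub>M count_space UNIV = (count_space UNIV :: ('b \<times> 'b) measure)"
    by (simp add: pair_measure_countable)
  have "distr M (count_space UNIV) (\<lambda>\<omega>. (U \<omega>, V \<omega>)) = measure_pmf p \<Otimes>\<^sub>M measure_pmf q"
    using ind unfolding indep_var_distribution_eq U V cs by simp
  also have "\<dots> = measure_pmf (pair_pmf p q)"
  proof (rule measure_eqI_countable[of _ UNIV])
    have "sets (measure_pmf p \<Otimes>\<^sub>M measure_pmf q) = sets (count_space UNIV \<Otimes>\<^sub>M count_space UNIV)"
      by (intro sets_pair_measure_cong) simp_all
    then show s: "sets (measure_pmf p \<Otimes>\<^sub>M measure_pmf q) = Pow UNIV" unfolding cs by simp
    fix z :: "'b \<times> 'b"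
    obtain a b where z: "z = (a, b)" by (cases z)
    have "emeasure (measure_pmf p \<Otimes>\<^sub>M measure_pmf q) ({a} \<times> {b}) = emeasure p {a} * emeasure q {b}"
      by (intro measure_pmf.emeasure_pair_measure_Times) auto
    then show "emeasure (measure_pmf p \<Otimes>\<^sub>M measure_pmf q) {z} = emeasure (measure_pmf (pair_pmf p q)) {z}"
      by (simp add: z emeasure_pmf_single pmf_pair ennreal_mult)
  qed auto
  finally show ?thesis .
qed

locale inar_process = prob_space M + inar_kernel \<alpha> pe
  for M :: "'a measure" and \<alpha> :: real and pe :: "nat pmf" +
  fixes X0 :: "'a \<Rightarrow> nat" and eps :: "nat \<Rightarrow> 'a \<Rightarrow> nat" and xi :: "nat \<Rightarrow> nat \<Rightarrow> 'a \<Rightarrow> nat"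
  assumes indep: "indep_vars (\<lambda>_. count_space UNIV) (inar_family X0 eps xi) inar_index"
    and eps_law: "\<And>k. 1 \<le> k \<Longrightarrow> distr M (count_space UNIV) (eps k) = measure_pmf pe"
    and xi_law: "\<And>k j. 1 \<le> k \<Longrightarrow> 1 \<le> j \<Longrightarrow> distr M (count_space UNIV) (xi k j) = measure_pmf (map_pmf of_bool (bernoulli_pmf \<alpha>))"
    and X03: "integrable M (\<lambda>\<omega>. real (X0 \<omega>) ^ 3)"
begin

section \<open>Histories, innovations and the blocks of driving variables\<close>

abbreviation X :: "nat \<Rightarrow> 'a \<Rightarrow> nat" where "X \<equiv> inar X0 eps xi"
abbreviation "cs \<equiv> count_space UNIV"

text \<open>Lists of naturals form a countable type, so every function of the past is measurable and
  conditioning on the past reduces to fixing a list.\<close>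

definition hist :: "nat \<Rightarrow> 'a \<Rightarrow> nat list" where "hist k \<omega> = map (\<lambda>i. X i \<omega>) [0..<Suc k]"
text \<open>The next state with the current state frozen at \<open>x\<close>. Unlike the next state
  itself, \<open>innov (Suc k) x\<close> is independent of \<open>hist k\<close>.\<close>

definition innov :: "nat \<Rightarrow> nat \<Rightarrow> 'a \<Rightarrow> nat" where "innov k x \<omega> = (\<Sum>j\<in>{1..x}. xi k j \<omega>) + eps k \<omega>"

lemma X_Suc_innov: "X (Suc k) \<omega> = innov (Suc k) (X k \<omega>) \<omega>" by (simp add: innov_def)

lemma last_hist: "last (hist k \<omega>) = X k \<omega>" by (simp add: hist_def)
lemma nth_hist: "i \<le> k \<Longrightarrow> hist k \<omega> ! i = X i \<omega>" unfolding hist_def by (subst nth_map) (auto simp del: upt_Suc)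

text \<open>Index sets of the driving variables: \<open>past k\<close> determines the history up to
  time \<open>k\<close>, and \<open>cur k x\<close> determines \<open>innov k x\<close>.
  Disjointness of \<open>past k\<close> and \<open>cur (Suc k) x\<close> is what yields the
  independence.\<close>

definition past :: "nat \<Rightarrow> (nat + nat \<times> nat) set" where
  "past k = Inl ` {..k} \<union> Inr ` {(i, j). 1 \<le> i \<and> i \<le> k \<and> 1 \<le> j}"
definition cur :: "nat \<Rightarrow> nat \<Rightarrow> (nat + nat \<times> nat) set" where
  "cur k x = insert (Inl k) (Inr ` {(i, j). i = k \<and> 1 \<le> j \<and> j \<le> x})"

abbreviation Fam where "Fam \<equiv> inar_family X0 eps xi"
text \<open>The same recursion read on the coordinate space, which exhibits \<open>X i\<close> as a
  measurable function of the restricted family.\<close>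

abbreviation X' where "X' \<equiv> inar (\<lambda>w. w (Inl 0)) (\<lambda>k w. w (Inl k)) (\<lambda>k j w. w (Inr (k, j)))"

lemma measurable_innov':
  fixes k x :: nat and B :: "(nat + nat \<times> nat) set"
  assumes "Inr ` {(i, j). i = k \<and> 1 \<le> j \<and> j \<le> x} \<subseteq> B" "Inl k \<in> B"
  shows "(\<lambda>w. (\<Sum>j\<in>{1..x}. w (Inr (k, j))) + w (Inl k) :: nat) \<in> measurable (PiM B (\<lambda>_. cs)) cs"
  using assms
proof (induction x)
  case 0 then show ?case by (simp add: measurable_component_singleton)
next
  case (Suc x)
  have "(\<lambda>w. w (Inr (k, Suc x)) + ((\<Sum>j\<in>{1..x}. w (Inr (k, j))) + w (Inl k)) :: nat) \<in> measurable (PiM B (\<lambda>_. cs)) cs"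
  proof (rule measurable_count_space_combine[where h="(+)"])
    show "(\<lambda>w. w (Inr (k, Suc x))) \<in> measurable (PiM B (\<lambda>_. cs)) cs"
      using Suc.prems by (intro measurable_component_singleton) auto
    show "(\<lambda>w. (\<Sum>j\<in>{1..x}. w (Inr (k, j))) + w (Inl k) :: nat) \<in> measurable (PiM B (\<lambda>_. cs)) cs"
      using Suc.prems by (intro Suc.IH) auto
  qed
  then show ?case by (simp add: ac_simps)
qed

lemma measurable_X': "i \<le> k \<Longrightarrow> X' i \<in> measurable (PiM (past k) (\<lambda>_. cs)) cs"
proof (induction i)
  case 0
  have "Inl 0 \<in> past k" by (simp add: past_def)
  then show ?case by (simp add: inar.simps[abs_def] measurable_component_singleton)
next
  case (Suc i)
  have "(\<lambda>w. (\<lambda>x w. (\<Sum>j\<in>{1..x}. w (Inr (Suc i, j))) + w (Inl (Suc i)) :: nat) (X' i w) w) \<in> measurable (PiM (past k) (\<lambda>_. cs)) cs"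
  proof (rule measurable_compose_countable[where f="\<lambda>x w. (\<Sum>j\<in>{1..x}. w (Inr (Suc i, j))) + w (Inl (Suc i))" and g="X' i"])
    show "X' i \<in> measurable (PiM (past k) (\<lambda>_. cs)) cs" using Suc by simp
    show "(\<lambda>w. (\<Sum>j\<in>{1..x}. w (Inr (Suc i, j))) + w (Inl (Suc i)) :: nat) \<in> measurable (PiM (past k) (\<lambda>_. cs)) cs" for x
      using Suc.prems by (intro measurable_innov') (auto simp: past_def)
  qed
  then show ?case by simp
qed

lemma X'_eq: "i \<le> k \<Longrightarrow> X' i (restrict (\<lambda>i. Fam i \<omega>) (past k)) = X i \<omega>"
proof (induction i)
  case 0 then show ?case by (simp add: past_def inar_family_def)
next
  case (Suc i)
  have e: "X' i (restrict (\<lambda>i. Fam i \<omega>) (past k)) = X i \<omega>" by (rule Suc.IH[OF Suc_leD[OF Suc.prems]])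
  have "(\<Sum>j\<in>{1..x}. (restrict (\<lambda>i. Fam i \<omega>) (past k)) (Inr (Suc i, j))) = (\<Sum>j\<in>{1..x}. xi (Suc i) j \<omega>)" for x
    using Suc.prems by (intro sum.cong) (auto simp: past_def inar_family_def)
  moreover have "(restrict (\<lambda>i. Fam i \<omega>) (past k)) (Inl (Suc i)) = eps (Suc i) \<omega>"
    using Suc.prems by (auto simp: past_def inar_family_def)
  ultimately show ?case unfolding inar.simps e by simp
qed

lemma measurable_map_upt:
  assumes "\<And>i. i < n \<Longrightarrow> f i \<in> measurable N (cs :: nat measure)"
  shows "(\<lambda>w. map (\<lambda>i. f i w) [0..<n]) \<in> measurable N cs"
  using assms
proof (induction n)
  case (Suc n)
  have "(\<lambda>w. (\<lambda>xs x. xs @ [x]) (map (\<lambda>i. f i w) [0..<n]) (f n w)) \<in> measurable N cs"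
    by (rule measurable_count_space_combine[where h="\<lambda>xs x. xs @ [x]"]) (use Suc in auto)
  then show ?case by simp
qed simp

text \<open>Both are functions of disjoint blocks of the independent family.
  \<open>indep_var\<close> gives its two variables one value type, so the innovation is wrapped as a
  one-element list next to the history list.\<close>

lemma indep_hist_innov: "indep_var cs (hist k) cs (\<lambda>\<omega>. [innov (Suc k) x \<omega>])"
proof -
  have "indep_var (PiM (past k) (\<lambda>_. cs)) (\<lambda>\<omega>. restrict (\<lambda>i. Fam i \<omega>) (past k))
     (PiM (cur (Suc k) x) (\<lambda>_. cs)) (\<lambda>\<omega>. restrict (\<lambda>i. Fam i \<omega>) (cur (Suc k) x))"
    by (rule indep_var_restrict[OF indep]) (auto simp: past_def cur_def inar_index_def)
  from indep_var_compose[OF this, of "\<lambda>w. map (\<lambda>i. X' i w) [0..<Suc k]" cs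
      "\<lambda>w. [(\<Sum>j\<in>{1..x}. w (Inr (Suc k, j))) + w (Inl (Suc k))]" cs]
  have "indep_var cs ((\<lambda>w. map (\<lambda>i. X' i w) [0..<Suc k]) \<circ> (\<lambda>\<omega>. restrict (\<lambda>i. Fam i \<omega>) (past k)))
     cs ((\<lambda>w. [(\<Sum>j\<in>{1..x}. w (Inr (Suc k, j))) + w (Inl (Suc k))]) \<circ> (\<lambda>\<omega>. restrict (\<lambda>i. Fam i \<omega>) (cur (Suc k) x)))"
    by (simp add: measurable_map_upt measurable_X' measurable_compose[OF measurable_innov', where g="\<lambda>x. [x]"] cur_def del: upt_Suc)
  moreover have "(\<lambda>w. map (\<lambda>i. X' i w) [0..<Suc k]) \<circ> (\<lambda>\<omega>. restrict (\<lambda>i. Fam i \<omega>) (past k)) = hist k"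
    by (auto simp: fun_eq_iff hist_def X'_eq simp del: upt_Suc)
  moreover have "(\<lambda>w. [(\<Sum>j\<in>{1..x}. w (Inr (Suc k, j))) + w (Inl (Suc k))]) \<circ> (\<lambda>\<omega>. restrict (\<lambda>i. Fam i \<omega>) (cur (Suc k) x)) = (\<lambda>\<omega>. [innov (Suc k) x \<omega>])"
    by (auto simp: fun_eq_iff innov_def cur_def inar_family_def intro!: sum.cong)
  ultimately show ?thesis by simp
qed

text \<open>Induction over the individuals mirrors \<open>K_Suc\<close>: the thinning variable of
  the added individual is independent of the innovation built from the others.\<close>

lemma innov_law: "1 \<le> k \<Longrightarrow> distr M cs (innov k x) = measure_pmf (K x)"
proof (induction x)
  case 0 then show ?case by (simp add: innov_def[abs_def] eps_law K_0)
next
  case (Suc x)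
  have "indep_var (PiM {Inr (k, Suc x)} (\<lambda>_. cs)) (\<lambda>\<omega>. restrict (\<lambda>i. Fam i \<omega>) {Inr (k, Suc x)})
     (PiM (cur k x) (\<lambda>_. cs)) (\<lambda>\<omega>. restrict (\<lambda>i. Fam i \<omega>) (cur k x))"
    using Suc.prems by (intro indep_var_restrict[OF indep]) (auto simp: cur_def inar_index_def)
  from indep_var_compose[OF this, of "\<lambda>w. w (Inr (k, Suc x))" cs
      "\<lambda>w. (\<Sum>j\<in>{1..x}. w (Inr (k, j))) + w (Inl k)" cs]
  have "indep_var cs ((\<lambda>w. w (Inr (k, Suc x))) \<circ> (\<lambda>\<omega>. restrict (\<lambda>i. Fam i \<omega>) {Inr (k, Suc x)}))
     cs ((\<lambda>w. (\<Sum>j\<in>{1..x}. w (Inr (k, j))) + w (Inl k)) \<circ> (\<lambda>\<omega>. restrict (\<lambda>i. Fam i \<omega>) (cur k x)))"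
    by (auto intro!: measurable_component_singleton measurable_innov' simp: cur_def)
  moreover have "(\<lambda>w. w (Inr (k, Suc x))) \<circ> (\<lambda>\<omega>. restrict (\<lambda>i. Fam i \<omega>) {Inr (k, Suc x)}) = xi k (Suc x)"
    by (auto simp: fun_eq_iff inar_family_def)
  moreover have "(\<lambda>w. (\<Sum>j\<in>{1..x}. w (Inr (k, j))) + w (Inl k)) \<circ> (\<lambda>\<omega>. restrict (\<lambda>i. Fam i \<omega>) (cur k x)) = innov k x"
    using Suc.prems by (auto simp: fun_eq_iff innov_def cur_def inar_family_def intro!: sum.cong)
  ultimately have ind: "indep_var cs (xi k (Suc x)) cs (innov k x)" by simp
  note J = distr_pair_pmf[OF ind xi_law Suc.IH]
  have m: "(\<lambda>\<omega>. (xi k (Suc x) \<omega>, innov k x \<omega>)) \<in> measurable M cs"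
    by (rule measurable_count_space_combine[where h="\<lambda>h i. (h, i)", OF indep_var_rv1[OF ind] indep_var_rv2[OF ind]])
  have "distr M cs (innov k (Suc x)) = distr M cs ((\<lambda>(b, y). b + y) \<circ> (\<lambda>\<omega>. (xi k (Suc x) \<omega>, innov k x \<omega>)))"
    by (rule distr_cong) (auto simp: innov_def)
  also have "\<dots> = distr (distr M cs (\<lambda>\<omega>. (xi k (Suc x) \<omega>, innov k x \<omega>))) cs (\<lambda>(b, y). b + y)"
    by (rule distr_distr[symmetric]) (use m in auto)
  also have "\<dots> = measure_pmf (map_pmf (\<lambda>(b, y). b + y) (pair_pmf (map_pmf of_bool (bernoulli_pmf \<alpha>)) (K x)))"
    using J Suc.prems by (simp add: map_pmf_rep_eq)
  also have "map_pmf (\<lambda>(b, y). b + y) (pair_pmf (map_pmf of_bool (bernoulli_pmf \<alpha>)) (K x)) = K (Suc x)"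
    unfolding K_Suc by (simp add: pair_pmf_def map_pmf_def bind_assoc_pmf bind_return_pmf)
  finally show ?case .
qed

section \<open>The Markov property and the marginal laws\<close>

lemma measurable_hist [measurable]: "hist k \<in> measurable M cs"
  using indep_hist_innov indep_var_rv1 by blast

lemma measurable_of_hist: "(\<lambda>\<omega>. u (hist k \<omega>)) \<in> measurable M cs"
  by (rule measurable_compose[OF measurable_hist]) simp

lemma measurable_X [measurable]: "X k \<in> measurable M cs"
  using measurable_of_hist[of last k] by (simp add: last_hist)

definition hp :: "nat \<Rightarrow> nat list pmf" where "hp k = (SOME p. distr M cs (hist k) = measure_pmf p)"

lemma distr_hist: "distr M cs (hist k) = measure_pmf (hp k)"
  unfolding hp_def by (rule someI_ex[OF rv_pmf_ex[OF measurable_hist]])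

lemma distr_joint: "distr M cs (\<lambda>\<omega>. (hist k \<omega>, X (Suc k) \<omega>)) = measure_pmf (bind_pmf (hp k) (\<lambda>h. map_pmf (Pair h) (K (last h))))"
proof (rule measure_eqI_countable[of _ UNIV])
  fix z :: "nat list \<times> nat"
  obtain h y where z: "z = (h, y)" by (cases z)
  have m: "(\<lambda>\<omega>. (hist k \<omega>, X (Suc k) \<omega>)) \<in> measurable M cs"
    by (rule measurable_count_space_combine[where h="\<lambda>h i. (h, i)"]) measurable
  have m': "(\<lambda>\<omega>. (hist k \<omega>, [innov (Suc k) x \<omega>])) \<in> measurable M cs" for x
    by (rule measurable_count_space_combine[where h="\<lambda>h i. (h, i)", OF measurable_hist indep_var_rv2[OF indep_hist_innov]])
  have l: "distr M cs (\<lambda>\<omega>. [innov (Suc k) x \<omega>]) = measure_pmf (map_pmf (\<lambda>y. [y]) (K x))" for x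
  proof -
    have "(\<lambda>\<omega>. hd [innov (Suc k) x \<omega>]) \<in> measurable M cs"
      by (rule measurable_compose[OF indep_var_rv2[OF indep_hist_innov]]) simp
    then have "innov (Suc k) x \<in> measurable M cs" by simp
    then have "distr M cs (\<lambda>\<omega>. [innov (Suc k) x \<omega>]) = distr (distr M cs (innov (Suc k) x)) cs (\<lambda>y. [y])"
      by (subst distr_distr) (auto simp: comp_def)
    then show ?thesis by (simp add: innov_law map_pmf_rep_eq)
  qed
  \<comment> \<open>On the event that the history is \<open>h\<close> the current state is
    \<open>last h\<close>, so the random number of summands may be frozen there; only afterwards is
    independence applied.\<close>
  have "emeasure (distr M cs (\<lambda>\<omega>. (hist k \<omega>, X (Suc k) \<omega>))) {z} = emeasure (distr M cs (\<lambda>\<omega>. (hist k \<omega>, [innov (Suc k) (last h) \<omega>]))) {(h, [y])}"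
    unfolding z by (subst (1 2) emeasure_distr) (use m m' in \<open>auto simp: X_Suc_innov last_hist intro!: arg_cong[where f="emeasure M"] simp del: inar.simps\<close>)
  also have "\<dots> = pmf (hp k) h * pmf (K (last h)) y"
    unfolding distr_pair_pmf[OF indep_hist_innov distr_hist l]
    using pmf_map_inj'[of "\<lambda>y. [y]" "K (last h)" y] by (simp add: emeasure_pmf_single pmf_pair inj_on_def)
  also have "\<dots> = pmf (bind_pmf (hp k) (\<lambda>h. map_pmf (Pair h) (K (last h)))) (h, y)"
  proof -
    have p: "pmf (map_pmf (Pair h') (K (last h'))) (h, y) = (if h' = h then pmf (K (last h)) y else 0)" for h'
    proof (cases "h' = h")
      case True then show ?thesis using pmf_map_inj'[of "Pair h" "K (last h)" y] by (simp add: inj_on_def)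
    next
      case False then show ?thesis by (auto simp: pmf_eq_0_set_pmf)
    qed
    show ?thesis unfolding pmf_bind p
      by (subst integral_measure_pmf_real[where A="{h}"]) (auto split: if_splits)
  qed
  finally show "emeasure (distr M cs (\<lambda>\<omega>. (hist k \<omega>, X (Suc k) \<omega>))) {z} = emeasure (measure_pmf (bind_pmf (hp k) (\<lambda>h. map_pmf (Pair h) (K (last h))))) {z}"
    by (simp add: z emeasure_pmf_single)
qed auto

lemma measurable_joint: "(\<lambda>\<omega>. (hist k \<omega>, X (Suc k) \<omega>)) \<in> measurable M cs"
  by (rule measurable_count_space_combine[where h="\<lambda>h i. (h, i)"]) measurable

text \<open>The Markov property in integral form. The nonnegative version works without
  integrability and serves the second moments of the score; the bounded real and complex versions
  serve covariances and characteristic functions.\<close>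

lemma markov_nn:
  fixes G :: "nat list \<Rightarrow> nat \<Rightarrow> ennreal"
  shows "(\<integral>\<^sup>+\<omega>. G (hist k \<omega>) (X (Suc k) \<omega>) \<partial>M) = (\<integral>\<^sup>+\<omega>. (\<integral>\<^sup>+y. G (hist k \<omega>) y \<partial>K (X k \<omega>)) \<partial>M)"
proof -
  have "(\<integral>\<^sup>+\<omega>. G (hist k \<omega>) (X (Suc k) \<omega>) \<partial>M) = (\<integral>\<^sup>+z. G (fst z) (snd z) \<partial>distr M cs (\<lambda>\<omega>. (hist k \<omega>, X (Suc k) \<omega>)))"
    by (subst nn_integral_distr) (use measurable_joint in auto)
  also have "\<dots> = (\<integral>\<^sup>+h. (\<integral>\<^sup>+y. G h y \<partial>K (last h)) \<partial>distr M cs (hist k))"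
    unfolding distr_joint distr_hist by simp
  also have "\<dots> = (\<integral>\<^sup>+\<omega>. (\<integral>\<^sup>+y. G (hist k \<omega>) y \<partial>K (X k \<omega>)) \<partial>M)"
    by (subst nn_integral_distr) (auto simp: last_hist)
  finally show ?thesis .
qed

lemma markov_real:
  fixes G :: "nat list \<Rightarrow> nat \<Rightarrow> real"
  assumes "\<And>h y. \<bar>G h y\<bar> \<le> C"
  shows "expectation (\<lambda>\<omega>. G (hist k \<omega>) (X (Suc k) \<omega>)) = expectation (\<lambda>\<omega>. measure_pmf.expectation (K (X k \<omega>)) (G (hist k \<omega>)))"
proof -
  have "expectation (\<lambda>\<omega>. G (hist k \<omega>) (X (Suc k) \<omega>)) = (\<integral>z. G (fst z) (snd z) \<partial>distr M cs (\<lambda>\<omega>. (hist k \<omega>, X (Suc k) \<omega>)))"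
    by (subst integral_distr) (use measurable_joint in auto)
  also have "\<dots> = (\<integral>h. measure_pmf.expectation (K (last h)) (G h) \<partial>distr M cs (hist k))"
    unfolding distr_joint distr_hist
    by (subst integral_bind_pmf_real) (use assms in \<open>auto intro!: integrable_pmf_bounded[where C=C]\<close>)
  also have "\<dots> = expectation (\<lambda>\<omega>. measure_pmf.expectation (K (X k \<omega>)) (G (hist k \<omega>)))"
    by (subst integral_distr) (auto simp: last_hist)
  finally show ?thesis .
qed

lemma markov_complex:
  fixes G :: "nat list \<Rightarrow> nat \<Rightarrow> complex"
  assumes G: "\<And>h y. norm (G h y) \<le> C"
  shows "(\<integral>\<omega>. G (hist k \<omega>) (X (Suc k) \<omega>) \<partial>M) = (\<integral>\<omega>. (\<integral>y. G (hist k \<omega>) y \<partial>K (X k \<omega>)) \<partial>M)"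
proof (rule complex_eqI)
  have C: "0 \<le> C" using G[of "[]" 0] norm_ge_zero order_trans by blast
  have i1: "integrable M (\<lambda>\<omega>. G (hist k \<omega>) (X (Suc k) \<omega>))"
    by (rule integrable_const_bound[where B=C]) (use G measurable_compose[OF measurable_joint, of "\<lambda>z. G (fst z) (snd z)" borel k] in auto)
  have i2: "integrable (K x) (G h)" for x h by (rule integrable_pmf_bounded[where C=C]) (rule G)
  have i3: "integrable M (\<lambda>\<omega>. \<integral>y. G (hist k \<omega>) y \<partial>K (X k \<omega>))"
  proof (rule integrable_const_bound[where B=C])
    show "AE \<omega> in M. norm (\<integral>y. G (hist k \<omega>) y \<partial>K (X k \<omega>)) \<le> C"
    proof (rule AE_I2)
      fix \<omega>
      have "norm (\<integral>y. G (hist k \<omega>) y \<partial>K (X k \<omega>)) \<le> (\<integral>y. norm (G (hist k \<omega>) y) \<partial>K (X k \<omega>))" by (rule integral_norm_bound)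
      also have "\<dots> \<le> C" using expectation_pmf_bounded[of "\<lambda>y. norm (G (hist k \<omega>) y)" C] G by (simp add: abs_le_iff)
      finally show "norm (\<integral>y. G (hist k \<omega>) y \<partial>K (X k \<omega>)) \<le> C" .
    qed
    show "(\<lambda>\<omega>. \<integral>y. G (hist k \<omega>) y \<partial>K (X k \<omega>)) \<in> borel_measurable M"
      using measurable_compose[OF measurable_hist, of "\<lambda>h. \<integral>y. G h y \<partial>K (last h)" borel k] by (simp add: last_hist)
  qed
  have R: "\<bar>Re (G h y)\<bar> \<le> C" "\<bar>Im (G h y)\<bar> \<le> C" for h y
    using G abs_Re_le_cmod abs_Im_le_cmod order_trans by blast+
  show "Re (\<integral>\<omega>. G (hist k \<omega>) (X (Suc k) \<omega>) \<partial>M) = Re (\<integral>\<omega>. (\<integral>y. G (hist k \<omega>) y \<partial>K (X k \<omega>)) \<partial>M)"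
    using i1 i2 i3 markov_real[of "\<lambda>h y. Re (G h y)" C k] R by (simp flip: integral_Re)
  show "Im (\<integral>\<omega>. G (hist k \<omega>) (X (Suc k) \<omega>) \<partial>M) = Im (\<integral>\<omega>. (\<integral>y. G (hist k \<omega>) y \<partial>K (X k \<omega>)) \<partial>M)"
    using i1 i2 i3 markov_real[of "\<lambda>h y. Im (G h y)" C k] R by (simp flip: integral_Im)
qed

definition p0 :: "nat pmf" where "p0 = (SOME p. distr M cs (X 0) = measure_pmf p)"

lemma distr_X: "distr M cs (X k) = measure_pmf (law p0 k)"
proof (induction k)
  case 0
  show ?case unfolding p0_def law.simps by (rule someI_ex[OF rv_pmf_ex[OF measurable_X]])
next
  case (Suc k)
  have l: "map_pmf last (hp k) = law p0 k"
  proof -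
    have "measure_pmf (map_pmf last (hp k)) = distr (distr M cs (hist k)) cs last" by (simp add: map_pmf_rep_eq distr_hist)
    also have "\<dots> = distr M cs (X k)" by (subst distr_distr) (auto simp: comp_def last_hist)
    finally show ?thesis using Suc by (simp add: measure_pmf_inject)
  qed
  have "distr M cs (X (Suc k)) = distr (distr M cs (\<lambda>\<omega>. (hist k \<omega>, X (Suc k) \<omega>))) cs snd"
    by (subst distr_distr) (use measurable_joint in \<open>auto simp: comp_def simp del: inar.simps\<close>)
  also have "\<dots> = measure_pmf (map_pmf snd (bind_pmf (hp k) (\<lambda>h. map_pmf (Pair h) (K (last h)))))"
    unfolding distr_joint by (simp only: map_pmf_rep_eq)
  also have "map_pmf snd (bind_pmf (hp k) (\<lambda>h. map_pmf (Pair h) (K (last h)))) = bind_pmf (map_pmf last (hp k)) K"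
    by (simp add: map_bind_pmf map_pmf_comp bind_map_pmf)
  finally show ?case by (simp add: l)
qed

lemma p03: "integrable (measure_pmf p0) (\<lambda>x. real x ^ 3)"
proof -
  have "integrable (distr M cs (X 0)) (\<lambda>x. real x ^ 3)"
    using X03 measurable_X[of 0] by (subst integrable_distr_eq) (auto simp: inar.simps[abs_def])
  then show ?thesis by (simp add: distr_X)
qed

lemma expectation_X:
  fixes f :: "nat \<Rightarrow> real" shows "expectation (\<lambda>\<omega>. f (X k \<omega>)) = measure_pmf.expectation (law p0 k) f"
  by (subst distr_X[symmetric], subst integral_distr) auto

lemma integrable_X:
  fixes f :: "nat \<Rightarrow> real" shows "integrable M (\<lambda>\<omega>. f (X k \<omega>)) \<longleftrightarrow> integrable (measure_pmf (law p0 k)) f"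
  by (subst distr_X[symmetric], subst integrable_distr_eq) auto

end

section \<open>Law of large numbers\<close>

lemma LIMSEQ_cesaro:
  fixes u :: "nat \<Rightarrow> real"
  assumes u: "u \<longlonglongrightarrow> l"
  shows "(\<lambda>n. (\<Sum>k<n. u k) / real n) \<longlonglongrightarrow> l"
proof -
  have "(\<lambda>n. (\<Sum>k<n. u k - l) / real n) \<longlonglongrightarrow> 0"
  proof (rule LIMSEQ_I)
    fix e :: real assume e: "0 < e"
    obtain N where N: "\<And>k. k \<ge> N \<Longrightarrow> \<bar>u k - l\<bar> < e / 2" using LIMSEQ_D[OF u, of "e/2"] e by auto
    define A where "A = (\<Sum>k<N. \<bar>u k - l\<bar>)"
    have "(\<lambda>n. A / real n) \<longlonglongrightarrow> 0" by (rule lim_const_over_n)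
    from LIMSEQ_D[OF this, of "e/2"] e obtain M where M: "\<And>n. n \<ge> M \<Longrightarrow> \<bar>A / real n\<bar> < e / 2" by auto
    have "norm ((\<Sum>k<n. u k - l) / real n - 0) < e" if n: "n \<ge> max M (Suc N)" for n
    proof -
      have "\<bar>\<Sum>k<n. u k - l\<bar> \<le> (\<Sum>k<n. \<bar>u k - l\<bar>)" by (rule sum_abs)
      also have "\<dots> = A + (\<Sum>k\<in>{N..<n}. \<bar>u k - l\<bar>)"
        using n unfolding A_def by (subst sum.union_disjoint[symmetric]) (auto intro!: sum.cong)
      also have "\<dots> \<le> A + (\<Sum>k\<in>{N..<n}. e / 2)"
        using N by (intro add_left_mono sum_mono) (auto intro: less_imp_le)
      also have "\<dots> \<le> A + real n * (e / 2)" using e n by (auto simp: of_nat_diff algebra_simps)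
      finally have "\<bar>\<Sum>k<n. u k - l\<bar> / real n \<le> A / real n + e / 2"
        using n by (simp add: field_simps)
      moreover have "A / real n < e / 2" using M[of n] n abs_ge_self[of "A / real n"] by linarith
      ultimately have "\<bar>\<Sum>k<n. u k - l\<bar> / real n < e" by linarith
      then show ?thesis by (simp add: abs_divide)
    qed
    then show "\<exists>no. \<forall>n\<ge>no. norm ((\<Sum>k<n. u k - l) / real n - 0) < e" by blast
  qed
  then have "(\<lambda>n. (\<Sum>k<n. u k - l) / real n + l) \<longlonglongrightarrow> 0 + l" by (intro tendsto_intros)
  moreover have "\<forall>\<^sub>F n in sequentially. (\<Sum>k<n. u k - l) / real n + l = (\<Sum>k<n. u k) / real n"
    using eventually_gt_at_top[of 0] by eventually_elim (simp add: sum_subtractf field_simps)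
  ultimately show ?thesis by (simp add: Lim_transform_eventually)
qed

lemma (in prob_space) expectation_abs_le_sqrt:
  fixes Z :: "'a \<Rightarrow> real"
  assumes "Z \<in> borel_measurable M" "integrable M (\<lambda>\<omega>. (Z \<omega>)^2)"
  shows "integrable M Z" "expectation (\<lambda>\<omega>. \<bar>Z \<omega>\<bar>) \<le> sqrt (expectation (\<lambda>\<omega>. (Z \<omega>)^2))"
proof -
  show i: "integrable M Z" using assms by (rule square_integrable_imp_integrable)
  have "0 \<le> variance (\<lambda>\<omega>. \<bar>Z \<omega>\<bar>)" by (rule variance_positive)
  also have "\<dots> = expectation (\<lambda>\<omega>. (Z \<omega>)^2) - (expectation (\<lambda>\<omega>. \<bar>Z \<omega>\<bar>))^2"
    using i assms by (subst variance_eq) auto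
  finally show "expectation (\<lambda>\<omega>. \<bar>Z \<omega>\<bar>) \<le> sqrt (expectation (\<lambda>\<omega>. (Z \<omega>)^2))"
    by (intro real_le_rsqrt) simp
qed

lemma (in prob_space) integrable_bounded_mult:
  fixes u v :: "'a \<Rightarrow> real"
  assumes u: "\<And>\<omega>. \<bar>u \<omega>\<bar> \<le> A" "u \<in> borel_measurable M" and v: "\<And>\<omega>. \<bar>v \<omega>\<bar> \<le> B" "v \<in> borel_measurable M"
  shows "integrable M (\<lambda>\<omega>. u \<omega> * v \<omega>)"
proof (rule integrable_const_bound[where B="A * B"])
  have "0 \<le> A" using u(1)[of undefined] by simp
  then show "AE \<omega> in M. norm (u \<omega> * v \<omega>) \<le> A * B"
    unfolding real_norm_def abs_mult by (intro AE_I2 mult_mono u v) auto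
qed (use u v in measurable)

context inar_process begin

section \<open>Expectations of functions of cubic growth\<close>

abbreviation "stat_mean f \<equiv> measure_pmf.expectation stat_law f"

definition cubic_bound :: "real \<Rightarrow> nat \<Rightarrow> real" where "cubic_bound C x = C * (1 + real x ^ 3)"

text \<open>The growth class of the compensator: the square of an affine factor times an affine
  conditional variance. The common majorant lets tails be compared through third moments
  alone.\<close>

definition cubic :: "(nat \<Rightarrow> real) \<Rightarrow> bool" where
  "cubic f \<longleftrightarrow> (\<exists>C. \<forall>x. \<bar>f x\<bar> \<le> cubic_bound C x)"

lemma cubicD:
  assumes "cubic f" obtains C where "0 \<le> C" "\<And>x. \<bar>f x\<bar> \<le> cubic_bound C x"
proof -
  obtain C where C: "\<And>x. \<bar>f x\<bar> \<le> cubic_bound C x" using assms by (auto simp: cubic_def)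
  have "0 \<le> C" using C[of 0] by (simp add: cubic_bound_def)
  with C that show ?thesis by blast
qed

lemma integrable_cubic:
  assumes f: "cubic f" and p: "integrable (measure_pmf p) (\<lambda>x. real x ^ 3)"
  shows "integrable (measure_pmf p) f"
proof -
  obtain C where C: "\<And>x. \<bar>f x\<bar> \<le> cubic_bound C x" using cubicD[OF f] by blast
  show ?thesis
  proof (rule Bochner_Integration.integrable_bound[where f="cubic_bound C"])
    show "integrable (measure_pmf p) (cubic_bound C)" using p by (simp add: cubic_bound_def[abs_def])
    show "AE x in measure_pmf p. norm (f x) \<le> norm (cubic_bound C x)"
      using C by (intro AE_I2) (metis abs_ge_self order_trans real_norm_def)
  qed simp
qed

lemma integrable_cubic_pi: "cubic f \<Longrightarrow> integrable stat_law f" by (rule integrable_cubic[OF _ stat_law3])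
lemma integrable_cubic_law: "cubic f \<Longrightarrow> integrable (law p0 k) f" by (rule integrable_cubic[OF _ integrable_law3[OF p03]])
lemma integrable_cubic_X: "cubic f \<Longrightarrow> integrable M (\<lambda>\<omega>. f (X k \<omega>))" using integrable_cubic_law by (simp add: integrable_X)

lemma cubic_tail_pi:
  assumes "cubic f" shows "(\<lambda>L. stat_mean (\<lambda>x. f x * indicator {L<..} x)) \<longlonglongrightarrow> 0"
proof -
  have "(\<lambda>L. stat_mean (\<lambda>x. f x * indicator {L<..} x)) \<longlonglongrightarrow> stat_mean (\<lambda>x. 0)"
  proof (rule integral_dominated_convergence[where w="\<lambda>x. \<bar>f x\<bar>"])
    show "integrable stat_law (\<lambda>x. \<bar>f x\<bar>)" using integrable_cubic_pi[OF assms] by auto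
    show "AE x in stat_law. (\<lambda>L. f x * indicator {L<..} x) \<longlonglongrightarrow> 0"
    proof (rule AE_I2)
      fix x :: nat
      have "\<forall>\<^sub>F L in sequentially. f x * indicator {L<..} x = 0"
        using eventually_ge_at_top[of x] by eventually_elim auto
      then show "(\<lambda>L. f x * indicator {L<..} x) \<longlonglongrightarrow> 0" by (rule tendsto_eventually)
    qed
  qed (auto simp: indicator_def)
  then show ?thesis by simp
qed

lemma trunc_bounded: "\<exists>C. \<forall>x. \<bar>f x * indicator {..L::nat} x :: real\<bar> \<le> C"
proof (intro exI allI)
  show "\<bar>f x * indicator {..L} x\<bar> \<le> Max ((\<lambda>x. \<bar>f x\<bar>) ` {..L})" for x
    by (cases "x \<le> L") (auto intro!: Max_ge order_trans[OF abs_ge_zero[of "f 0"] Max_ge])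
qed

lemma cubic_trunc: "cubic f \<Longrightarrow> cubic (\<lambda>x. f x * indicator A x)"
  unfolding cubic_def by (auto simp: indicator_def cubic_bound_def) (smt (verit) mult_nonneg_nonneg of_nat_0_le_iff zero_le_power)+

lemma cubic_abs: "cubic f \<Longrightarrow> cubic (\<lambda>x. \<bar>f x\<bar>)" by (simp add: cubic_def)

lemma cubic_cubic_bound: "cubic (cubic_bound C)"
  unfolding cubic_def by (rule exI[of _ "\<bar>C\<bar>"]) (auto simp: cubic_bound_def abs_mult)

lemma split_trunc:
  fixes f :: "nat \<Rightarrow> real"
  shows "f x = f x * indicator {..L} x + f x * indicator {L<..} x" by (auto simp: indicator_def)

lemma expectation_cubic_split:
  assumes f: "cubic f" and p: "integrable (measure_pmf p) (\<lambda>x. real x ^ 3)"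
  shows "measure_pmf.expectation p f = measure_pmf.expectation p (\<lambda>x. f x * indicator {..L} x) + measure_pmf.expectation p (\<lambda>x. f x * indicator {L<..} x)"
proof -
  have "measure_pmf.expectation p f = measure_pmf.expectation p (\<lambda>x. f x * indicator {..L} x + f x * indicator {L<..} x)"
    by (intro Bochner_Integration.integral_cong refl split_trunc)
  also have "\<dots> = measure_pmf.expectation p (\<lambda>x. f x * indicator {..L} x) + measure_pmf.expectation p (\<lambda>x. f x * indicator {L<..} x)"
    by (intro Bochner_Integration.integral_add integrable_cubic[OF cubic_trunc[OF f] p])
  finally show ?thesis .
qed

lemma law_cubic_bound_tendsto: "(\<lambda>k. measure_pmf.expectation (law p0 k) (cubic_bound C)) \<longlonglongrightarrow> stat_mean (cubic_bound C)"
proof -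
  have e: "measure_pmf.expectation p (cubic_bound C) = C * (1 + measure_pmf.expectation p (\<lambda>x. real x ^ 3))"
    if "integrable (measure_pmf p) (\<lambda>x. real x ^ 3)" for p
    unfolding cubic_bound_def[abs_def] using that by simp
  show ?thesis unfolding e[OF integrable_law3[OF p03]] e[OF stat_law3] stat_law_moments
    by (intro tendsto_intros law_moments_tendsto p03)
qed

text \<open>The tail is the full expectation minus that of a bounded truncation, and both converge.
  With \<open>C\<close> nonnegative this plays the role of uniform integrability.\<close>

lemma law_cubic_bound_tail:
  "(\<lambda>k. measure_pmf.expectation (law p0 k) (\<lambda>x. cubic_bound C x * indicator {L<..} x)) \<longlonglongrightarrow> stat_mean (\<lambda>x. cubic_bound C x * indicator {L<..} x)"
proof -
  obtain D where D: "\<And>x. \<bar>cubic_bound C x * indicator {..L} x\<bar> \<le> D" using trunc_bounded by blast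
  have "(\<lambda>k. measure_pmf.expectation (law p0 k) (cubic_bound C) - measure_pmf.expectation (law p0 k) (\<lambda>x. cubic_bound C x * indicator {..L} x))
     \<longlonglongrightarrow> stat_mean (cubic_bound C) - stat_mean (\<lambda>x. cubic_bound C x * indicator {..L} x)"
    by (intro tendsto_diff law_cubic_bound_tendsto law_tendsto_pi[where C=D] D)
  then show ?thesis
    unfolding expectation_cubic_split[OF cubic_cubic_bound integrable_law3[OF p03], where L=L]
      expectation_cubic_split[OF cubic_cubic_bound stat_law3, where L=L] by simp
qed

text \<open>Below level \<open>L\<close> the function is bounded and mixing applies. Above it the
  tails under both laws are dominated by tails of \<open>cubic_bound C\<close>, of which the
  stationary one is small and the others are eventually close to it.\<close>

lemma law_cubic_tendsto:
  assumes f: "cubic f"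
  shows "(\<lambda>k. expectation (\<lambda>\<omega>. f (X k \<omega>))) \<longlonglongrightarrow> stat_mean f"
  unfolding expectation_X
proof (rule LIMSEQ_I)
  fix e :: real assume e: "0 < e"
  obtain C where C: "0 \<le> C" "\<And>x. \<bar>f x\<bar> \<le> cubic_bound C x" using cubicD[OF f] by blast
  define w where "w L x = cubic_bound C x * indicator {L<..} x" for L x
  have cw: "cubic (w L)" for L unfolding w_def by (intro cubic_trunc cubic_cubic_bound)
  have "\<forall>\<^sub>F L in sequentially. stat_mean (w L) < e / 4"
    unfolding w_def[abs_def] by (rule order_tendstoD(2)[OF cubic_tail_pi[OF cubic_cubic_bound]]) (use e in simp)
  then obtain L where L: "stat_mean (w L) < e / 4" using eventually_happens'[OF sequentially_bot] by blast
  obtain D where D: "\<And>x. \<bar>f x * indicator {..L} x\<bar> \<le> D" using trunc_bounded by blast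
  have "\<forall>\<^sub>F k in sequentially. measure_pmf.expectation (law p0 k) (w L) < e / 4"
    using order_tendstoD(2)[OF law_cubic_bound_tail, of C L "e/4"] L by (simp add: w_def[abs_def])
  moreover have "\<forall>\<^sub>F k in sequentially. \<bar>measure_pmf.expectation (law p0 k) (\<lambda>x. f x * indicator {..L} x) - stat_mean (\<lambda>x. f x * indicator {..L} x)\<bar> < e / 2"
    using law_tendsto_pi[of "\<lambda>x. f x * indicator {..L} x" D p0] D e half_gt_zero[OF e] unfolding tendsto_iff dist_real_def by blast
  ultimately have "\<forall>\<^sub>F k in sequentially. \<bar>measure_pmf.expectation (law p0 k) f - stat_mean f\<bar> < e"
  proof eventually_elim
    case (elim k)
    have t: "\<bar>measure_pmf.expectation p (\<lambda>x. f x * indicator {L<..} x)\<bar> \<le> measure_pmf.expectation p (w L)"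
      if p: "integrable (measure_pmf p) (\<lambda>x. real x ^ 3)" for p
    proof -
      have "\<bar>measure_pmf.expectation p (\<lambda>x. f x * indicator {L<..} x)\<bar> \<le> measure_pmf.expectation p (\<lambda>x. \<bar>f x * indicator {L<..} x\<bar>)"
        using integral_norm_bound[of p "\<lambda>x. f x * indicator {L<..} x"] by simp
      also have "\<dots> \<le> measure_pmf.expectation p (w L)"
        by (intro integral_mono integrable_cubic[OF _ p] cubic_abs cubic_trunc f cw) (use C in \<open>auto simp: w_def indicator_def\<close>)
      finally show ?thesis .
    qed
    show ?case using elim L t[OF stat_law3] t[OF integrable_law3[OF p03, of k]]
      expectation_cubic_split[OF f stat_law3, where L=L] expectation_cubic_split[OF f integrable_law3[OF p03, of k], where L=L] by linarith
  qed
  then show "\<exists>no. \<forall>n\<ge>no. norm (measure_pmf.expectation (law p0 n) f - stat_mean f) < e" by (simp add: eventually_sequentially)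
qed

text \<open>The last step is removed by the Markov property and replaced by one application of
  \<open>P\<close>; the factor at time \<open>j\<close> is a function of the history and stays in
  place.\<close>

lemma expectation_two_times:
  assumes a: "\<And>x. \<bar>a x\<bar> \<le> A" and f: "\<And>x. \<bar>f x\<bar> \<le> C"
  shows "expectation (\<lambda>\<omega>. a (X j \<omega>) * f (X (j + m) \<omega>)) = expectation (\<lambda>\<omega>. a (X j \<omega>) * (P ^^ m) f (X j \<omega>))"
  using f
proof (induction m arbitrary: f)
  case (Suc m)
  have A: "0 \<le> A" using a[of 0] by simp
  have "expectation (\<lambda>\<omega>. a (X j \<omega>) * f (X (Suc (j + m)) \<omega>)) = expectation (\<lambda>\<omega>. (\<lambda>h y. a (h ! j) * f y) (hist (j + m) \<omega>) (X (Suc (j + m)) \<omega>))"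
    by (intro Bochner_Integration.integral_cong) (auto simp: nth_hist simp del: inar.simps)
  also have "\<dots> = expectation (\<lambda>\<omega>. measure_pmf.expectation (K (X (j + m) \<omega>)) (\<lambda>y. a (hist (j + m) \<omega> ! j) * f y))"
    by (rule markov_real[where C="A * C"]) (use a Suc.prems A in \<open>auto simp: abs_mult intro!: mult_mono\<close>)
  also have "\<dots> = expectation (\<lambda>\<omega>. a (X j \<omega>) * P f (X (j + m) \<omega>))"
    by (intro Bochner_Integration.integral_cong) (auto simp: nth_hist P_def)
  also have "\<dots> = expectation (\<lambda>\<omega>. a (X j \<omega>) * (P ^^ m) (P f) (X j \<omega>))"
    by (rule Suc.IH) (rule P_bounded, rule Suc.prems)
  finally show ?case by (simp add: funpow_swap1)
qed simp

section \<open>Averages along the path\<close>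

lemma measurable_fX [measurable]: "(\<lambda>\<omega>. (f :: nat \<Rightarrow> 'b::topological_space) (X k \<omega>)) \<in> borel_measurable M"
  by (rule measurable_compose[OF measurable_X]) simp

text \<open>Geometric ergodicity bounds each covariance by \<open>E * \<alpha> ^ m\<close>,
  uniformly in the starting time because first moments stay bounded. Each new term then adds a
  bounded amount to the second moment of the sum.\<close>

lemma bounded_second_moment:
  assumes f: "\<And>x. \<bar>f x\<bar> \<le> C"
  shows "\<exists>D. \<forall>n. expectation (\<lambda>\<omega>. (\<Sum>k<n. f (X k \<omega>) - stat_mean f)^2) \<le> real n * D"
proof -
  have C: "0 \<le> C" using f[of 0] by simp
  define fb where "fb x = f x - stat_mean f" for x
  have fb: "\<bar>fb x\<bar> \<le> 2 * C" for x using f[of x] expectation_pmf_bounded[of f C stat_law] f unfolding fb_def by (smt (verit))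
  have pifb: "stat_mean fb = 0" unfolding fb_def using integrable_pmf_bounded[of f C stat_law] f by (subst Bochner_Integration.integral_diff) auto
  have "(\<lambda>k. expectation (\<lambda>\<omega>. real (X k \<omega>))) \<longlonglongrightarrow> l1"
    unfolding expectation_X by (rule law_moments_tendsto(1)[OF p03])
  then obtain B where B: "\<And>k. expectation (\<lambda>\<omega>. real (X k \<omega>)) \<le> B" using LIMSEQ_upper_bound by blast
  have iX: "integrable M (\<lambda>\<omega>. real (X k \<omega>))" for k
    using integrable_power_le3[OF integrable_law3[OF p03, of k], of 1] by (simp add: integrable_X)
  \<comment> \<open>The bound \<open>2 * C\<close> on the centred function, the ergodic factor
    \<open>2 * (2 * C)\<close>, and the bound on the mean of
    \<open>real (X j \<omega>) + l1\<close>, multiplied together.\<close>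
  define E where "E = 8 * C^2 * (B + l1)"
  have cov: "expectation (\<lambda>\<omega>. fb (X j \<omega>) * fb (X (j + m) \<omega>)) \<le> E * \<alpha> ^ m" for j m
  proof -
    have "expectation (\<lambda>\<omega>. fb (X j \<omega>) * fb (X (j + m) \<omega>)) = expectation (\<lambda>\<omega>. fb (X j \<omega>) * (P ^^ m) fb (X j \<omega>))"
      by (rule expectation_two_times[OF fb fb])
    also have "\<dots> \<le> expectation (\<lambda>\<omega>. 8 * C^2 * \<alpha> ^ m * (real (X j \<omega>) + l1))"
    proof (rule integral_mono)
      show "integrable M (\<lambda>\<omega>. 8 * C^2 * \<alpha> ^ m * (real (X j \<omega>) + l1))" using iX by auto
      show "integrable M (\<lambda>\<omega>. fb (X j \<omega>) * (P ^^ m) fb (X j \<omega>))"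
        by (rule integrable_bounded_mult[where A="2 * C" and B="2 * C"]) (use fb Pn_bounded[of fb "2*C" m] in measurable)
      fix \<omega>
      have "fb (X j \<omega>) * (P ^^ m) fb (X j \<omega>) \<le> \<bar>fb (X j \<omega>)\<bar> * \<bar>(P ^^ m) fb (X j \<omega>)\<bar>" by (metis abs_ge_self abs_mult)
      also have "\<dots> \<le> (2 * C) * (2 * (2 * C) * \<alpha> ^ m * (real (X j \<omega>) + l1))"
        using Pn_ergodic[of fb "2 * C" m "X j \<omega>"] fb pifb C by (intro mult_mono) auto
      finally show "fb (X j \<omega>) * (P ^^ m) fb (X j \<omega>) \<le> 8 * C^2 * \<alpha> ^ m * (real (X j \<omega>) + l1)"
        by (simp add: power2_eq_square algebra_simps)
    qed
    also have "\<dots> = 8 * C^2 * \<alpha> ^ m * (expectation (\<lambda>\<omega>. real (X j \<omega>)) + l1)" using iX by (simp add: prob_space)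
    also have "\<dots> \<le> 8 * C^2 * \<alpha> ^ m * (B + l1)" using B[of j] \<alpha> by (intro mult_left_mono) auto
    finally show ?thesis by (simp add: E_def algebra_simps)
  qed
  have "0 \<le> expectation (\<lambda>\<omega>. real (X 0 \<omega>))" by (rule integral_nonneg_AE) simp
  then have "0 \<le> B + l1" using B[of 0] l1_pos by linarith
  then have E: "0 \<le> E" unfolding E_def by (intro mult_nonneg_nonneg) auto
  have iS: "integrable M (\<lambda>\<omega>. (\<Sum>k<n. fb (X k \<omega>)) * (\<Sum>k<m. fb (X k \<omega>)))" "integrable M (\<lambda>\<omega>. (\<Sum>k<n. fb (X k \<omega>)) * fb (X m \<omega>))"
    "integrable M (\<lambda>\<omega>. fb (X n \<omega>) * fb (X m \<omega>))" for n m
  proof -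
    have b: "\<bar>\<Sum>k<n. fb (X k \<omega>)\<bar> \<le> real n * (2 * C)" for n \<omega>
      using order_trans[OF sum_abs sum_bounded_above[of "{..<n}" "\<lambda>k. \<bar>fb (X k \<omega>)\<bar>" "2 * C"]] fb by simp
    show "integrable M (\<lambda>\<omega>. (\<Sum>k<n. fb (X k \<omega>)) * (\<Sum>k<m. fb (X k \<omega>)))"
      by (rule integrable_bounded_mult[OF b _ b]) measurable
    show "integrable M (\<lambda>\<omega>. (\<Sum>k<n. fb (X k \<omega>)) * fb (X m \<omega>))"
      by (rule integrable_bounded_mult[OF b _ fb]) measurable
    show "integrable M (\<lambda>\<omega>. fb (X n \<omega>) * fb (X m \<omega>))"
      by (rule integrable_bounded_mult[OF fb _ fb]) measurable
  qed
  \<comment> \<open>Twice the geometric sum of the covariances with the past, plus the diagonal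
    term.\<close>
  define D where "D = 2 * E / (1 - \<alpha>) + E"
  have "expectation (\<lambda>\<omega>. (\<Sum>k<n. fb (X k \<omega>))^2) \<le> real n * D" for n
  proof (induction n)
    case (Suc n)
    have "expectation (\<lambda>\<omega>. (\<Sum>k<Suc n. fb (X k \<omega>))^2) = expectation (\<lambda>\<omega>. (\<Sum>k<n. fb (X k \<omega>)) * (\<Sum>k<n. fb (X k \<omega>)) + 2 * ((\<Sum>k<n. fb (X k \<omega>)) * fb (X n \<omega>)) + fb (X n \<omega>) * fb (X n \<omega>))"
      by (intro Bochner_Integration.integral_cong) (auto simp: power2_eq_square algebra_simps)
    also have "\<dots> = expectation (\<lambda>\<omega>. (\<Sum>k<n. fb (X k \<omega>))^2) + 2 * expectation (\<lambda>\<omega>. (\<Sum>k<n. fb (X k \<omega>)) * fb (X n \<omega>)) + expectation (\<lambda>\<omega>. fb (X n \<omega>) * fb (X (n + 0) \<omega>))"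
      by (simp add: iS power2_eq_square)
    also have "expectation (\<lambda>\<omega>. (\<Sum>k<n. fb (X k \<omega>)) * fb (X n \<omega>)) = (\<Sum>k<n. expectation (\<lambda>\<omega>. fb (X k \<omega>) * fb (X (k + (n - k)) \<omega>)))"
      by (simp add: sum_distrib_right iS(3))
    also have "\<dots> \<le> (\<Sum>k<n. E * \<alpha> ^ (n - k))" by (intro sum_mono cov)
    also have "\<dots> = E * (\<Sum>k<n. \<alpha> ^ Suc k)"
      unfolding sum_distrib_left[symmetric] by (subst sum.nat_diff_reindex[symmetric]) (auto intro!: sum.cong arg_cong[where f="\<lambda>x. E * x"] simp: Suc_diff_Suc)
    also have "\<dots> \<le> E * (1 / (1 - \<alpha>))"
    proof (rule mult_left_mono[OF _ E])
      have "(\<Sum>k<n. \<alpha> ^ Suc k) \<le> (\<Sum>k<n. \<alpha> ^ k)" using \<alpha> by (intro sum_mono) (auto simp: mult_le_cancel_right2)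
      also have "\<dots> = (1 - \<alpha> ^ n) / (1 - \<alpha>)" using \<alpha> by (subst sum_gp_strict) auto
      also have "\<dots> \<le> 1 / (1 - \<alpha>)" using \<alpha> by (intro divide_right_mono) auto
      finally show "(\<Sum>k<n. \<alpha> ^ Suc k) \<le> 1 / (1 - \<alpha>)" .
    qed
    finally have "expectation (\<lambda>\<omega>. (\<Sum>k<Suc n. fb (X k \<omega>))^2) \<le> real n * D + 2 * (E * (1 / (1 - \<alpha>))) + E"
      using Suc.IH cov[of n 0] by simp
    also have "\<dots> = real (Suc n) * D" by (simp add: D_def algebra_simps add_divide_distrib)
    finally show ?case .
  qed simp
  then show ?thesis unfolding fb_def by blast
qed

lemma bounded_lln:
  assumes f: "\<And>x. \<bar>f x\<bar> \<le> C"
  shows "(\<lambda>n. expectation (\<lambda>\<omega>. \<bar>(\<Sum>k<n. f (X k \<omega>)) / real n - stat_mean f\<bar>)) \<longlonglongrightarrow> 0"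
proof -
  obtain D where D: "\<And>n. expectation (\<lambda>\<omega>. (\<Sum>k<n. f (X k \<omega>) - stat_mean f)^2) \<le> real n * D"
    using bounded_second_moment[of f C] f by blast
  have C: "0 \<le> C" using f[of 0] by simp
  have le: "expectation (\<lambda>\<omega>. \<bar>(\<Sum>k<n. f (X k \<omega>)) / real n - stat_mean f\<bar>) \<le> sqrt (D / real n)" if n: "0 < n" for n
  proof -
    have e: "(\<Sum>k<n. f (X k \<omega>)) / real n - stat_mean f = (\<Sum>k<n. f (X k \<omega>) - stat_mean f) / real n" for \<omega>
      using n by (simp add: sum_subtractf field_simps)
    have b: "\<bar>(\<Sum>k<n. f (X k \<omega>) - stat_mean f)\<bar> \<le> real n * (2 * C)" for \<omega>
    proof (rule order_trans[OF sum_abs])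
      have "\<bar>f x - stat_mean f\<bar> \<le> 2 * C" for x using f[of x] expectation_pmf_bounded[of f C stat_law] f by (smt (verit))
      then show "(\<Sum>k<n. \<bar>f (X k \<omega>) - stat_mean f\<bar>) \<le> real n * (2 * C)"
        using sum_bounded_above[of "{..<n}" "\<lambda>k. \<bar>f (X k \<omega>) - stat_mean f\<bar>" "2 * C"] by simp
    qed
    have i: "integrable M (\<lambda>\<omega>. ((\<Sum>k<n. f (X k \<omega>) - stat_mean f) / real n)^2)"
    proof (rule integrable_const_bound[where B="(2 * C)^2"])
      show "AE \<omega> in M. norm (((\<Sum>k<n. f (X k \<omega>) - stat_mean f) / real n)\<^sup>2) \<le> (2 * C)\<^sup>2"
      proof (rule AE_I2)
        fix \<omega>
        have "\<bar>(\<Sum>k<n. f (X k \<omega>) - stat_mean f) / real n\<bar> \<le> 2 * C" using b[of \<omega>] n by (simp add: abs_divide field_simps)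
        then have "((\<Sum>k<n. f (X k \<omega>) - stat_mean f) / real n)^2 \<le> (2 * C)^2"
          using C abs_le_square_iff[of "(\<Sum>k<n. f (X k \<omega>) - stat_mean f) / real n" "2 * C"] by simp
        then show "norm (((\<Sum>k<n. f (X k \<omega>) - stat_mean f) / real n)\<^sup>2) \<le> (2 * C)\<^sup>2" by simp
      qed
    qed measurable
    have "expectation (\<lambda>\<omega>. \<bar>(\<Sum>k<n. f (X k \<omega>)) / real n - stat_mean f\<bar>) \<le> sqrt (expectation (\<lambda>\<omega>. ((\<Sum>k<n. f (X k \<omega>) - stat_mean f) / real n)^2))"
      unfolding e by (rule expectation_abs_le_sqrt(2)[OF _ i]) measurable
    also have "\<dots> = sqrt (expectation (\<lambda>\<omega>. (\<Sum>k<n. f (X k \<omega>) - stat_mean f)^2) / (real n)^2)"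
      by (simp add: power_divide)
    also have "\<dots> \<le> sqrt (real n * D / (real n)^2)" using D[of n] by (intro real_sqrt_le_mono divide_right_mono) auto
    also have "real n * D / (real n)^2 = D / real n" using n by (simp add: power2_eq_square)
    finally show ?thesis .
  qed
  show ?thesis
  proof (rule tendsto_sandwich[where f="\<lambda>_. 0" and h="\<lambda>n. sqrt (D / real n)"])
    show "\<forall>\<^sub>F n in sequentially. 0 \<le> expectation (\<lambda>\<omega>. \<bar>(\<Sum>k<n. f (X k \<omega>)) / real n - stat_mean f\<bar>)" by simp
    show "\<forall>\<^sub>F n in sequentially. expectation (\<lambda>\<omega>. \<bar>(\<Sum>k<n. f (X k \<omega>)) / real n - stat_mean f\<bar>) \<le> sqrt (D / real n)"
      using eventually_gt_at_top[of 0] by eventually_elim (rule le)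
    show "(\<lambda>n. sqrt (D / real n)) \<longlonglongrightarrow> 0" using tendsto_real_sqrt[OF lim_const_over_n[of D]] by simp
  qed simp
qed

text \<open>Only the truncated function is treated through second moments. The remainder is
  estimated in mean, where the triangle inequality leaves a Cesaro average of tail expectations
  converging to the stationary tail.\<close>

theorem lln:
  assumes f: "cubic f"
  shows "(\<lambda>n. expectation (\<lambda>\<omega>. \<bar>(\<Sum>k<n. f (X k \<omega>)) / real n - stat_mean f\<bar>)) \<longlonglongrightarrow> 0"
proof (rule LIMSEQ_I)
  fix e :: real assume e: "0 < e"
  define w where "w L x = \<bar>f x * indicator {L<..} x\<bar>" for L x
  have cw: "cubic (w L)" for L unfolding w_def by (intro cubic_abs cubic_trunc f)
  have "(\<lambda>L. stat_mean (w L)) \<longlonglongrightarrow> 0" using cubic_tail_pi[OF cubic_abs[OF f]] by (simp add: w_def[abs_def] abs_mult)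
  then have "\<forall>\<^sub>F L in sequentially. stat_mean (w L) < e / 4" by (rule order_tendstoD(2)) (use e in simp)
  then obtain L where L: "stat_mean (w L) < e / 4" using eventually_happens'[OF sequentially_bot] by blast
  define fL where "fL x = f x * indicator {..L} x" for x
  have cf: "cubic fL" unfolding fL_def by (intro cubic_trunc f)
  obtain D where D: "\<And>x. \<bar>fL x\<bar> \<le> D" using trunc_bounded unfolding fL_def by blast
  have iX: "integrable M (\<lambda>\<omega>. g (X k \<omega>))" if "cubic g" for g k using that by (rule integrable_cubic_X)
  have "\<forall>\<^sub>F n in sequentially. (\<Sum>k<n. expectation (\<lambda>\<omega>. w L (X k \<omega>))) / real n < e / 4"
    using order_tendstoD(2)[OF LIMSEQ_cesaro[OF law_cubic_tendsto[OF cw]] L] .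
  moreover have "\<forall>\<^sub>F n in sequentially. expectation (\<lambda>\<omega>. \<bar>(\<Sum>k<n. fL (X k \<omega>)) / real n - stat_mean fL\<bar>) < e / 2"
    using order_tendstoD(2)[OF bounded_lln[of fL D], of "e/2"] D e by simp
  ultimately have "\<forall>\<^sub>F n in sequentially. expectation (\<lambda>\<omega>. \<bar>(\<Sum>k<n. f (X k \<omega>)) / real n - stat_mean f\<bar>) < e"
  proof eventually_elim
    case (elim n)
    have d1: "\<bar>stat_mean f - stat_mean fL\<bar> \<le> stat_mean (w L)"
    proof -
      have "stat_mean f - stat_mean fL = stat_mean (\<lambda>x. f x * indicator {L<..} x)"
        using expectation_cubic_split[OF f stat_law3, where L=L] by (simp add: fL_def[abs_def])
      also have "\<bar>\<dots>\<bar> \<le> stat_mean (w L)" unfolding w_def using integral_norm_bound[of stat_law "\<lambda>x. f x * indicator {L<..} x"] by simp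
      finally show ?thesis .
    qed
    have d2: "\<bar>(\<Sum>k<n. f (X k \<omega>)) / real n - (\<Sum>k<n. fL (X k \<omega>)) / real n\<bar> \<le> (\<Sum>k<n. w L (X k \<omega>)) / real n" for \<omega>
    proof -
      have e: "(\<Sum>k<n. f (X k \<omega>)) - (\<Sum>k<n. fL (X k \<omega>)) = (\<Sum>k<n. f (X k \<omega>) * indicator {L<..} (X k \<omega>))"
        unfolding sum_subtractf[symmetric] fL_def by (intro sum.cong) (auto simp: indicator_def)
      have "\<bar>(\<Sum>k<n. f (X k \<omega>)) - (\<Sum>k<n. fL (X k \<omega>))\<bar> \<le> (\<Sum>k<n. w L (X k \<omega>))"
        unfolding e w_def by (rule sum_abs)
      then show ?thesis by (simp add: diff_divide_distrib[symmetric] abs_divide divide_right_mono)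
    qed
    have "expectation (\<lambda>\<omega>. \<bar>(\<Sum>k<n. f (X k \<omega>)) / real n - stat_mean f\<bar>)
        \<le> expectation (\<lambda>\<omega>. \<bar>(\<Sum>k<n. fL (X k \<omega>)) / real n - stat_mean fL\<bar> + (\<Sum>k<n. w L (X k \<omega>)) / real n + stat_mean (w L))"
    proof (rule integral_mono)
      show "\<bar>(\<Sum>k<n. f (X k \<omega>)) / real n - stat_mean f\<bar> \<le> \<bar>(\<Sum>k<n. fL (X k \<omega>)) / real n - stat_mean fL\<bar> + (\<Sum>k<n. w L (X k \<omega>)) / real n + stat_mean (w L)" for \<omega>
        using d1 d2[of \<omega>] by linarith
    qed (auto intro!: iX f cf cw Bochner_Integration.integrable_add Bochner_Integration.integrable_diff integrable_abs integrable_divide Bochner_Integration.integrable_sum)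
    also have "\<dots> = expectation (\<lambda>\<omega>. \<bar>(\<Sum>k<n. fL (X k \<omega>)) / real n - stat_mean fL\<bar>) + (\<Sum>k<n. expectation (\<lambda>\<omega>. w L (X k \<omega>))) / real n + stat_mean (w L)"
      by (simp add: iX cf cw prob_space)
    finally show ?case using elim L by linarith
  qed
  then show "\<exists>no. \<forall>n\<ge>no. norm (expectation (\<lambda>\<omega>. \<bar>(\<Sum>k<n. f (X k \<omega>)) / real n - stat_mean f\<bar>) - 0) < e"
    by (simp add: eventually_sequentially)
qed

end

section \<open>Central limit theorem for the score\<close>

lemma exp_minus_approx:
  fixes u :: real
  assumes "0 \<le> u" shows "\<bar>exp (- u) - (1 - u)\<bar> \<le> u^2"
proof -
  have 1: "1 - u \<le> exp (- u)" using exp_ge_add_one_self[of "- u"] by simp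
  have "exp (- u) = 1 / exp u" by (simp add: exp_minus inverse_eq_divide)
  also have "\<dots> \<le> 1 / (1 + u)" using assms by (intro divide_left_mono exp_ge_add_one_self) auto
  also have "\<dots> \<le> 1 - u + u^2"
  proof -
    have "1 \<le> (1 - u + u^2) * (1 + u)" using assms by (simp add: algebra_simps power2_eq_square)
    then show ?thesis using assms by (simp add: divide_le_eq)
  qed
  finally show ?thesis using 1 by (simp add: abs_le_iff)
qed

lemma exp_lipschitz:
  fixes a b c :: real
  assumes "a \<le> c" "b \<le> c" shows "\<bar>exp a - exp b\<bar> \<le> exp c * \<bar>a - b\<bar>"
proof -
  have *: "exp a - exp b \<le> exp c * (a - b)" if "b \<le> a" "a \<le> c" for a b
  proof -
    have "exp a - exp b = exp a * (1 - exp (b - a))" by (simp add: exp_diff algebra_simps)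
    also have "\<dots> \<le> exp a * (a - b)"
    proof (rule mult_left_mono)
      show "1 - exp (b - a) \<le> a - b" using exp_ge_add_one_self[of "b - a"] by linarith
    qed simp
    also have "\<dots> \<le> exp c * (a - b)" using that by (intro mult_right_mono) auto
    finally show ?thesis .
  qed
  show ?thesis
  proof (cases "b \<le> a")
    case True then show ?thesis using *[of b a] assms by simp
  next
    case False then show ?thesis using *[of a b] assms by simp
  qed
qed

lemma norm_iexp_diff: "norm (iexp a - iexp b) \<le> \<bar>a - b\<bar>"
proof -
  have "iexp a - iexp b = iexp b * (iexp (a - b) - 1)" by (simp add: algebra_simps exp_diff)
  then have "norm (iexp a - iexp b) = norm (iexp (a - b) - 1)" by (simp add: norm_mult)
  also have "\<dots> \<le> \<bar>a - b\<bar>" using iexp_approx1[of "a - b" 0] by simp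
  finally show ?thesis .
qed

context inar_process begin

section \<open>Score increments and their second moments\<close>

definition res :: "nat \<Rightarrow> nat \<Rightarrow> real" where "res x y = real y - \<alpha> * real x - \<mu>"
text \<open>The index is the time of the predictable factor: \<open>incr g k\<close> becomes known
  only at time \<open>k + 1\<close>. \<open>condvar g x\<close> is its conditional variance given
  the state \<open>x\<close>.\<close>

definition incr :: "(nat \<Rightarrow> real) \<Rightarrow> nat \<Rightarrow> 'a \<Rightarrow> real" where "incr g k \<omega> = g (X k \<omega>) * res (X k \<omega>) (X (Suc k) \<omega>)"
definition condvar :: "(nat \<Rightarrow> real) \<Rightarrow> nat \<Rightarrow> real" where "condvar g x = (g x)^2 * (\<alpha> * (1 - \<alpha>) * real x + \<sigma>2)"

lemma condvar_nonneg: "0 \<le> condvar g x"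
  unfolding condvar_def using \<alpha> \<sigma>2_nonneg by (intro mult_nonneg_nonneg add_nonneg_nonneg) auto

lemma integrable_res: "integrable (K x) (res x)" "integrable (K x) (\<lambda>y. (res x y)^2)"
  unfolding res_def[abs_def] using integrable_K1 integrable_K_centered_sq by auto

lemma expectation_res: "measure_pmf.expectation (K x) (res x) = 0" "measure_pmf.expectation (K x) (\<lambda>y. (res x y)^2) = \<alpha> * (1 - \<alpha>) * real x + \<sigma>2"
  unfolding res_def[abs_def] using K_centered K_variance by auto

lemma nn_integral_affine_res:
  "(\<integral>\<^sup>+y. ennreal ((a + b * res x y)^2) \<partial>K x) = ennreal (a^2) + ennreal (b^2 * (\<alpha> * (1 - \<alpha>) * real x + \<sigma>2))"
proof -
  have i: "integrable (K x) (\<lambda>y. (a + b * res x y)^2)"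
  proof -
    have "integrable (K x) (\<lambda>y. a^2 + 2 * a * b * res x y + b^2 * (res x y)^2)" using integrable_res[of x] by auto
    then show ?thesis by (rule Bochner_Integration.integrable_cong[THEN iffD1, rotated -1]) (auto simp: power2_eq_square algebra_simps)
  qed
  have e: "(a + b * res x y)^2 = a^2 + 2 * a * b * res x y + b^2 * (res x y)^2" for y
    by (simp add: power2_eq_square algebra_simps)
  have "(\<integral>\<^sup>+y. ennreal ((a + b * res x y)^2) \<partial>K x) = ennreal (measure_pmf.expectation (K x) (\<lambda>y. (a + b * res x y)^2))"
    by (rule nn_integral_eq_integral[OF i]) simp
  also have "measure_pmf.expectation (K x) (\<lambda>y. (a + b * res x y)^2) = a^2 + b^2 * (\<alpha> * (1 - \<alpha>) * real x + \<sigma>2)"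
    unfolding e using integrable_res[of x] expectation_res[of x] by simp
  finally show ?thesis using condvar_nonneg[of "\<lambda>_. b" x] by (simp add: ennreal_plus condvar_def)
qed

lemma measurable_incr [measurable]: "incr g k \<in> borel_measurable M"
proof -
  have "(\<lambda>\<omega>. g (X k \<omega>) * (real (X (Suc k) \<omega>) - \<alpha> * real (X k \<omega>) - \<mu>)) \<in> borel_measurable M" by (simp del: inar.simps)
  then show ?thesis by (simp add: incr_def[abs_def] res_def del: inar.simps)
qed

text \<open>Orthogonality of martingale increments: conditionally on the history the cross term
  vanishes. Nonnegative integrals deliver finiteness together with the value.\<close>

lemma second_moment_nn:
  assumes "k0 \<le> n"
  shows "(\<integral>\<^sup>+\<omega>. ennreal ((\<Sum>k\<in>{k0..<n}. incr g k \<omega>)^2) \<partial>M) = (\<Sum>k\<in>{k0..<n}. \<integral>\<^sup>+\<omega>. ennreal (condvar g (X k \<omega>)) \<partial>M)"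
  using assms
proof (induction n rule: dec_induct)
  case (step n)
  define s where "s h = (\<Sum>k\<in>{k0..<n}. g (h ! k) * res (h ! k) (h ! Suc k))" for h
  have s: "s (hist n \<omega>) = (\<Sum>k\<in>{k0..<n}. incr g k \<omega>)" for \<omega>
    unfolding s_def incr_def by (intro sum.cong) (auto simp: nth_hist simp del: inar.simps)
  have "(\<integral>\<^sup>+\<omega>. ennreal ((\<Sum>k\<in>{k0..<Suc n}. incr g k \<omega>)^2) \<partial>M)
      = (\<integral>\<^sup>+\<omega>. (\<lambda>h y. ennreal ((s h + g (h ! n) * res (h ! n) y)^2)) (hist n \<omega>) (X (Suc n) \<omega>) \<partial>M)"
    using step by (intro nn_integral_cong) (simp add: s nth_hist incr_def del: inar.simps)
  also have "\<dots> = (\<integral>\<^sup>+\<omega>. (\<integral>\<^sup>+y. ennreal ((s (hist n \<omega>) + g (hist n \<omega> ! n) * res (hist n \<omega> ! n) y)^2) \<partial>K (X n \<omega>)) \<partial>M)"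
    by (rule markov_nn)
  also have "\<dots> = (\<integral>\<^sup>+\<omega>. ennreal ((\<Sum>k\<in>{k0..<n}. incr g k \<omega>)^2) + ennreal (condvar g (X n \<omega>)) \<partial>M)"
    by (intro nn_integral_cong) (simp add: nth_hist nn_integral_affine_res s condvar_def)
  also have "\<dots> = (\<integral>\<^sup>+\<omega>. ennreal ((\<Sum>k\<in>{k0..<n}. incr g k \<omega>)^2) \<partial>M) + (\<integral>\<^sup>+\<omega>. ennreal (condvar g (X n \<omega>)) \<partial>M)"
    by (rule nn_integral_add) auto
  finally show ?case using step by simp
qed simp

lemma second_moment:
  assumes "k0 \<le> n" "cubic (condvar g)"
  shows "integrable M (\<lambda>\<omega>. (\<Sum>k\<in>{k0..<n}. incr g k \<omega>)^2)"
    and "expectation (\<lambda>\<omega>. (\<Sum>k\<in>{k0..<n}. incr g k \<omega>)^2) = (\<Sum>k\<in>{k0..<n}. expectation (\<lambda>\<omega>. condvar g (X k \<omega>)))"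
proof -
  have "(\<integral>\<^sup>+\<omega>. ennreal ((\<Sum>k\<in>{k0..<n}. incr g k \<omega>)^2) \<partial>M) = (\<Sum>k\<in>{k0..<n}. ennreal (expectation (\<lambda>\<omega>. condvar g (X k \<omega>))))"
    unfolding second_moment_nn[OF assms(1)]
    by (intro sum.cong refl nn_integral_eq_integral integrable_cubic_X assms) (simp add: condvar_nonneg)
  also have "\<dots> = ennreal (\<Sum>k\<in>{k0..<n}. expectation (\<lambda>\<omega>. condvar g (X k \<omega>)))"
    by (intro sum_ennreal integral_nonneg_AE) (simp add: condvar_nonneg)
  finally have e: "(\<integral>\<^sup>+\<omega>. ennreal ((\<Sum>k\<in>{k0..<n}. incr g k \<omega>)^2) \<partial>M) = ennreal (\<Sum>k\<in>{k0..<n}. expectation (\<lambda>\<omega>. condvar g (X k \<omega>)))" .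
  show "integrable M (\<lambda>\<omega>. (\<Sum>k\<in>{k0..<n}. incr g k \<omega>)^2)"
    by (rule integrableI_nonneg) (auto simp: e)
  have "0 \<le> (\<Sum>k\<in>{k0..<n}. expectation (\<lambda>\<omega>. condvar g (X k \<omega>)))"
    by (intro sum_nonneg integral_nonneg_AE AE_I2 condvar_nonneg)
  then show "expectation (\<lambda>\<omega>. (\<Sum>k\<in>{k0..<n}. incr g k \<omega>)^2) = (\<Sum>k\<in>{k0..<n}. expectation (\<lambda>\<omega>. condvar g (X k \<omega>)))"
    by (subst integral_eq_nn_integral) (simp_all only: e enn2real_ennreal, auto)
qed

text \<open>The characteristic exponential of one normalised increment times the inverse of its
  Gaussian approximation, so that \<open>mean_cf n g x\<close> is 1 up to an error that vanishes
  faster than \<open>1 / n\<close>.\<close>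

definition step_cf :: "nat \<Rightarrow> (nat \<Rightarrow> real) \<Rightarrow> nat \<Rightarrow> nat \<Rightarrow> complex" where
  "step_cf n g x y = exp (complex_of_real (condvar g x / (2 * real n))) * iexp (g x * res x y / sqrt (real n))"

definition mean_cf :: "nat \<Rightarrow> (nat \<Rightarrow> real) \<Rightarrow> nat \<Rightarrow> complex" where
  "mean_cf n g x = (\<integral>y. step_cf n g x y \<partial>K x)"

lemma norm_step_cf: "norm (step_cf n g x y) = exp (condvar g x / (2 * real n))"
  by (simp add: step_cf_def norm_mult)

text \<open>Second-order expansion of the one-step characteristic function; only the conditional
  variance is needed, so no Lindeberg condition appears.\<close>
lemma mean_cf_tendsto: "(\<lambda>n. real n * norm (mean_cf n g x - 1)) \<longlonglongrightarrow> 0"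
proof -
  define v where "v = condvar g x"
  define Z where "Z y = g x * res x y" for y
  define \<nu> where "\<nu> = distr (K x) borel Z"
  have v0: "0 \<le> v" unfolding v_def by (rule condvar_nonneg)
  have iZ: "integrable (K x) Z" unfolding Z_def by (intro integrable_mult_right integrable_res)
  have iZ2: "integrable (K x) (\<lambda>y. (Z y)^2)" unfolding Z_def power_mult_distrib by (intro integrable_mult_right integrable_res)
  have EZ: "measure_pmf.expectation (K x) Z = 0" unfolding Z_def using expectation_res by simp
  have EZ2: "measure_pmf.expectation (K x) (\<lambda>y. (Z y)^2) = v"
    unfolding Z_def power_mult_distrib v_def condvar_def using expectation_res by simp
  have var: "measure_pmf.variance (K x) Z = v" using EZ EZ2 by simp
  have ch: "char \<nu> t = (\<integral>y. iexp (t * Z y) \<partial>K x)" for t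
    unfolding \<nu>_def char_def by (subst integral_distr) auto
  \<comment> \<open>The remainder of the second-order expansion at \<open>1 / sqrt n\<close> is at
    most \<open>1 / (6 * n)\<close> times this expectation. The minimum with
    \<open>6 * (Z y)^2\<close> supplies the dominating function, and the integrand tends to 0
    pointwise.\<close>
  define a where "a n = measure_pmf.expectation (K x) (\<lambda>y. min (6 * (Z y)^2) (\<bar>1 / sqrt (real n)\<bar> * \<bar>Z y\<bar>^3))" for n
  have a: "a \<longlonglongrightarrow> measure_pmf.expectation (K x) (\<lambda>y. 0)"
    unfolding a_def[abs_def]
  proof (rule integral_dominated_convergence[where w="\<lambda>y. 6 * (Z y)^2"])
    show "AE y in K x. (\<lambda>n. min (6 * (Z y)^2) (\<bar>1 / sqrt (real n)\<bar> * \<bar>Z y\<bar>^3)) \<longlonglongrightarrow> 0"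
    proof (rule AE_I2)
      fix y
      have "(\<lambda>n. 1 / sqrt (real n)) \<longlonglongrightarrow> 0"
        using tendsto_real_sqrt[OF lim_const_over_n[of 1]] by (simp add: real_sqrt_divide)
      then have "(\<lambda>n. \<bar>1 / sqrt (real n)\<bar> * \<bar>Z y\<bar>^3) \<longlonglongrightarrow> 0" by (intro tendsto_mult_left_zero tendsto_rabs_zero)
      then have "(\<lambda>n. min (6 * (Z y)^2) (\<bar>1 / sqrt (real n)\<bar> * \<bar>Z y\<bar>^3)) \<longlonglongrightarrow> min (6 * (Z y)^2) 0" by (intro tendsto_intros)
      then show "(\<lambda>n. min (6 * (Z y)^2) (\<bar>1 / sqrt (real n)\<bar> * \<bar>Z y\<bar>^3)) \<longlonglongrightarrow> 0" by (simp add: min_absorb2)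
    qed
    show "AE y in K x. norm (min (6 * (Z y)^2) (\<bar>1 / sqrt (real n)\<bar> * \<bar>Z y\<bar>^3)) \<le> 6 * (Z y)^2" for n
      by (intro AE_I2) (auto simp: min_def)
  qed (use iZ2 in auto)
  define u where "u n = v / (2 * real n)" for n
  have main: "real n * norm (mean_cf n g x - 1) \<le> exp (v / 2) * (a n / 6 + (v^2 / 4) / real n)" if n: "0 < n" for n
  proof -
    have t2: "(1 / sqrt (real n))^2 = 1 / real n" using n by (simp add: power_divide)
    have "mean_cf n g x = exp (complex_of_real (u n)) * char \<nu> (1 / sqrt (real n))"
      unfolding mean_cf_def step_cf_def ch u_def v_def Z_def by simp
    moreover have "exp (complex_of_real (u n)) * exp (complex_of_real (- u n)) = 1" by (simp add: exp_minus)
    \<comment> \<open>Factoring out the compensator turns the deviation from 1 into a comparison of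
      the characteristic function with \<open>exp (- u n)\<close>, both of which are close to
      \<open>1 - u n\<close>.\<close>
    ultimately have "mean_cf n g x - 1 = exp (complex_of_real (u n)) * (char \<nu> (1 / sqrt (real n)) - exp (complex_of_real (- u n)))"
      by (simp add: algebra_simps)
    then have "norm (mean_cf n g x - 1) = exp (u n) * norm (char \<nu> (1 / sqrt (real n)) - exp (complex_of_real (- u n)))"
      by (simp add: norm_mult)
    also have "\<dots> \<le> exp (v / 2) * (norm (char \<nu> (1 / sqrt (real n)) - complex_of_real (1 - u n)) + \<bar>exp (- u n) - (1 - u n)\<bar>)"
    proof (intro mult_mono)
      show "exp (u n) \<le> exp (v / 2)" using v0 n by (simp add: u_def field_simps mult_le_cancel_left1)
      have "norm (complex_of_real (1 - u n) - complex_of_real (exp (- u n))) = \<bar>exp (- u n) - (1 - u n)\<bar>"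
        unfolding of_real_diff[symmetric] norm_of_real by simp
      then show "norm (char \<nu> (1 / sqrt (real n)) - exp (complex_of_real (- u n))) \<le> norm (char \<nu> (1 / sqrt (real n)) - complex_of_real (1 - u n)) + \<bar>exp (- u n) - (1 - u n)\<bar>"
        using norm_triangle_ineq[of "char \<nu> (1 / sqrt (real n)) - complex_of_real (1 - u n)" "complex_of_real (1 - u n) - complex_of_real (exp (- u n))"]
        by (simp add: exp_of_real[symmetric] exp_minus)
    qed auto
    also have "\<dots> \<le> exp (v / 2) * ((1 / real n) / 6 * a n + (u n)^2)"
    proof (intro mult_left_mono add_mono)
      have "norm (char \<nu> (1 / sqrt (real n)) - complex_of_real (1 - (1 / sqrt (real n))^2 * v / 2)) \<le> ((1 / sqrt (real n))^2 / 6) * a n"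
        unfolding a_def using prob_space.char_approx3'[OF measure_pmf.prob_space_axioms _ iZ iZ2 EZ var \<nu>_def, of "1 / sqrt (real n)"] by simp
      then show "norm (char \<nu> (1 / sqrt (real n)) - complex_of_real (1 - u n)) \<le> (1 / real n) / 6 * a n"
        unfolding t2 by (simp add: u_def mult.commute)
      show "\<bar>exp (- u n) - (1 - u n)\<bar> \<le> (u n)^2" by (rule exp_minus_approx) (use v0 in \<open>simp add: u_def\<close>)
    qed auto
    finally have "real n * norm (mean_cf n g x - 1) \<le> real n * (exp (v / 2) * ((1 / real n) / 6 * a n + (u n)^2))"
      by (intro mult_left_mono) auto
    also have "\<dots> = exp (v / 2) * (a n / 6 + (v^2 / 4) / real n)"
      using n by (simp add: u_def power2_eq_square field_simps)
    finally show ?thesis .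
  qed
  show ?thesis
  proof (rule tendsto_sandwich[where f="\<lambda>_. 0" and h="\<lambda>n. exp (v / 2) * (a n / 6 + (v^2 / 4) / real n)"])
    show "\<forall>\<^sub>F n in sequentially. real n * norm (mean_cf n g x - 1) \<le> exp (v / 2) * (a n / 6 + (v^2 / 4) / real n)"
      using eventually_gt_at_top[of 0] by eventually_elim (rule main)
    have "(\<lambda>n. exp (v / 2) * (a n / 6 + (v^2 / 4) / real n)) \<longlonglongrightarrow> exp (v / 2) * (0 / 6 + 0)"
      using a by (intro tendsto_intros lim_const_over_n) simp_all
    then show "(\<lambda>n. exp (v / 2) * (a n / 6 + (v^2 / 4) / real n)) \<longlonglongrightarrow> 0" by simp
  qed auto
qed

lemma take_hist: "k0 \<le> m \<Longrightarrow> take (Suc k0) (hist m \<omega>) = hist k0 \<omega>"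
  by (simp add: hist_def take_map take_upt del: upt_Suc)

text \<open>Multiplying the characteristic exponential by the compensator keeps the product close to a
  martingale: consecutive expectations differ by at most a sum of terms of size o(1/n).\<close>
lemma clt_truncated:
  fixes F :: "nat list \<Rightarrow> complex"
  assumes g: "\<And>x. L < x \<Longrightarrow> g x = 0" and F: "\<And>h. norm (F h) \<le> 1"
  shows "(\<lambda>n. \<integral>\<omega>. F (hist k0 \<omega>) * iexp ((\<Sum>k\<in>{k0..<n}. incr g k \<omega>) / sqrt (real n)) \<partial>M)
     \<longlonglongrightarrow> (\<integral>\<omega>. F (hist k0 \<omega>) \<partial>M) * complex_of_real (exp (- stat_mean (condvar g) / 2))"
proof -
  \<comment> \<open>A maximum over finitely many states bounds \<open>condvar g\<close> everywhere,
    because \<open>g\<close> vanishes above \<open>L\<close>.\<close>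
  define vm where "vm = Max (condvar g ` {..L})"
  have vm0: "0 \<le> vm" unfolding vm_def using condvar_nonneg[of g 0] by (rule order_trans) (auto intro!: Max_ge)
  have vm: "condvar g x \<le> vm" for x
  proof (cases "x \<le> L")
    case True then show ?thesis by (auto simp: vm_def intro!: Max_ge)
  next
    case False then show ?thesis using g[of x] vm0 by (simp add: condvar_def)
  qed
  define V where "V = stat_mean (condvar g)"
  have bv: "\<bar>condvar g x\<bar> \<le> vm" for x using vm condvar_nonneg[of g x] by simp
  have V: "V \<le> vm" unfolding V_def using expectation_pmf_bounded[of "condvar g" vm stat_law] bv by (simp add: abs_le_iff)
  define pr where "pr n m h = (\<Prod>k\<in>{k0..<m}. step_cf n g (h ! k) (h ! Suc k))" for n m h
  \<comment> \<open>\<open>take (Suc k0) h\<close> recovers the history up to time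
    \<open>k0\<close>, so the weight stays fixed while the product grows.\<close>
  define z where "z n m h = F (take (Suc k0) h) * pr n m h" for n m h
  have npr: "norm (pr n m h) \<le> exp (vm / 2)" if "m \<le> n" for n m h
  proof -
    have "norm (pr n m h) = (\<Prod>k\<in>{k0..<m}. exp (condvar g (h ! k) / (2 * real n)))"
      by (simp add: pr_def prod_norm[symmetric] norm_step_cf)
    also have "\<dots> = exp (\<Sum>k\<in>{k0..<m}. condvar g (h ! k) / (2 * real n))" by (simp add: exp_sum)
    also have "\<dots> \<le> exp (\<Sum>k\<in>{k0..<m}. vm / (2 * real n))"
      using vm by (intro exp_le_cancel_iff[THEN iffD2] sum_mono divide_right_mono) auto
    also have "(\<Sum>k\<in>{k0..<m}. vm / (2 * real n)) \<le> vm / 2"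
    proof (cases "n = 0")
      case False
      have "real (m - k0) * vm \<le> real n * vm" using that vm0 by (intro mult_right_mono) auto
      then show ?thesis using False by (simp add: field_simps)
    qed (use vm0 in auto)
    finally show ?thesis by simp
  qed
  have nz: "norm (z n m h) \<le> exp (vm / 2)" if "m \<le> n" for n m h
    using mult_mono[OF F npr[OF that]] by (simp add: z_def norm_mult)
  have iz: "integrable M (\<lambda>\<omega>. z n m (hist m \<omega>))" if "m \<le> n" for n m
    by (rule integrable_const_bound[where B="exp (vm / 2)"]) (use nz[OF that] measurable_compose[OF measurable_hist, of "z n m" borel m] in auto)
  \<comment> \<open>A sum over the states up to \<open>L\<close> serves as a uniform bound; for
    larger states \<open>g\<close> vanishes and \<open>mean_cf\<close> is exactly 1.\<close>
  define \<delta> where "\<delta> n = (\<Sum>x\<le>L. norm (mean_cf n g x - 1))" for n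
  have \<delta>: "norm (mean_cf n g x - 1) \<le> \<delta> n" for n x
  proof (cases "x \<le> L")
    case True then show ?thesis unfolding \<delta>_def by (intro member_le_sum) auto
  next
    case False
    then have "step_cf n g x y = 1" for y using g[of x] by (simp add: step_cf_def condvar_def)
    then have "mean_cf n g x = 1" by (simp add: mean_cf_def)
    then show ?thesis by (simp add: \<delta>_def sum_nonneg)
  qed
  have onestep: "norm ((\<integral>\<omega>. z n (Suc m) (hist (Suc m) \<omega>) \<partial>M) - (\<integral>\<omega>. z n m (hist m \<omega>) \<partial>M)) \<le> exp (vm / 2) * \<delta> n"
    if m: "k0 \<le> m" "Suc m \<le> n" for n m
  proof -
    have zS: "z n (Suc m) (hist (Suc m) \<omega>) = (\<lambda>h y. z n m h * step_cf n g (h ! m) y) (hist m \<omega>) (X (Suc m) \<omega>)" for \<omega>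
    proof -
      have "pr n m (hist (Suc m) \<omega>) = pr n m (hist m \<omega>)"
        unfolding pr_def by (intro prod.cong) (auto simp: nth_hist simp del: inar.simps)
      then have "pr n (Suc m) (hist (Suc m) \<omega>) = pr n m (hist m \<omega>) * step_cf n g (X m \<omega>) (X (Suc m) \<omega>)"
        using m by (simp add: pr_def nth_hist del: inar.simps)
      then show ?thesis using m by (simp add: z_def take_hist nth_hist del: inar.simps take_Suc)
    qed
    have "(\<integral>\<omega>. z n (Suc m) (hist (Suc m) \<omega>) \<partial>M) = (\<integral>\<omega>. (\<integral>y. z n m (hist m \<omega>) * step_cf n g (hist m \<omega> ! m) y \<partial>K (X m \<omega>)) \<partial>M)"
      unfolding zS
    proof (rule markov_complex[where C="exp (vm / 2) * exp (vm / 2)"])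
      fix h y
      have "norm (step_cf n g (h ! m) y) \<le> exp (vm / 2)"
      proof -
        have "condvar g (h ! m) / (2 * real n) \<le> vm / (2 * real n)" using vm by (intro divide_right_mono) auto
        also have "\<dots> \<le> vm / 2" using m vm0 by (intro divide_left_mono) auto
        finally show ?thesis by (simp add: norm_step_cf)
      qed
      then show "norm (z n m h * step_cf n g (h ! m) y) \<le> exp (vm / 2) * exp (vm / 2)"
        unfolding norm_mult using nz[of m n h] m by (intro mult_mono) auto
    qed
    also have "\<dots> = (\<integral>\<omega>. z n m (hist m \<omega>) * mean_cf n g (X m \<omega>) \<partial>M)"
      by (intro Bochner_Integration.integral_cong) (auto simp: nth_hist mean_cf_def)
    finally have e: "(\<integral>\<omega>. z n (Suc m) (hist (Suc m) \<omega>) \<partial>M) = (\<integral>\<omega>. z n m (hist m \<omega>) * mean_cf n g (X m \<omega>) \<partial>M)" .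
    have b: "norm (z n m (hist m \<omega>) * (mean_cf n g (X m \<omega>) - 1)) \<le> exp (vm / 2) * \<delta> n" for \<omega>
      unfolding norm_mult using nz[of m n] m \<delta>[of n] by (intro mult_mono) auto
    have i: "integrable M (\<lambda>\<omega>. z n m (hist m \<omega>) * (mean_cf n g (X m \<omega>) - 1))"
    proof (rule integrable_const_bound[where B="exp (vm / 2) * \<delta> n"])
      show "(\<lambda>\<omega>. z n m (hist m \<omega>) * (mean_cf n g (X m \<omega>) - 1)) \<in> borel_measurable M"
        using measurable_compose[OF measurable_hist, of "\<lambda>h. z n m h * (mean_cf n g (last h) - 1)" borel m] by (simp add: last_hist)
    qed (use b in auto)
    have "(\<integral>\<omega>. z n m (hist m \<omega>) * mean_cf n g (X m \<omega>) \<partial>M) = (\<integral>\<omega>. z n m (hist m \<omega>) * (mean_cf n g (X m \<omega>) - 1) + z n m (hist m \<omega>) \<partial>M)"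
      by (simp add: algebra_simps)
    also have "\<dots> = (\<integral>\<omega>. z n m (hist m \<omega>) * (mean_cf n g (X m \<omega>) - 1) \<partial>M) + (\<integral>\<omega>. z n m (hist m \<omega>) \<partial>M)"
      using i iz[of m n] m by (intro Bochner_Integration.integral_add) auto
    finally have q: "(\<integral>\<omega>. z n (Suc m) (hist (Suc m) \<omega>) \<partial>M) - (\<integral>\<omega>. z n m (hist m \<omega>) \<partial>M) = (\<integral>\<omega>. z n m (hist m \<omega>) * (mean_cf n g (X m \<omega>) - 1) \<partial>M)"
      unfolding e by simp
    have "norm ((\<integral>\<omega>. z n (Suc m) (hist (Suc m) \<omega>) \<partial>M) - (\<integral>\<omega>. z n m (hist m \<omega>) \<partial>M)) \<le> (\<integral>\<omega>. norm (z n m (hist m \<omega>) * (mean_cf n g (X m \<omega>) - 1)) \<partial>M)"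
      unfolding q by (rule integral_norm_bound)
    also have "\<dots> \<le> (\<integral>\<omega>. exp (vm / 2) * \<delta> n \<partial>M)"
      by (rule integral_mono[OF integrable_norm[OF i] integrable_const b])
    finally show ?thesis by (simp add: prob_space)
  qed
  have tele: "norm ((\<integral>\<omega>. z n m (hist m \<omega>) \<partial>M) - (\<integral>\<omega>. F (hist k0 \<omega>) \<partial>M)) \<le> real (m - k0) * (exp (vm / 2) * \<delta> n)"
    if "k0 \<le> m" "m \<le> n" for n m
    using that
  proof (induction m rule: dec_induct)
    case base then show ?case by (simp add: z_def pr_def take_hist)
  next
    case (step m)
    have "norm ((\<integral>\<omega>. z n (Suc m) (hist (Suc m) \<omega>) \<partial>M) - (\<integral>\<omega>. F (hist k0 \<omega>) \<partial>M))
       \<le> norm ((\<integral>\<omega>. z n (Suc m) (hist (Suc m) \<omega>) \<partial>M) - (\<integral>\<omega>. z n m (hist m \<omega>) \<partial>M)) + norm ((\<integral>\<omega>. z n m (hist m \<omega>) \<partial>M) - (\<integral>\<omega>. F (hist k0 \<omega>) \<partial>M))"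
      by (rule norm_diff_triangle_le[OF order_refl order_refl])
    also have "\<dots> \<le> exp (vm / 2) * \<delta> n + real (m - k0) * (exp (vm / 2) * \<delta> n)"
      using step onestep[of m n] by (intro add_mono) auto
    also have "\<dots> = real (Suc m - k0) * (exp (vm / 2) * \<delta> n)" using step by (simp add: Suc_diff_le algebra_simps)
    finally show ?case .
  qed
  define W where "W n = (\<integral>\<omega>. z n n (hist n \<omega>) \<partial>M)" for n
  have Wlim: "W \<longlonglongrightarrow> (\<integral>\<omega>. F (hist k0 \<omega>) \<partial>M)"
  proof (rule LIM_zero_cancel, rule Lim_null_comparison[where g="\<lambda>n. exp (vm / 2) * (\<Sum>x\<le>L. real n * norm (mean_cf n g x - 1))"])
    show "\<forall>\<^sub>F n in sequentially. norm (W n - (\<integral>\<omega>. F (hist k0 \<omega>) \<partial>M)) \<le> exp (vm / 2) * (\<Sum>x\<le>L. real n * norm (mean_cf n g x - 1))"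
      using eventually_ge_at_top[of k0]
    proof eventually_elim
      case (elim n)
      have "0 \<le> \<delta> n" unfolding \<delta>_def by (intro sum_nonneg) auto
      then have "real (n - k0) * (exp (vm / 2) * \<delta> n) \<le> real n * (exp (vm / 2) * \<delta> n)" by (intro mult_right_mono) auto
      then show ?case using tele[OF elim order_refl] by (simp add: W_def \<delta>_def sum_distrib_left mult_ac)
    qed
    have "(\<lambda>n. exp (vm / 2) * (\<Sum>x\<le>L. real n * norm (mean_cf n g x - 1))) \<longlonglongrightarrow> exp (vm / 2) * (\<Sum>x\<le>L. 0)"
      by (intro tendsto_intros mean_cf_tendsto)
    then show "(\<lambda>n. exp (vm / 2) * (\<Sum>x\<le>L. real n * norm (mean_cf n g x - 1))) \<longlonglongrightarrow> 0" by simp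
  qed
  define J where "J n = (\<integral>\<omega>. F (hist k0 \<omega>) * iexp ((\<Sum>k\<in>{k0..<n}. incr g k \<omega>) / sqrt (real n)) \<partial>M)" for n
  have mF: "(\<lambda>\<omega>. F (hist k0 \<omega>)) \<in> borel_measurable M" by (rule measurable_compose[OF measurable_hist]) simp
  have cc: "cubic (condvar g)" unfolding cubic_def
    by (rule exI[of _ vm]) (use bv vm0 in \<open>auto simp: cubic_bound_def intro!: order_trans[OF bv] mult_le_cancel_left1[THEN iffD2]\<close>)
  \<comment> \<open>Here the random compensator is exchanged for its limit \<open>V / 2\<close>. The
    price is the error of the law of large numbers in mean, plus the \<open>k0\<close> initial terms
    missing from the product, which cost order \<open>1 / n\<close>.\<close>
  have JW: "norm (J n * exp (complex_of_real (V / 2)) - W n)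
      \<le> exp (vm / 2) * (expectation (\<lambda>\<omega>. \<bar>(\<Sum>k<n. condvar g (X k \<omega>)) / real n - V\<bar>) / 2 + (real k0 * vm / 2) / real n)"
    if n: "k0 \<le> n" "0 < n" for n
  proof -
    define T where "T \<omega> = (\<Sum>k\<in>{k0..<n}. condvar g (X k \<omega>)) / (2 * real n)" for \<omega>
    define S where "S \<omega> = (\<Sum>k\<in>{k0..<n}. incr g k \<omega>) / sqrt (real n)" for \<omega>
    have [measurable]: "S \<in> borel_measurable M" "T \<in> borel_measurable M" unfolding S_def T_def by measurable
    have zn: "z n n (hist n \<omega>) = F (hist k0 \<omega>) * (iexp (S \<omega>) * exp (complex_of_real (T \<omega>)))" for \<omega>
    proof -
      have "pr n n (hist n \<omega>) = (\<Prod>k\<in>{k0..<n}. exp (complex_of_real (condvar g (X k \<omega>) / (2 * real n))) * iexp (incr g k \<omega> / sqrt (real n)))"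
        unfolding pr_def by (intro prod.cong) (auto simp: nth_hist step_cf_def incr_def simp del: inar.simps)
      also have "\<dots> = exp (complex_of_real (T \<omega>)) * iexp (S \<omega>)"
        by (simp add: prod.distrib exp_sum[symmetric] T_def S_def sum_divide_distrib sum_distrib_left)
      finally show ?thesis using n by (simp add: z_def take_hist mult.commute del: take_Suc)
    qed
    have Tb: "T \<omega> \<le> vm / 2" "0 \<le> T \<omega>" for \<omega>
    proof -
      have "(\<Sum>k\<in>{k0..<n}. condvar g (X k \<omega>)) \<le> real (card {k0..<n}) * vm" using vm by (intro sum_bounded_above) auto
      also have "\<dots> \<le> real n * vm" using vm0 n by (intro mult_right_mono) auto
      finally show "T \<omega> \<le> vm / 2" using n by (simp add: T_def field_simps)
      show "0 \<le> T \<omega>" unfolding T_def by (intro divide_nonneg_nonneg sum_nonneg condvar_nonneg) auto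
    qed
    have nE: "norm (iexp r) = 1" for r by simp
    have nexp: "norm (exp (complex_of_real r) - exp (complex_of_real r')) = \<bar>exp r - exp r'\<bar>" for r r'
      unfolding exp_of_real of_real_diff[symmetric] norm_of_real ..
    have pw: "norm (F (hist k0 \<omega>) * iexp (S \<omega>) * exp (complex_of_real (V / 2)) - z n n (hist n \<omega>))
      \<le> exp (vm / 2) * (\<bar>(\<Sum>k<n. condvar g (X k \<omega>)) / real n - V\<bar> / 2 + (real k0 * vm / 2) / real n)" for \<omega>
    proof -
      have "F (hist k0 \<omega>) * iexp (S \<omega>) * exp (complex_of_real (V / 2)) - z n n (hist n \<omega>)
        = F (hist k0 \<omega>) * (iexp (S \<omega>) * (exp (complex_of_real (V / 2)) - exp (complex_of_real (T \<omega>))))"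
        unfolding zn by (simp add: algebra_simps)
      also have "norm \<dots> \<le> 1 * (1 * \<bar>exp (V / 2) - exp (T \<omega>)\<bar>)"
        unfolding norm_mult nexp nE by (intro mult_mono F) auto
      also have "\<dots> \<le> exp (vm / 2) * \<bar>V / 2 - T \<omega>\<bar>" using exp_lipschitz[of "V / 2" "vm / 2" "T \<omega>"] V Tb by simp
      also have "\<dots> \<le> exp (vm / 2) * (\<bar>(\<Sum>k<n. condvar g (X k \<omega>)) / real n - V\<bar> / 2 + (real k0 * vm / 2) / real n)"
      proof (rule mult_left_mono)
        have "(\<Sum>k<n. condvar g (X k \<omega>)) = (\<Sum>k<k0. condvar g (X k \<omega>)) + (\<Sum>k\<in>{k0..<n}. condvar g (X k \<omega>))"
          using n by (subst sum.union_disjoint[symmetric]) (auto intro!: sum.cong)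
        then have "T \<omega> = ((\<Sum>k<n. condvar g (X k \<omega>)) / real n) / 2 - ((\<Sum>k<k0. condvar g (X k \<omega>)) / 2) / real n"
          using n by (simp add: T_def field_simps)
        moreover have "0 \<le> ((\<Sum>k<k0. condvar g (X k \<omega>)) / 2) / real n" by (intro divide_nonneg_nonneg sum_nonneg condvar_nonneg) auto
        moreover have "((\<Sum>k<k0. condvar g (X k \<omega>)) / 2) / real n \<le> (real k0 * vm / 2) / real n"
          using sum_bounded_above[of "{..<k0}" "\<lambda>k. condvar g (X k \<omega>)" vm] vm by (intro divide_right_mono) auto
        moreover have "\<bar>V / 2 - t\<bar> \<le> \<bar>a - V\<bar> / 2 + c" if "t = a / 2 - b" "0 \<le> b" "b \<le> c" for t a b c :: real
          using that by (simp add: abs_if field_simps)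
        ultimately show "\<bar>V / 2 - T \<omega>\<bar> \<le> \<bar>(\<Sum>k<n. condvar g (X k \<omega>)) / real n - V\<bar> / 2 + (real k0 * vm / 2) / real n"
          by blast
      qed simp
      finally show ?thesis .
    qed
    have iJ: "integrable M (\<lambda>\<omega>. F (hist k0 \<omega>) * iexp (S \<omega>))"
      by (rule integrable_const_bound[where B=1]) (use F mF in \<open>auto simp: norm_mult\<close>)
    have iC: "integrable M (\<lambda>\<omega>. \<bar>(\<Sum>k<n. condvar g (X k \<omega>)) / real n - V\<bar>)"
      using integrable_cubic_X[OF cc] by simp
    have q: "J n * exp (complex_of_real (V / 2)) - W n = (\<integral>\<omega>. F (hist k0 \<omega>) * iexp (S \<omega>) * exp (complex_of_real (V / 2)) - z n n (hist n \<omega>) \<partial>M)"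
      using iJ iz[of n n] by (simp add: J_def W_def S_def[symmetric])
    have "norm (J n * exp (complex_of_real (V / 2)) - W n) \<le> (\<integral>\<omega>. norm (F (hist k0 \<omega>) * iexp (S \<omega>) * exp (complex_of_real (V / 2)) - z n n (hist n \<omega>)) \<partial>M)"
      unfolding q by (rule integral_norm_bound)
    also have "\<dots> \<le> (\<integral>\<omega>. exp (vm / 2) * (\<bar>(\<Sum>k<n. condvar g (X k \<omega>)) / real n - V\<bar> / 2 + (real k0 * vm / 2) / real n) \<partial>M)"
    proof (rule integral_mono)
      show "integrable M (\<lambda>\<omega>. norm (F (hist k0 \<omega>) * iexp (S \<omega>) * exp (complex_of_real (V / 2)) - z n n (hist n \<omega>)))"
        using iJ iz[of n n] by (intro integrable_norm Bochner_Integration.integrable_diff integrable_mult_left) auto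
      show "integrable M (\<lambda>\<omega>. exp (vm / 2) * (\<bar>(\<Sum>k<n. condvar g (X k \<omega>)) / real n - V\<bar> / 2 + (real k0 * vm / 2) / real n))"
        using iC by simp
    qed (rule pw)
    also have "\<dots> = exp (vm / 2) * (expectation (\<lambda>\<omega>. \<bar>(\<Sum>k<n. condvar g (X k \<omega>)) / real n - V\<bar>) / 2 + (real k0 * vm / 2) / real n)"
      using iC by (simp add: prob_space)
    finally show ?thesis .
  qed
  have "(\<lambda>n. J n * exp (complex_of_real (V / 2)) - W n) \<longlonglongrightarrow> 0"
  proof (rule Lim_null_comparison[where g="\<lambda>n. exp (vm / 2) * (expectation (\<lambda>\<omega>. \<bar>(\<Sum>k<n. condvar g (X k \<omega>)) / real n - V\<bar>) / 2 + (real k0 * vm / 2) / real n)"])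
    show "\<forall>\<^sub>F n in sequentially. norm (J n * exp (complex_of_real (V / 2)) - W n)
      \<le> exp (vm / 2) * (expectation (\<lambda>\<omega>. \<bar>(\<Sum>k<n. condvar g (X k \<omega>)) / real n - V\<bar>) / 2 + (real k0 * vm / 2) / real n)"
      using eventually_ge_at_top[of k0] eventually_gt_at_top[of 0] by eventually_elim (rule JW)
    have "(\<lambda>n. exp (vm / 2) * (expectation (\<lambda>\<omega>. \<bar>(\<Sum>k<n. condvar g (X k \<omega>)) / real n - V\<bar>) / 2 + (real k0 * vm / 2) / real n))
      \<longlonglongrightarrow> exp (vm / 2) * (0 / 2 + 0)"
      unfolding V_def by (intro tendsto_intros lln cc lim_const_over_n) auto
    then show "(\<lambda>n. exp (vm / 2) * (expectation (\<lambda>\<omega>. \<bar>(\<Sum>k<n. condvar g (X k \<omega>)) / real n - V\<bar>) / 2 + (real k0 * vm / 2) / real n)) \<longlonglongrightarrow> 0" by simp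
  qed
  from tendsto_add[OF this Wlim] have "(\<lambda>n. J n * exp (complex_of_real (V / 2))) \<longlonglongrightarrow> (\<integral>\<omega>. F (hist k0 \<omega>) \<partial>M)" by simp
  then have "(\<lambda>n. (J n * exp (complex_of_real (V / 2))) * exp (complex_of_real (- V / 2))) \<longlonglongrightarrow> (\<integral>\<omega>. F (hist k0 \<omega>) \<partial>M) * exp (complex_of_real (- V / 2))"
    by (intro tendsto_intros)
  moreover have "exp (complex_of_real (V / 2)) * exp (complex_of_real (- V / 2)) = 1"
    unfolding exp_add[symmetric] of_real_add[symmetric] by simp
  ultimately have "J \<longlonglongrightarrow> (\<integral>\<omega>. F (hist k0 \<omega>) \<partial>M) * exp (complex_of_real (- V / 2))" by (simp add: mult.assoc)
  then show ?thesis unfolding J_def[abs_def] V_def exp_of_real .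
qed

text \<open>The predictable factor is split at a level \<open>L\<close>. By orthogonality the
  normalised second moment of the discarded part is bounded by a Cesaro mean tending to
  \<open>\<tau> L\<close>, and the characteristic exponential moves by at most the modulus of that
  part.\<close>

theorem clt:
  fixes F :: "nat list \<Rightarrow> complex"
  assumes g: "cubic (condvar g)" and F: "\<And>h. norm (F h) \<le> 1"
  shows "(\<lambda>n. \<integral>\<omega>. F (hist k0 \<omega>) * iexp ((\<Sum>k\<in>{k0..<n}. incr g k \<omega>) / sqrt (real n)) \<partial>M)
     \<longlonglongrightarrow> (\<integral>\<omega>. F (hist k0 \<omega>) \<partial>M) * complex_of_real (exp (- stat_mean (condvar g) / 2))"
proof (rule LIMSEQ_I)
  fix e :: real assume e: "0 < e"
  define V where "V = stat_mean (condvar g)"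
  define gl where "gl L x = g x * indicator {..L} x" for L x
  define gt where "gt L x = g x * indicator {L<..} x" for L x
  have vl: "condvar (gl L) = (\<lambda>x. condvar g x * indicator {..L} x)" and vt: "condvar (gt L) = (\<lambda>x. condvar g x * indicator {L<..} x)" for L
    by (auto simp: condvar_def gl_def gt_def fun_eq_iff indicator_def)
  have cg: "cubic (condvar (gl L))" "cubic (condvar (gt L))" for L unfolding vl vt by (intro cubic_trunc g)+
  define \<tau> where "\<tau> L = stat_mean (condvar (gt L))" for L
  have \<tau>0: "\<tau> \<longlonglongrightarrow> 0" unfolding \<tau>_def[abs_def] vt by (rule cubic_tail_pi[OF g])
  have Vs: "V = stat_mean (condvar (gl L)) + \<tau> L" for L unfolding V_def \<tau>_def vl vt by (rule expectation_cubic_split[OF g stat_law3])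
  have "(\<lambda>L. sqrt (\<tau> L)) \<longlonglongrightarrow> sqrt 0" using \<tau>0 by (rule tendsto_real_sqrt)
  then have "\<forall>\<^sub>F L in sequentially. sqrt (\<tau> L) < e / 4" by (rule order_tendstoD(2)) (use e in simp)
  moreover have "\<forall>\<^sub>F L in sequentially. \<bar>exp (- (V - \<tau> L) / 2) - exp (- V / 2)\<bar> < e / 4"
  proof -
    have "(\<lambda>L. exp (- (V - \<tau> L) / 2)) \<longlonglongrightarrow> exp (- (V - 0) / 2)" by (intro tendsto_intros \<tau>0) simp
    from tendstoD[OF this, of "e / 4"] e show ?thesis by (simp add: dist_real_def)
  qed
  ultimately have "\<forall>\<^sub>F L in sequentially. sqrt (\<tau> L) < e / 4 \<and> \<bar>exp (- (V - \<tau> L) / 2) - exp (- V / 2)\<bar> < e / 4"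
    by eventually_elim simp
  then obtain L where L: "sqrt (\<tau> L) < e / 4" "\<bar>exp (- (V - \<tau> L) / 2) - exp (- V / 2)\<bar> < e / 4"
    using eventually_happens'[OF sequentially_bot] by blast
  define J where "J h n = (\<integral>\<omega>. F (hist k0 \<omega>) * iexp ((\<Sum>k\<in>{k0..<n}. incr h k \<omega>) / sqrt (real n)) \<partial>M)" for h n
  define m where "m = (\<integral>\<omega>. F (hist k0 \<omega>) \<partial>M)"
  have mF: "(\<lambda>\<omega>. F (hist k0 \<omega>)) \<in> borel_measurable M" by (rule measurable_compose[OF measurable_hist]) simp
  have m1: "norm m \<le> 1"
  proof -
    have "norm m \<le> (\<integral>\<omega>. norm (F (hist k0 \<omega>)) \<partial>M)" unfolding m_def by (rule integral_norm_bound)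
    also have "\<dots> \<le> (\<integral>\<omega>. 1 \<partial>M)"
      by (intro integral_mono F integrable_norm integrable_const_bound[where B=1] mF) (use F in auto)
    finally show ?thesis by (simp add: prob_space)
  qed
  have "J (gl L) \<longlonglongrightarrow> m * complex_of_real (exp (- stat_mean (condvar (gl L)) / 2))"
    unfolding J_def[abs_def] m_def by (rule clt_truncated[OF _ F, of L]) (simp add: gl_def)
  moreover have "stat_mean (condvar (gl L)) = V - \<tau> L" using Vs[of L] by simp
  ultimately have "J (gl L) \<longlonglongrightarrow> m * complex_of_real (exp (- (V - \<tau> L) / 2))" by simp
  from tendstoD[OF this, of "e / 4"] e
  have ev1: "\<forall>\<^sub>F n in sequentially. norm (J (gl L) n - m * complex_of_real (exp (- (V - \<tau> L) / 2))) < e / 4"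
    by (simp add: dist_norm)
  have "(\<lambda>n. sqrt ((\<Sum>k<n. expectation (\<lambda>\<omega>. condvar (gt L) (X k \<omega>))) / real n)) \<longlonglongrightarrow> sqrt (\<tau> L)"
    unfolding \<tau>_def by (intro tendsto_real_sqrt LIMSEQ_cesaro law_cubic_tendsto cg)
  then have ev2: "\<forall>\<^sub>F n in sequentially. sqrt ((\<Sum>k<n. expectation (\<lambda>\<omega>. condvar (gt L) (X k \<omega>))) / real n) < e / 4"
    by (rule order_tendstoD(2)) (rule L(1))
  have diff: "norm (J g n - J (gl L) n) \<le> sqrt ((\<Sum>k<n. expectation (\<lambda>\<omega>. condvar (gt L) (X k \<omega>))) / real n)" if n: "k0 \<le> n" "0 < n" for n
  proof -
    define S where "S h \<omega> = (\<Sum>k\<in>{k0..<n}. incr h k \<omega>)" for h \<omega>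
    have [measurable]: "S h \<in> borel_measurable M" for h unfolding S_def by measurable
    have i: "integrable M (\<lambda>\<omega>. F (hist k0 \<omega>) * iexp (S h \<omega> / sqrt (real n)))" for h
      by (rule integrable_const_bound[where B=1]) (use F mF in \<open>auto simp: norm_mult\<close>)
    have sd: "S g \<omega> - S (gl L) \<omega> = S (gt L) \<omega>" for \<omega>
      unfolding S_def sum_subtractf[symmetric] by (intro sum.cong) (auto simp: incr_def gl_def gt_def indicator_def simp del: inar.simps)
    note sm = second_moment[OF n(1) cg(2)[of L], folded S_def]
    have i2: "integrable M (\<lambda>\<omega>. (S (gt L) \<omega> / sqrt (real n))^2)" using sm(1) by (simp add: power_divide)
    have q: "J g n - J (gl L) n = (\<integral>\<omega>. F (hist k0 \<omega>) * iexp (S g \<omega> / sqrt (real n)) - F (hist k0 \<omega>) * iexp (S (gl L) \<omega> / sqrt (real n)) \<partial>M)"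
      unfolding J_def S_def[symmetric] using i by simp
    have "norm (J g n - J (gl L) n) \<le> (\<integral>\<omega>. norm (F (hist k0 \<omega>) * iexp (S g \<omega> / sqrt (real n)) - F (hist k0 \<omega>) * iexp (S (gl L) \<omega> / sqrt (real n))) \<partial>M)"
      unfolding q by (rule integral_norm_bound)
    also have "\<dots> \<le> (\<integral>\<omega>. \<bar>S (gt L) \<omega> / sqrt (real n)\<bar> \<partial>M)"
    proof (rule integral_mono)
      show "integrable M (\<lambda>\<omega>. \<bar>S (gt L) \<omega> / sqrt (real n)\<bar>)"
        by (rule integrable_abs, rule expectation_abs_le_sqrt(1)[OF _ i2]) measurable
      show "integrable M (\<lambda>\<omega>. norm (F (hist k0 \<omega>) * iexp (S g \<omega> / sqrt (real n)) - F (hist k0 \<omega>) * iexp (S (gl L) \<omega> / sqrt (real n))))"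
        using i by auto
      fix \<omega>
      have "norm (F (hist k0 \<omega>) * iexp (S g \<omega> / sqrt (real n)) - F (hist k0 \<omega>) * iexp (S (gl L) \<omega> / sqrt (real n)))
        = norm (F (hist k0 \<omega>)) * norm (iexp (S g \<omega> / sqrt (real n)) - iexp (S (gl L) \<omega> / sqrt (real n)))"
        unfolding norm_mult[symmetric] by (simp add: right_diff_distrib)
      also have "\<dots> \<le> 1 * \<bar>S g \<omega> / sqrt (real n) - S (gl L) \<omega> / sqrt (real n)\<bar>"
        by (intro mult_mono F norm_iexp_diff) auto
      also have "\<dots> = \<bar>S (gt L) \<omega> / sqrt (real n)\<bar>" by (simp add: diff_divide_distrib[symmetric] sd)
      finally show "norm (F (hist k0 \<omega>) * iexp (S g \<omega> / sqrt (real n)) - F (hist k0 \<omega>) * iexp (S (gl L) \<omega> / sqrt (real n))) \<le> \<bar>S (gt L) \<omega> / sqrt (real n)\<bar>" .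
    qed
    also have "\<dots> \<le> sqrt (expectation (\<lambda>\<omega>. (S (gt L) \<omega> / sqrt (real n))^2))"
      by (rule expectation_abs_le_sqrt(2)[OF _ i2]) measurable
    also have "expectation (\<lambda>\<omega>. (S (gt L) \<omega> / sqrt (real n))^2) = (\<Sum>k\<in>{k0..<n}. expectation (\<lambda>\<omega>. condvar (gt L) (X k \<omega>))) / real n"
      using sm(2) by (simp add: power_divide)
    also have "sqrt \<dots> \<le> sqrt ((\<Sum>k<n. expectation (\<lambda>\<omega>. condvar (gt L) (X k \<omega>))) / real n)"
      by (intro real_sqrt_le_mono divide_right_mono sum_mono2 integral_nonneg_AE) (auto simp: condvar_nonneg)
    finally show ?thesis .
  qed
  have "\<forall>\<^sub>F n in sequentially. norm (J g n - m * complex_of_real (exp (- V / 2))) < e"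
    using ev1 ev2 eventually_ge_at_top[of k0] eventually_gt_at_top[of 0]
  proof eventually_elim
    case (elim n)
    have "J g n - m * complex_of_real (exp (- V / 2)) = (J g n - J (gl L) n) + (J (gl L) n - m * complex_of_real (exp (- (V - \<tau> L) / 2)))
       + m * complex_of_real (exp (- (V - \<tau> L) / 2) - exp (- V / 2))" by (simp add: algebra_simps)
    also have "norm \<dots> \<le> norm (J g n - J (gl L) n) + norm (J (gl L) n - m * complex_of_real (exp (- (V - \<tau> L) / 2)))
       + norm (m * complex_of_real (exp (- (V - \<tau> L) / 2) - exp (- V / 2)))"
      by (intro norm_triangle_mono norm_triangle_ineq order_refl)
    also have "norm (m * complex_of_real (exp (- (V - \<tau> L) / 2) - exp (- V / 2))) \<le> 1 * (e / 4)"
      unfolding norm_mult norm_of_real using m1 L(2) by (intro mult_mono) auto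
    finally show ?case using elim diff[of n] e by linarith
  qed
  then show "\<exists>no. \<forall>n\<ge>no. norm ((\<integral>\<omega>. F (hist k0 \<omega>) * iexp ((\<Sum>k\<in>{k0..<n}. incr g k \<omega>) / sqrt (real n)) \<partial>M) - (\<integral>\<omega>. F (hist k0 \<omega>) \<partial>M) * complex_of_real (exp (- stat_mean (condvar g) / 2))) < e"
    by (simp add: eventually_sequentially J_def m_def V_def)
qed

end

section \<open>Weak convergence from characteristic functions\<close>

text \<open>Finite linear combinations of characters: convergence of their integrals is immediate
  from characteristic functions. Being closed under products, they contain every polynomial in sines
  of linear forms.\<close>

inductive trig_poly :: "('b::euclidean_space \<Rightarrow> complex) \<Rightarrow> bool" where
  iexp: "trig_poly (\<lambda>x. c * iexp (t \<bullet> x))"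
| add: "trig_poly u \<Longrightarrow> trig_poly v \<Longrightarrow> trig_poly (\<lambda>x. u x + v x)"

lemma trig_poly_const: "trig_poly (\<lambda>x. c)"
  using trig_poly.iexp[of c 0] by simp

lemma trig_poly_mult:
  assumes "trig_poly u" "trig_poly v" shows "trig_poly (\<lambda>x. u x * v x)"
  using assms(1)
proof induction
  case (iexp c t)
  show ?case using assms(2)
  proof induction
    case (iexp c' t')
    have "(\<lambda>x. c * iexp (t \<bullet> x) * (c' * iexp (t' \<bullet> x))) = (\<lambda>x. (c * c') * iexp ((t + t') \<bullet> x))"
      by (simp add: fun_eq_iff inner_add_left distrib_left exp_add)
    then show ?case using trig_poly.iexp by metis
  next
    case (add u v) then show ?case using trig_poly.add by (simp add: distrib_left)
  qed
next
  case (add u w) then show ?case using trig_poly.add by (simp add: distrib_right)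
qed

lemma trig_poly_sum:
  assumes "finite I" "\<And>i. i \<in> I \<Longrightarrow> trig_poly (u i)" shows "trig_poly (\<lambda>x. \<Sum>i\<in>I. u i x)"
  using assms
proof (induction rule: finite_induct)
  case empty then show ?case using trig_poly_const[of 0] by simp
next
  case (insert i I) then show ?case by (simp add: trig_poly.add)
qed

lemma trig_poly_sin: "trig_poly (\<lambda>x. complex_of_real (c * sin (t \<bullet> x)))"
proof -
  have e: "complex_of_real (c * sin (t \<bullet> x)) = (c / (2 * \<i>)) * iexp (t \<bullet> x) + (- c / (2 * \<i>)) * iexp ((- t) \<bullet> x)" for x
    by (simp add: sin_of_real[symmetric] sin_exp_eq field_simps)
  show ?thesis unfolding e by (intro trig_poly.intros)
qed

lemma trig_poly_bounded_continuous:
  assumes "trig_poly u" shows "continuous_on UNIV u \<and> (\<exists>C. \<forall>x. norm (u x) \<le> C)"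
  using assms
proof induction
  case (iexp c t)
  have "norm (c * iexp (t \<bullet> x)) \<le> norm c" for x by (simp add: norm_mult)
  then show ?case by (auto intro!: continuous_intros)
next
  case (add u v)
  then obtain C D where "\<And>x. norm (u x) \<le> C" "\<And>x. norm (v x) \<le> D" by blast
  then have "norm (u x + v x) \<le> C + D" for x by (intro norm_triangle_mono) auto
  then show ?case using add by (auto intro!: continuous_intros)
qed

lemma integrable_trig_poly:
  assumes "trig_poly u" "prob_space N" "sets N = sets borel"
  shows "integrable N u"
proof -
  interpret prob_space N by fact
  obtain C where C: "\<And>x. norm (u x) \<le> C" using trig_poly_bounded_continuous[OF assms(1)] by blast
  have "u \<in> borel_measurable N"
    using trig_poly_bounded_continuous[OF assms(1)] assms(3) by (simp add: borel_measurable_continuous_onI cong: measurable_cong_sets)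
  then show ?thesis using C by (intro integrable_const_bound[where B=C]) auto
qed

lemma trig_poly_expectation_tendsto:
  assumes u: "trig_poly u"
    and Ns: "\<And>n. prob_space (Ns n)" "\<And>n. sets (Ns n) = sets borel" and N: "prob_space N" "sets N = sets borel"
    and ch: "\<And>t. (\<lambda>n. CLINT x|Ns n. iexp (t \<bullet> x)) \<longlonglongrightarrow> (CLINT x|N. iexp (t \<bullet> x))"
  shows "(\<lambda>n. CLINT x|Ns n. u x) \<longlonglongrightarrow> (CLINT x|N. u x)"
  using u
proof induction
  case (iexp c t) then show ?case using tendsto_mult[OF tendsto_const[of c] ch[of t]] by simp
next
  case (add u v)
  then show ?case using tendsto_add[OF add.IH]
    by (simp add: integrable_trig_poly[OF _ Ns] integrable_trig_poly[OF _ N])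
qed

text \<open>Coordinatewise sine is a homeomorphism of a small ball into a compact cube; a continuous
  function is transported along it, extended by Tietze and approximated by a polynomial,
  which pulls back to a trigonometric polynomial that is bounded on the whole space.\<close>
lemma trig_poly_approx:
  fixes f :: "'b::euclidean_space \<Rightarrow> real"
  assumes f: "continuous_on UNIV f" and B: "\<And>x. \<bar>f x\<bar> \<le> B" and R: "0 < R" and e: "0 < e"
  shows "\<exists>u. trig_poly (\<lambda>x. complex_of_real (u x)) \<and> (\<forall>x. \<bar>u x\<bar> \<le> B + e) \<and> (\<forall>x. norm x \<le> R \<longrightarrow> \<bar>f x - u x\<bar> \<le> e)"
proof -
  \<comment> \<open>The scale \<open>1 / R\<close> keeps each coordinate of the ball within one
    radian, inside the interval where sine is injective.\<close>
  define E :: "'b \<Rightarrow> 'b" where "E x = (\<Sum>b\<in>Basis. sin (((1 / R) *\<^sub>R b) \<bullet> x) *\<^sub>R b)" for x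
  have Eb: "E x \<bullet> b = sin ((x \<bullet> b) / R)" if "b \<in> Basis" for x b
    using that by (simp add: E_def inner_sum_left_Basis inner_commute[of b x])
  have contE: "continuous_on S E" for S unfolding E_def by (intro continuous_intros)
  have inj: "inj_on E (cball 0 R)"
  proof (rule inj_onI)
    fix x y assume xy: "x \<in> cball 0 R" "y \<in> cball 0 R" "E x = E y"
    show "x = y"
    proof (rule euclidean_eqI)
      fix b :: 'b assume b: "b \<in> Basis"
      have r: "\<bar>(z \<bullet> b) / R\<bar> \<le> pi / 2" if "z \<in> cball 0 R" for z
      proof -
        have "\<bar>z \<bullet> b\<bar> \<le> R" using Basis_le_norm[OF b, of z] that by simp
        then have "\<bar>(z \<bullet> b) / R\<bar> \<le> 1" using R by (simp add: abs_divide)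
        then show ?thesis using pi_gt3 by linarith
      qed
      have sn: "sin ((x \<bullet> b) / R) = sin ((y \<bullet> b) / R)" using Eb[OF b, of x] Eb[OF b, of y] xy by simp
      have "(x \<bullet> b) / R = (y \<bullet> b) / R"
        by (rule sin_inj_pi[OF _ _ _ _ sn]) (use r[OF xy(1)] r[OF xy(2)] in linarith)+
      then show "x \<bullet> b = y \<bullet> b" using R by simp
    qed
  qed
  define S where "S = E ` cball 0 R"
  have cS: "compact S" unfolding S_def by (intro compact_continuous_image contE compact_cball)
  define ginv where "ginv = inv_into (cball 0 R) E"
  have "continuous_on S ginv" unfolding S_def ginv_def
    by (intro continuous_on_inv contE compact_cball) (simp add: inj inv_into_f_f)
  then have cg: "continuous_on S (\<lambda>z. f (ginv z))"
    by (intro continuous_on_compose2[OF f]) auto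
  have B0: "0 \<le> B" using B[of 0] by simp
  \<comment> \<open>The extension keeps the bound \<open>B\<close>. Since \<open>E\<close> maps the
    whole space into the cube, the approximation is bounded by \<open>B + e\<close> even outside the
    ball where it is accurate.\<close>
  obtain g where g: "continuous_on UNIV g" "\<And>z. z \<in> S \<Longrightarrow> g z = f (ginv z)" "\<And>z. \<bar>g z\<bar> \<le> B"
    using Tietze[OF cg, of UNIV B] B0 B compact_imp_closed[OF cS] by (auto simp: closedin_closed_eq)
  obtain p where p: "real_polynomial_function p" "\<And>z. z \<in> cbox (- One) One \<Longrightarrow> \<bar>g z - p z\<bar> < e"
    using Stone_Weierstrass_real_polynomial_function[of "cbox (- One) (One::'b)" g e] e continuous_on_subset[OF g(1)] by auto
  have Ebox: "E x \<in> cbox (- One) One" for x by (simp add: mem_box Eb)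
  have "trig_poly (\<lambda>x. complex_of_real (p (E x)))" using p(1)
  proof (induction p rule: real_polynomial_function.induct)
    case (linear h)
    interpret h: bounded_linear h by fact
    have "h (E x) = (\<Sum>b\<in>Basis. h b * sin (((1 / R) *\<^sub>R b) \<bullet> x))" for x
      by (simp add: E_def h.sum h.scaleR mult.commute)
    then show ?case by (simp only: of_real_sum) (rule trig_poly_sum[OF finite_Basis trig_poly_sin])
  next
    case (const c) then show ?case by (rule trig_poly_const)
  next
    case (add f g) then show ?case by (simp add: trig_poly.add)
  next
    case (mult f g) then show ?case by (simp add: trig_poly_mult)
  qed
  moreover have "\<bar>p (E x)\<bar> \<le> B + e" for x using p(2)[OF Ebox[of x]] g(3)[of "E x"] by linarith
  moreover have "\<bar>f x - p (E x)\<bar> \<le> e" if "norm x \<le> R" for x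
  proof -
    have "E x \<in> S" using that by (simp add: S_def)
    moreover have "ginv (E x) = x" unfolding ginv_def using that by (simp add: inv_into_f_f inj)
    ultimately have "g (E x) = f x" using g(2) by simp
    then show ?thesis using p(2)[OF Ebox[of x]] by simp
  qed
  ultimately show ?thesis by (intro exI[of _ "\<lambda>x. p (E x)"]) auto
qed

text \<open>For \<open>R\<close> nonnegative, a continuous cutoff that is 0 up to \<open>R\<close>
  in absolute value and 1 from \<open>R + 1\<close> on. Its expectations measure mass far out and
  can pass to the limit.\<close>

definition bump :: "real \<Rightarrow> real \<Rightarrow> real" where "bump R r = min 1 (max 0 (\<bar>r\<bar> - R))"

lemma bump_bounds: "0 \<le> bump R r" "bump R r \<le> 1" by (auto simp: bump_def)

lemma isCont_bump: "isCont (bump R) r" unfolding bump_def by (intro continuous_intros)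

lemma char_distr_inner:
  assumes "sets N = sets (borel :: 'b::euclidean_space measure)"
  shows "char (distr N borel (\<lambda>x. x \<bullet> b)) t = (CLINT x|N. iexp ((t *\<^sub>R b) \<bullet> x))"
proof -
  have "(\<lambda>x. x \<bullet> b) \<in> measurable N borel" using assms by (simp cong: measurable_cong_sets)
  then show ?thesis unfolding char_def by (subst integral_distr) (auto simp: inner_commute)
qed

text \<open>The one-dimensional continuity theorem applies to the projection onto \<open>b\<close>;
  tightness of the vectors is reduced to such projections.\<close>

lemma bump_expectation_tendsto:
  fixes Ns :: "nat \<Rightarrow> 'b::euclidean_space measure"
  assumes Ns: "\<And>n. prob_space (Ns n)" "\<And>n. sets (Ns n) = sets borel" and N: "prob_space N" "sets N = sets borel"
    and ch: "\<And>t. (\<lambda>n. CLINT x|Ns n. iexp (t \<bullet> x)) \<longlonglongrightarrow> (CLINT x|N. iexp (t \<bullet> x))"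
  shows "(\<lambda>n. \<integral>x. bump R (x \<bullet> b) \<partial>Ns n) \<longlonglongrightarrow> (\<integral>x. bump R (x \<bullet> b) \<partial>N)"
proof -
  have m: "(\<lambda>x. x \<bullet> b) \<in> measurable (Ns n) borel" "(\<lambda>x. x \<bullet> b) \<in> measurable N borel" for n
    using Ns(2) N(2) by (simp_all cong: measurable_cong_sets)
  have rd: "real_distribution (distr (Ns n) borel (\<lambda>x. x \<bullet> b))" "real_distribution (distr N borel (\<lambda>x. x \<bullet> b))" for n
    unfolding real_distribution_def real_distribution_axioms_def
    using prob_space.prob_space_distr[OF Ns(1) m(1)] prob_space.prob_space_distr[OF N(1) m(2)] by auto
  have "weak_conv_m (\<lambda>n. distr (Ns n) borel (\<lambda>x. x \<bullet> b)) (distr N borel (\<lambda>x. x \<bullet> b))"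
  proof (rule levy_continuity[OF rd])
    show "(\<lambda>n. char (distr (Ns n) borel (\<lambda>x. x \<bullet> b)) t) \<longlonglongrightarrow> char (distr N borel (\<lambda>x. x \<bullet> b)) t" for t
      unfolding char_distr_inner[OF Ns(2)] char_distr_inner[OF N(2)] by (rule ch)
  qed
  then have "(\<lambda>n. integral\<^sup>L (distr (Ns n) borel (\<lambda>x. x \<bullet> b)) (bump R)) \<longlonglongrightarrow> integral\<^sup>L (distr N borel (\<lambda>x. x \<bullet> b)) (bump R)"
    by (rule weak_conv_imp_integral_bdd_continuous_conv[OF rd _ isCont_bump, where B=1]) (use bump_bounds in auto)
  moreover have "bump R \<in> borel_measurable borel"
    by (intro borel_measurable_continuous_onI continuous_at_imp_continuous_on) (simp add: isCont_bump)
  ultimately show ?thesis using m by (simp add: integral_distr)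
qed

text \<open>On a large ball \<open>f\<close> is replaced by a trigonometric polynomial. Outside it
  the difference is at most \<open>2 * B + e\<close> and is paid for by the sum of coordinate
  cutoffs, whose expectations converge to a small number.\<close>

theorem weak_conv_vecI_char:
  fixes Ns :: "nat \<Rightarrow> 'b::euclidean_space measure"
  assumes Ns: "\<And>n. prob_space (Ns n)" "\<And>n. sets (Ns n) = sets borel" and N: "prob_space N" "sets N = sets borel"
    and ch: "\<And>t. (\<lambda>n. CLINT x|Ns n. iexp (t \<bullet> x)) \<longlonglongrightarrow> (CLINT x|N. iexp (t \<bullet> x))"
  shows "weak_conv_vec Ns N"
  unfolding weak_conv_vec_def
proof (intro allI impI)
  fix f :: "'b \<Rightarrow> real" assume f: "continuous_on UNIV f \<and> bounded (range f)"
  then obtain B where B: "\<And>x. \<bar>f x\<bar> \<le> B" by (auto simp: bounded_iff)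
  have B0: "0 \<le> B" using B[of 0] by simp
  interpret N: prob_space N by fact
  show "(\<lambda>n. \<integral>x. f x \<partial>Ns n) \<longlonglongrightarrow> (\<integral>x. f x \<partial>N)"
  proof (rule LIMSEQ_I)
    fix e0 :: real assume e0: "0 < e0"
    \<comment> \<open>Two approximation errors of at most \<open>2 * e + 2 * e * B\<close> and one
      error \<open>e\<close> for the polynomial add up to at most \<open>e0\<close>; the minimum
      with 1 bounds \<open>2 * B + e\<close> by \<open>2 * B + 1\<close>.\<close>
    define e where "e = min 1 (e0 / (4 * B + 10))"
    have e: "0 < e" "e \<le> 1" using e0 B0 by (auto simp: e_def)
    have "e * (4 * B + 10) \<le> (e0 / (4 * B + 10)) * (4 * B + 10)" using B0 by (intro mult_right_mono) (auto simp: e_def)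
    also have "\<dots> = e0" using B0 by simp
    finally have small: "4 * (e * B) + 10 * e \<le> e0" by (simp add: algebra_simps)
    define \<Phi> where "\<Phi> R x = (\<Sum>b\<in>Basis. bump R (x \<bullet> b))" for R and x :: 'b
    have cbump: "continuous_on UNIV (bump R)" for R by (intro continuous_at_imp_continuous_on ballI isCont_bump)
    have mb: "(\<lambda>x. bump R (x \<bullet> b)) \<in> borel_measurable borel" for R and b :: 'b
      by (intro borel_measurable_continuous_onI continuous_on_compose2[OF cbump] continuous_intros) auto
    have ib: "integrable D (\<lambda>x. bump R (x \<bullet> b))" if "prob_space D" "sets D = sets borel" for R b and D :: "'b measure"
    proof -
      interpret D: prob_space D by fact
      show ?thesis using mb bump_bounds that(2) by (intro D.integrable_const_bound[where B=1]) (auto cong: measurable_cong_sets)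
    qed
    have i\<Phi>: "integrable D (\<Phi> R)" if "prob_space D" "sets D = sets borel" for R and D :: "'b measure"
      unfolding \<Phi>_def by (intro Bochner_Integration.integrable_sum ib that)
    have "(\<lambda>R. \<integral>x. \<Phi> (real R) x \<partial>N) \<longlonglongrightarrow> (\<integral>x. 0 \<partial>N)"
    proof (rule integral_dominated_convergence[where w="\<lambda>x. real (card (Basis::'b set))"])
      show "AE x in N. (\<lambda>R. \<Phi> (real R) x) \<longlonglongrightarrow> 0"
      proof (rule AE_I2)
        fix x :: 'b
        have "\<forall>\<^sub>F R in sequentially. bump (real R) (x \<bullet> b) = 0" for b
        proof -
          obtain R0 where "\<bar>x \<bullet> b\<bar> \<le> real R0" using real_arch_simple by blast
          then show ?thesis unfolding eventually_sequentially by (intro exI[of _ R0]) (auto simp: bump_def)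
        qed
        then have "(\<lambda>R. bump (real R) (x \<bullet> b)) \<longlonglongrightarrow> 0" for b by (rule tendsto_eventually)
        then have "(\<lambda>R. \<Phi> (real R) x) \<longlonglongrightarrow> (\<Sum>b\<in>(Basis::'b set). 0)" unfolding \<Phi>_def by (intro tendsto_sum)
        then show "(\<lambda>R. \<Phi> (real R) x) \<longlonglongrightarrow> 0" by simp
      qed
      show "AE x in N. norm (\<Phi> (real R) x) \<le> real (card (Basis::'b set))" for R
      proof (rule AE_I2)
        fix x :: 'b
        have "\<Phi> (real R) x \<le> real (card (Basis::'b set)) * 1" unfolding \<Phi>_def by (intro sum_bounded_above bump_bounds)
        moreover have "0 \<le> \<Phi> (real R) x" unfolding \<Phi>_def by (intro sum_nonneg bump_bounds)
        ultimately show "norm (\<Phi> (real R) x) \<le> real (card (Basis::'b set))" by simp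
      qed
      show "(\<lambda>x. \<Phi> (real R) x) \<in> borel_measurable N" for R using i\<Phi>[OF N] by simp
    qed auto
    then have "(\<lambda>R. \<integral>x. \<Phi> (real R) x \<partial>N) \<longlonglongrightarrow> 0" by simp
    then have "\<forall>\<^sub>F R in sequentially. (\<integral>x. \<Phi> (real R) x \<partial>N) < e" by (rule order_tendstoD(2)) (rule e(1))
    then obtain R0 :: nat where R0: "(\<integral>x. \<Phi> (real R0) x \<partial>N) < e" using eventually_happens'[OF sequentially_bot] by blast
    define R where "R = real R0"
    \<comment> \<open>A vector longer than this has a coordinate exceeding \<open>R + 1\<close> in
      absolute value, because the norm is at most the sum of the coordinate moduli.\<close>
    define R1 where "R1 = real (card (Basis::'b set)) * (R + 1)"
    have R1: "0 < R1" unfolding R1_def R_def by simp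
    have \<Phi>0: "0 \<le> \<Phi> R x" for x unfolding \<Phi>_def by (intro sum_nonneg bump_bounds)
    have \<Phi>1: "1 \<le> \<Phi> R x" if x: "R1 < norm x" for x
    proof -
      have "\<exists>b\<in>Basis. R + 1 < \<bar>x \<bullet> b\<bar>"
      proof (rule ccontr)
        assume "\<not> ?thesis"
        then have "(\<Sum>b\<in>Basis. \<bar>x \<bullet> b\<bar>) \<le> real (card (Basis::'b set)) * (R + 1)" by (intro sum_bounded_above) auto
        then show False using x norm_le_l1[of x] by (simp add: R1_def)
      qed
      then obtain b where b: "b \<in> Basis" "R + 1 < \<bar>x \<bullet> b\<bar>" by blast
      then have "1 = bump R (x \<bullet> b)" by (simp add: bump_def)
      also have "\<dots> \<le> \<Phi> R x" unfolding \<Phi>_def using b bump_bounds by (intro member_le_sum) auto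
      finally show ?thesis .
    qed
    obtain u where u: "trig_poly (\<lambda>x. complex_of_real (u x))" "\<And>x. \<bar>u x\<bar> \<le> B + e" "\<And>x. norm x \<le> R1 \<Longrightarrow> \<bar>f x - u x\<bar> \<le> e"
      using trig_poly_approx[of f B R1 e] f B R1 e by blast
    have cu: "continuous_on UNIV u"
    proof -
      have "continuous_on UNIV (\<lambda>x. Re (complex_of_real (u x)))"
        using trig_poly_bounded_continuous[OF u(1)] by (intro continuous_intros) auto
      then show ?thesis by simp
    qed
    have pw: "\<bar>f x - u x\<bar> \<le> e + (2 * B + e) * \<Phi> R x" for x
    proof (cases "norm x \<le> R1")
      case True
      have "0 \<le> (2 * B + e) * \<Phi> R x" using B0 e \<Phi>0 by simp
      then show ?thesis using u(3)[OF True] by linarith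
    next
      case False
      have "\<bar>f x - u x\<bar> \<le> (2 * B + e) * 1" using B[of x] u(2)[of x] abs_triangle_ineq4[of "f x" "u x"] by simp
      also have "\<dots> \<le> (2 * B + e) * \<Phi> R x" using False \<Phi>1[of x] B0 e by (intro mult_left_mono) auto
      finally show ?thesis using e by linarith
    qed
    have dist: "\<bar>(\<integral>x. f x \<partial>D) - (\<integral>x. u x \<partial>D)\<bar> \<le> e + (2 * B + e) * (\<integral>x. \<Phi> R x \<partial>D)"
      if D: "prob_space D" "sets D = sets borel" for D :: "'b measure"
    proof -
      interpret D: prob_space D by fact
      have i: "integrable D h" if "continuous_on UNIV h" "\<And>x. \<bar>h x\<bar> \<le> C" for h :: "'b \<Rightarrow> real" and C :: real
      proof (rule D.integrable_const_bound[where B=C])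
        show "h \<in> borel_measurable D"
          using borel_measurable_continuous_onI[OF that(1)] D(2) by (simp cong: measurable_cong_sets)
      qed (use that(2) in simp)
      have i: "integrable D f" "integrable D u"
        using i[of f B] i[of u "B + e"] f cu B u(2) by auto
      have q: "(\<integral>x. f x \<partial>D) - (\<integral>x. u x \<partial>D) = (\<integral>x. f x - u x \<partial>D)" using i by simp
      have "\<bar>(\<integral>x. f x \<partial>D) - (\<integral>x. u x \<partial>D)\<bar> \<le> (\<integral>x. \<bar>f x - u x\<bar> \<partial>D)"
        unfolding q using integral_norm_bound[of D "\<lambda>x. f x - u x"] by simp
      also have "\<dots> \<le> (\<integral>x. e + (2 * B + e) * \<Phi> R x \<partial>D)"
      proof (rule integral_mono)
        show "integrable D (\<lambda>x. \<bar>f x - u x\<bar>)" using i by simp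
        show "integrable D (\<lambda>x. e + (2 * B + e) * \<Phi> R x)" using i\<Phi>[OF D] by simp
      qed (rule pw)
      also have "\<dots> = e + (2 * B + e) * (\<integral>x. \<Phi> R x \<partial>D)" using i\<Phi>[OF D, of R] by (simp add: D.prob_space)
      finally show ?thesis .
    qed
    have t\<Phi>: "(\<lambda>n. \<integral>x. \<Phi> R x \<partial>Ns n) \<longlonglongrightarrow> (\<integral>x. \<Phi> R x \<partial>N)"
      unfolding \<Phi>_def Bochner_Integration.integral_sum[OF ib[OF N]] Bochner_Integration.integral_sum[OF ib[OF Ns]]
      by (intro tendsto_sum bump_expectation_tendsto Ns N ch)
    have tu: "(\<lambda>n. \<integral>x. u x \<partial>Ns n) \<longlonglongrightarrow> (\<integral>x. u x \<partial>N)"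
      using tendsto_Re[OF trig_poly_expectation_tendsto[OF u(1) Ns N ch]] by (simp only: integral_complex_of_real Re_complex_of_real)
    have "\<forall>\<^sub>F n in sequentially. (\<integral>x. \<Phi> R x \<partial>Ns n) < e" using t\<Phi> R0 unfolding R_def by (rule order_tendstoD(2))
    moreover have "\<forall>\<^sub>F n in sequentially. \<bar>(\<integral>x. u x \<partial>Ns n) - (\<integral>x. u x \<partial>N)\<bar> < e"
      using tendstoD[OF tu e(1)] by (simp add: dist_real_def)
    ultimately have "\<forall>\<^sub>F n in sequentially. \<bar>(\<integral>x. f x \<partial>Ns n) - (\<integral>x. f x \<partial>N)\<bar> < e0"
    proof eventually_elim
      case (elim n)
      have "(2 * B + e) * r \<le> 2 * (e * B) + e" if "0 \<le> r" "r < e" for r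
      proof -
        have "(2 * B + e) * r \<le> (2 * B + 1) * e" using that B0 e by (intro mult_mono) auto
        then show ?thesis by (simp add: algebra_simps)
      qed
      then have "(2 * B + e) * (\<integral>x. \<Phi> R x \<partial>Ns n) \<le> 2 * (e * B) + e" "(2 * B + e) * (\<integral>x. \<Phi> R x \<partial>N) \<le> 2 * (e * B) + e"
        using elim(1) R0 \<Phi>0 by (simp_all add: R_def integral_nonneg_AE)
      then show ?case using dist[OF Ns, of n] dist[OF N] elim(2) e(1) small by linarith
    qed
    then show "\<exists>no. \<forall>n\<ge>no. norm ((\<integral>x. f x \<partial>Ns n) - (\<integral>x. f x \<partial>N)) < e0"
      by (simp add: eventually_sequentially)
  qed
qed

text \<open>Image of two independent standard normals under the linear map sending
  \<open>(p, q)\<close> to \<open>p *\<^sub>R u + q *\<^sub>R w\<close>. The vectors may be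
  dependent or zero, so degenerate laws are covered.\<close>

lemma centered_gaussian_ex:
  fixes u w :: "'b::euclidean_space"
  shows "\<exists>N. centered_gaussian (\<lambda>t. (t \<bullet> u)^2 + (t \<bullet> w)^2) N"
proof -
  let ?S = "std_normal_distribution"
  interpret S: real_distribution ?S by (rule real_dist_normal_dist)
  interpret SS: pair_prob_space ?S ?S ..
  define h :: "real \<times> real \<Rightarrow> 'b" where "h z = fst z *\<^sub>R u + snd z *\<^sub>R w" for z
  have ss: "sets (?S \<Otimes>\<^sub>M ?S) = sets (borel \<Otimes>\<^sub>M borel)" by (intro sets_pair_measure_cong) auto
  have h: "h \<in> measurable (?S \<Otimes>\<^sub>M ?S) borel" unfolding h_def[abs_def] measurable_cong_sets[OF ss refl] by measurable
  define N where "N = distr (?S \<Otimes>\<^sub>M ?S) borel h"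
  have "(CLINT x|N. iexp (t \<bullet> x)) = complex_of_real (exp (- ((t \<bullet> u)^2 + (t \<bullet> w)^2) / 2))" for t
  proof -
    have "(CLINT x|N. iexp (t \<bullet> x)) = (CLINT z|?S \<Otimes>\<^sub>M ?S. iexp (t \<bullet> h z))"
      unfolding N_def by (rule integral_distr[OF h]) simp
    also have "\<dots> = (CLINT x|?S. (CLINT y|?S. iexp (t \<bullet> h (x, y))))"
    proof (rule SS.integral_fst'[symmetric])
      show "integrable (?S \<Otimes>\<^sub>M ?S) (\<lambda>z. iexp (t \<bullet> h z))"
        by (rule SS.integrable_const_bound[where B=1]) (use h in auto)
    qed
    also have "\<dots> = (CLINT x|?S. iexp ((t \<bullet> u) * x) * (CLINT y|?S. iexp ((t \<bullet> w) * y)))"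
      by (simp add: h_def inner_add_right distrib_left exp_add mult.commute)
    also have "\<dots> = char ?S (t \<bullet> u) * char ?S (t \<bullet> w)" by (simp add: char_def)
    also have "\<dots> = complex_of_real (exp (- ((t \<bullet> u)^2) / 2) * exp (- ((t \<bullet> w)^2) / 2))"
      by (simp add: char_std_normal_distribution)
    also have "exp (- ((t \<bullet> u)^2) / 2) * exp (- ((t \<bullet> w)^2) / 2) = exp (- ((t \<bullet> u)^2 + (t \<bullet> w)^2) / 2)"
      unfolding exp_add[symmetric] by (simp add: field_simps)
    finally show ?thesis .
  qed
  moreover have "prob_space N" unfolding N_def by (rule SS.prob_space_distr[OF h])
  ultimately show ?thesis unfolding centered_gaussian_def by (intro exI[of _ N]) (simp add: N_def)
qed

section \<open>The least squares objective\<close>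

text \<open>The objective after minimising over the outlier size: the two equations at times s and s+1
  leave a single residual, divided by 1 + a^2.\<close>
definition outlier_profile :: "real \<Rightarrow> real \<Rightarrow> real \<Rightarrow> real \<Rightarrow> real" where
  "outlier_profile b c a m = (c - a^2 * b - (1 + a) * m)^2 / (1 + a^2)"

section \<open>The term left by the two disturbed equations\<close>

lemma one_plus_square_pos [simp]: "0 < 1 + (a::real)^2" by (simp add: add_pos_nonneg)

lemma one_plus_square_nz [simp]: "1 + (a::real)^2 \<noteq> 0" using one_plus_square_pos[of a] by linarith

lemma outlier_profile_nonneg: "0 \<le> outlier_profile b c a m" by (simp add: outlier_profile_def)

text \<open>Completion of the square in \<open>u\<close>. With \<open>u\<close> the residual at time
  \<open>s\<close> and \<open>g - a * u\<close> the one at \<open>s + 1\<close>, the first summand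
  is the minimum over the outlier size and the second records the distance from the
  minimiser.\<close>

lemma sum_two_squares_profile:
  fixes a g u :: real
  shows "u^2 + (g - a * u)^2 = g^2 / (1 + a^2) + (1 + a^2) * (u - a * g / (1 + a^2))^2"
proof -
  have "(1 + a^2) * (u^2 + (g - a * u)^2) = g^2 + ((1 + a^2) * u - a * g)^2" by algebra
  moreover have "(1 + a^2) * (g^2 / (1 + a^2) + (1 + a^2) * (u - a * g / (1 + a^2))^2) = g^2 + ((1 + a^2) * u - a * g)^2"
  proof -
    have e: "(1 + a^2) * (u - a * g / (1 + a^2)) = (1 + a^2) * u - a * g" using one_plus_square_pos[of a] by (simp add: right_diff_distrib)
    have "(1 + a^2) * ((1 + a^2) * (u - a * g / (1 + a^2))^2) = ((1 + a^2) * (u - a * g / (1 + a^2)))^2" by (simp add: power2_eq_square)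
    then show ?thesis using one_plus_square_pos[of a] unfolding e by (simp add: distrib_left)
  qed
  ultimately show ?thesis using one_plus_square_pos[of a] by (metis mult_cancel_left order_less_irrefl)
qed

text \<open>The profile is not convex; the additional variable u linearises the quotient, so that the
  convexity defect comes only from products of increments.\<close>
lemma outlier_profile_semiconvex:
  "\<exists>C. \<forall>a m a' m'. \<bar>a\<bar> \<le> K \<longrightarrow> \<bar>m\<bar> \<le> K \<longrightarrow> \<bar>a'\<bar> \<le> K \<longrightarrow> \<bar>m'\<bar> \<le> K \<longrightarrow>
     outlier_profile b c ((a + a') / 2) ((m + m') / 2)
       \<le> (outlier_profile b c a m + outlier_profile b c a' m') / 2 + C * ((a - a')^2 + (m - m')^2)"
proof -
  \<comment> \<open>\<open>G\<close> bounds \<open>g\<close>, \<open>u\<close> and \<open>w\<close>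
    on the box, \<open>E\<close> the midpoint defect \<open>e\<close>, and \<open>H\<close> the
    factor \<open>(W + T) + e\<close> that multiplies it; \<open>C\<close> gathers what the
    elementary inequalities leave.\<close>
  define G where "G = \<bar>c\<bar> + K^2 * \<bar>b\<bar> + (1 + K) * K"
  define E where "E = (\<bar>b\<bar> * (2 * K)^2 + (2 * K) * (2 * K) + (2 * K) * (2 * G)) / 4"
  define H where "H = 2 * G + E"
  define C where "C = H * \<bar>b\<bar> / 4 + H / 4 + H^2 / 16"
  have "outlier_profile b c ((a + a') / 2) ((m + m') / 2)
       \<le> (outlier_profile b c a m + outlier_profile b c a' m') / 2 + C * ((a - a')^2 + (m - m')^2)"
    if K: "\<bar>a\<bar> \<le> K" "\<bar>m\<bar> \<le> K" "\<bar>a'\<bar> \<le> K" "\<bar>m'\<bar> \<le> K" for a m a' m'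
  proof -
    define g where "g a m = c - a^2 * b - (1 + a) * m" for a m
    \<comment> \<open>The optimal value of the free variable in
      \<open>sum_two_squares_profile\<close>. Evaluating the two squares at the average of two such
      optima bounds the profile at the midpoint from above.\<close>
    define u where "u a m = a * g a m / (1 + a^2)" for a m
    define w where "w a m = g a m - a * u a m" for a m
    have K0: "0 \<le> K" using K(1) by linarith
    have gb: "\<bar>g a m\<bar> \<le> G" if "\<bar>a\<bar> \<le> K" "\<bar>m\<bar> \<le> K" for a m
    proof -
      have "\<bar>a^2 * b\<bar> \<le> K^2 * \<bar>b\<bar>" using that K0 by (simp add: abs_mult mult_mono abs_le_square_iff[symmetric] power2_abs)
      moreover have "\<bar>(1 + a) * m\<bar> \<le> (1 + K) * K" unfolding abs_mult using that K0 by (intro mult_mono) auto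
      ultimately show ?thesis unfolding g_def G_def by linarith
    qed
    have G0: "0 \<le> G" using gb[OF K(1,2)] by linarith
    have pr: "outlier_profile b c a m = (u a m)^2 + (w a m)^2" for a m
      unfolding w_def sum_two_squares_profile by (simp add: u_def outlier_profile_def g_def)
    have w': "w a m = g a m / (1 + a^2)" for a m
      using one_plus_square_pos[of a] by (simp add: w_def u_def field_simps power2_eq_square)
    have wb: "\<bar>w a m\<bar> \<le> G" if "\<bar>a\<bar> \<le> K" "\<bar>m\<bar> \<le> K" for a m
    proof -
      have "\<bar>w a m\<bar> = \<bar>g a m\<bar> / (1 + a^2)" using one_plus_square_pos[of a] by (simp add: w' abs_divide)
      also have "\<dots> \<le> \<bar>g a m\<bar> / 1" by (intro divide_left_mono) auto
      finally show ?thesis using gb[OF that] by simp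
    qed
    have ub: "\<bar>u a m\<bar> \<le> G" if "\<bar>a\<bar> \<le> K" "\<bar>m\<bar> \<le> K" for a m
    proof -
      have "(u a m)^2 + (w a m)^2 = (g a m)^2 / (1 + a^2)" using pr[of a m] by (simp add: outlier_profile_def g_def)
      also have "\<dots> \<le> (g a m)^2 / 1" by (intro divide_left_mono) auto
      also have "\<dots> \<le> G^2" using gb[OF that] G0 by (simp add: abs_le_square_iff[symmetric])
      finally have "(u a m)^2 \<le> G^2" using zero_le_power2[of "w a m"] by linarith
      then show ?thesis using G0 by (simp add: abs_le_square_iff[symmetric])
    qed
    define U W V T where "U = u a m" and "W = w a m" and "V = u a' m'" and "T = w a' m'"
    define da dm du where "da = a - a'" and "dm = m - m'" and "du = U - V"
    \<comment> \<open>Deviation of the second square's argument at the midpoint from the average of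
      \<open>W\<close> and \<open>T\<close>. That argument is quadratic in \<open>(a, m, u)\<close>,
      so the deviation involves only products of differences.\<close>
    define e where "e = (b * da^2 + da * dm + da * du) / 4"
    have e: "g ((a + a') / 2) ((m + m') / 2) - (a + a') / 2 * ((U + V) / 2) = (W + T) / 2 + e"
    proof -
      define h k mh mk uh uk where "h = (a + a') / 2" and "k = (a - a') / 2" and "mh = (m + m') / 2" and "mk = (m - m') / 2"
        and "uh = (U + V) / 2" and "uk = (U - V) / 2"
      have sub: "a = h + k" "a' = h - k" "m = mh + mk" "m' = mh - mk" "U = uh + uk" "V = uh - uk"
        by (simp_all add: h_def k_def mh_def mk_def uh_def uk_def field_simps)
      have W1: "W = c - a^2 * b - (1 + a) * m - a * U" and T1: "T = c - a'^2 * b - (1 + a') * m' - a' * V"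
        by (simp_all add: W_def T_def w_def U_def V_def g_def)
      have ee: "e = b * k^2 + k * mk + k * uk"
        by (simp add: e_def da_def dm_def du_def k_def mk_def uk_def power2_eq_square field_simps)
      have W2: "W = c - (h + k)^2 * b - (1 + (h + k)) * (mh + mk) - (h + k) * (uh + uk)"
        using W1 unfolding sub .
      have T2: "T = c - (h - k)^2 * b - (1 + (h - k)) * (mh - mk) - (h - k) * (uh - uk)"
        using T1 unfolding sub .
      show ?thesis unfolding ee g_def h_def[symmetric] mh_def[symmetric] uh_def[symmetric] W2 T2
        by (simp add: power2_eq_square field_simps)
    qed
    have abs_diff: "\<bar>x - y\<bar> \<le> 2 * z" "\<bar>x + y\<bar> \<le> 2 * z" if "\<bar>x\<bar> \<le> z" "\<bar>y\<bar> \<le> z" for x y z :: real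
      using that by linarith+
    have abs: "\<bar>da\<bar> \<le> 2 * K" "\<bar>dm\<bar> \<le> 2 * K" "\<bar>du\<bar> \<le> 2 * G" "\<bar>W + T\<bar> \<le> 2 * G"
      unfolding da_def dm_def du_def U_def V_def W_def T_def
      by (intro abs_diff K ub wb)+
    have e1: "\<bar>e\<bar> \<le> (\<bar>b\<bar> * da^2 + \<bar>da\<bar> * \<bar>dm\<bar> + \<bar>da\<bar> * \<bar>du\<bar>) / 4"
    proof -
      have "\<bar>b * da^2 + da * dm + da * du\<bar> \<le> \<bar>b * da^2\<bar> + \<bar>da * dm\<bar> + \<bar>da * du\<bar>" by linarith
      then show ?thesis by (simp add: e_def abs_mult)
    qed
    have e2: "\<bar>e\<bar> \<le> E"
    proof -
      have "da^2 \<le> (2 * K)^2" using abs(1) K0 abs_le_square_iff[of da "2 * K"] by simp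
      then have "\<bar>b\<bar> * da^2 \<le> \<bar>b\<bar> * (2 * K)^2" by (intro mult_left_mono) auto
      moreover have "\<bar>da\<bar> * \<bar>dm\<bar> \<le> (2 * K) * (2 * K)" using abs K0 by (intro mult_mono) auto
      moreover have "\<bar>da\<bar> * \<bar>du\<bar> \<le> (2 * K) * (2 * G)" using abs K0 by (intro mult_mono) auto
      ultimately show ?thesis unfolding E_def by (intro order_trans[OF e1] divide_right_mono add_mono) auto
    qed
    have H0: "0 \<le> H" using G0 e2 unfolding H_def by linarith
    have "outlier_profile b c ((a + a') / 2) ((m + m') / 2) \<le> ((U + V) / 2)^2 + (g ((a + a') / 2) ((m + m') / 2) - (a + a') / 2 * ((U + V) / 2))^2"
      unfolding sum_two_squares_profile outlier_profile_def g_def by (simp add: one_plus_square_pos less_imp_le)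
    also have "\<dots> = ((U + V) / 2)^2 + ((W + T) / 2 + e)^2" unfolding e ..
    also have "\<dots> = (U^2 + W^2 + (V^2 + T^2)) / 2 - du^2 / 4 - (W - T)^2 / 4 + ((W + T) + e) * e"
      unfolding du_def by (simp add: field_simps power2_eq_square)
    also have "\<dots> \<le> (U^2 + W^2 + (V^2 + T^2)) / 2 - du^2 / 4 + H * \<bar>e\<bar>"
    proof -
      have "((W + T) + e) * e \<le> \<bar>(W + T) + e\<bar> * \<bar>e\<bar>" by (metis abs_ge_self abs_mult)
      also have "\<dots> \<le> H * \<bar>e\<bar>" using abs(4) e2 unfolding H_def by (intro mult_right_mono) linarith+
      finally show ?thesis using zero_le_power2[of "W - T"] by linarith
    qed
    also have "H * \<bar>e\<bar> \<le> H * ((\<bar>b\<bar> * da^2 + \<bar>da\<bar> * \<bar>dm\<bar> + \<bar>da\<bar> * \<bar>du\<bar>) / 4)" using e1 H0 by (intro mult_left_mono)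
    also have "\<dots> \<le> C * (da^2 + dm^2) + du^2 / 4"
    proof -
      \<comment> \<open>The mixed product of \<open>da\<close> and \<open>du\<close> is absorbed by
        the term \<open>du^2 / 4\<close> that the convexity of the square of \<open>u\<close> has
        released.\<close>
      have 1: "H * \<bar>da\<bar> * \<bar>du\<bar> / 4 \<le> du^2 / 4 + H^2 / 16 * da^2"
      proof -
        have "0 \<le> (\<bar>du\<bar> / 2 - H * \<bar>da\<bar> / 4)^2" by simp
        then show ?thesis by (simp add: power2_eq_square field_simps)
      qed
      have "0 \<le> (\<bar>da\<bar> - \<bar>dm\<bar>)^2" by simp
      then have "2 * (\<bar>da\<bar> * \<bar>dm\<bar>) \<le> da^2 + dm^2" by (simp add: power2_eq_square field_simps)
      then have "\<bar>da\<bar> * \<bar>dm\<bar> \<le> da^2 + dm^2" using zero_le_power2[of da] zero_le_power2[of dm] by linarith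
      then have 2: "H / 4 * (\<bar>da\<bar> * \<bar>dm\<bar>) \<le> H / 4 * (da^2 + dm^2)" using H0 by (intro mult_left_mono) auto
      have 3: "0 \<le> H * \<bar>b\<bar> / 4 * dm^2" "0 \<le> H^2 / 16 * dm^2" using H0 by auto
      have "H * ((\<bar>b\<bar> * da^2 + \<bar>da\<bar> * \<bar>dm\<bar> + \<bar>da\<bar> * \<bar>du\<bar>) / 4) = H * \<bar>b\<bar> / 4 * da^2 + H / 4 * (\<bar>da\<bar> * \<bar>dm\<bar>) + H * \<bar>da\<bar> * \<bar>du\<bar> / 4"
        by (simp add: field_simps)
      moreover have "C * (da^2 + dm^2) = H * \<bar>b\<bar> / 4 * da^2 + H * \<bar>b\<bar> / 4 * dm^2 + H / 4 * (da^2 + dm^2) + H^2 / 16 * da^2 + H^2 / 16 * dm^2"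
        unfolding C_def by (simp add: field_simps)
      ultimately show ?thesis using 1 2 3 by linarith
    qed
    finally show ?thesis unfolding pr U_def V_def W_def T_def da_def dm_def by linarith
  qed
  then show ?thesis by blast
qed

lemma outlier_profile_continuous: "continuous_on UNIV (\<lambda>z. outlier_profile b c (fst z) (snd z))"
  unfolding outlier_profile_def using one_plus_square_pos
  by (intro continuous_intros) (metis order_less_irrefl)

text \<open>For the matrix with rows \<open>(S2, S1)\<close> and \<open>(S1, 1)\<close>,
  Cayley-Hamilton says that trace times the matrix minus determinant times the identity is the
  square of the matrix, hence positive semidefinite. With positive trace the smallest eigenvalue is
  at least determinant over trace.\<close>

lemma quad_form_lower:
  fixes S2 S1 x z :: real
  shows "(S2 - S1^2) * (x^2 + z^2) \<le> (S2 + 1) * (S2 * x^2 + 2 * S1 * x * z + z^2)"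
proof -
  have "(S2 + 1) * (S2 * x^2 + 2 * S1 * x * z + z^2) - (S2 - S1^2) * (x^2 + z^2) = (S2 * x + S1 * z)^2 + (S1 * x + z)^2" by algebra
  then show ?thesis using zero_le_power2[of "S2 * x + S1 * z"] zero_le_power2[of "S1 * x + z"] by linarith
qed

text \<open>The profile objective in the local variables a = alpha + x / sqrt n, m = mu + z / sqrt n,
  up to a constant.\<close>
definition local_obj :: "real \<Rightarrow> real \<Rightarrow> real \<Rightarrow> real \<Rightarrow> nat \<Rightarrow> real \<times> real \<times> real \<Rightarrow> real \<times> real \<Rightarrow> real \<times> real \<Rightarrow> real" where
  "local_obj \<alpha> \<mu> b c n A \<sigma> w = (case A of (a2, a1, a0) \<Rightarrow> a2 * fst w ^ 2 + 2 * a1 * fst w * snd w + a0 * snd w ^ 2)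
     - 2 * (fst w * fst \<sigma> + snd w * snd \<sigma>) + outlier_profile b c (\<alpha> + fst w / sqrt (real n)) (\<mu> + snd w / sqrt (real n))"

text \<open>One curvature constant \<open>l\<close> is used three times: coercivity confines
  minimisers to a ball independent of \<open>n\<close>, strong convexity converts a small objective
  gap into a small distance, and the midpoint comparison beats the defect
  \<open>C / n\<close>.\<close>

lemma local_obj_minimizer:
  fixes \<alpha> \<mu> b c S2 S1 K \<epsilon> :: real
  assumes D: "0 < S2 - S1^2" and \<epsilon>: "0 < \<epsilon>" and K: "0 \<le> K"
  shows "\<exists>\<eta>>0. \<exists>n0. \<forall>n\<ge>n0. \<forall>a2 a1 a0 \<sigma>1 \<sigma>0. \<bar>a2 - S2\<bar> \<le> \<eta> \<longrightarrow> \<bar>a1 - S1\<bar> \<le> \<eta> \<longrightarrow> \<bar>a0 - 1\<bar> \<le> \<eta> \<longrightarrow> \<bar>\<sigma>1\<bar> \<le> K \<longrightarrow> \<bar>\<sigma>0\<bar> \<le> K \<longrightarrow>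
    (\<exists>w. (\<forall>v. local_obj \<alpha> \<mu> b c n (a2, a1, a0) (\<sigma>1, \<sigma>0) w \<le> local_obj \<alpha> \<mu> b c n (a2, a1, a0) (\<sigma>1, \<sigma>0) v) \<and>
      (\<forall>w'. (\<forall>v. local_obj \<alpha> \<mu> b c n (a2, a1, a0) (\<sigma>1, \<sigma>0) w' \<le> local_obj \<alpha> \<mu> b c n (a2, a1, a0) (\<sigma>1, \<sigma>0) v) \<longrightarrow> w' = w) \<and>
      \<bar>fst w - (\<sigma>1 - S1 * \<sigma>0) / (S2 - S1^2)\<bar> \<le> \<epsilon> \<and> \<bar>snd w - (S2 * \<sigma>0 - S1 * \<sigma>1) / (S2 - S1^2)\<bar> \<le> \<epsilon>)"
proof -
  define \<Delta> where "\<Delta> = S2 - S1^2"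
  have S2: "0 < S2" using D zero_le_power2[of S1] by linarith
  \<comment> \<open>Half of the eigenvalue bound: a perturbation of the coefficients by at most
    \<open>l / 2\<close> still leaves curvature \<open>l\<close>.\<close>
  define l where "l = \<Delta> / (S2 + 1) / 2"
  have l: "0 < l" using D S2 by (simp add: l_def \<Delta>_def)
  define qS where "qS x z = S2 * x^2 + 2 * S1 * x * z + z^2" for x z
  have qS: "2 * l * (x^2 + z^2) \<le> qS x z" for x z
    using quad_form_lower[of S2 S1 x z] S2 by (simp add: l_def \<Delta>_def qS_def field_simps)
  define M0 where "M0 = outlier_profile b c \<alpha> \<mu>"
  have M0: "0 \<le> M0" unfolding M0_def by (rule outlier_profile_nonneg)
  \<comment> \<open>Comparison with the value \<open>M0\<close> at the origin, and Young's
    inequality for the linear term, bound the squared radius of any point that is at least as good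
    by this number.\<close>
  define R where "R = (2 / l) * (M0 + 4 * K^2 / l)"
  have R0: "0 \<le> R" unfolding R_def using M0 l by simp
  obtain C where C: "\<And>a m a' m'. \<bar>a\<bar> \<le> \<bar>\<alpha>\<bar> + \<bar>\<mu>\<bar> + (1 + R) \<Longrightarrow> \<bar>m\<bar> \<le> \<bar>\<alpha>\<bar> + \<bar>\<mu>\<bar> + (1 + R) \<Longrightarrow> \<bar>a'\<bar> \<le> \<bar>\<alpha>\<bar> + \<bar>\<mu>\<bar> + (1 + R) \<Longrightarrow> \<bar>m'\<bar> \<le> \<bar>\<alpha>\<bar> + \<bar>\<mu>\<bar> + (1 + R) \<Longrightarrow>
     outlier_profile b c ((a + a') / 2) ((m + m') / 2)
       \<le> (outlier_profile b c a m + outlier_profile b c a' m') / 2 + C * ((a - a')^2 + (m - m')^2)"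
    using outlier_profile_semiconvex[of "\<bar>\<alpha>\<bar> + \<bar>\<mu>\<bar> + (1 + R)" b c] by blast
  \<comment> \<open>Error budget: the coefficient perturbations cost at most
    \<open>4 * \<eta> * R \<le> \<zeta>\<close> and the variation of the profile costs
    \<open>\<zeta>\<close>, together at most \<open>2 * l * \<epsilon>^2\<close>.\<close>
  define \<zeta> where "\<zeta> = l * \<epsilon>^2 / 2"
  have \<zeta>: "0 < \<zeta>" using l \<epsilon> by (simp add: \<zeta>_def)
  define \<eta> where "\<eta> = min (l / 2) (\<zeta> / (4 * (R + 1)))"
  have \<eta>: "0 < \<eta>" "\<eta> \<le> l / 2" using l \<zeta> R0 by (simp add: \<eta>_def, simp only: \<eta>_def min.cobounded1)
  have \<eta>R: "4 * \<eta> * R \<le> \<zeta>"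
  proof -
    have "\<eta> * (4 * (R + 1)) \<le> \<zeta> / (4 * (R + 1)) * (4 * (R + 1))" using R0 by (intro mult_right_mono) (auto simp: \<eta>_def)
    also have "\<dots> = \<zeta>" using R0 by simp
    finally show ?thesis using \<eta>(1) by (simp add: algebra_simps)
  qed
  define p where "p n x z = outlier_profile b c (\<alpha> + x / sqrt (real n)) (\<mu> + z / sqrt (real n))" for n and x z :: real
  have "continuous (at (\<alpha>, \<mu>)) (\<lambda>z. outlier_profile b c (fst z) (snd z))"
    using outlier_profile_continuous continuous_on_eq_continuous_at open_UNIV by blast
  then have "\<exists>d>0. \<forall>z. dist z (\<alpha>, \<mu>) < d \<longrightarrow> dist (outlier_profile b c (fst z) (snd z)) (outlier_profile b c (fst (\<alpha>, \<mu>)) (snd (\<alpha>, \<mu>))) < \<zeta> / 2"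
    unfolding continuous_at_eps_delta using half_gt_zero[OF \<zeta>] by blast
  then obtain d where d: "0 < d" "\<And>z. dist z (\<alpha>, \<mu>) < d \<Longrightarrow> \<bar>outlier_profile b c (fst z) (snd z) - M0\<bar> < \<zeta> / 2"
    unfolding M0_def dist_real_def fst_conv snd_conv by blast
  \<comment> \<open>Three demands: local points lie within \<open>d\<close> of
    \<open>(\<alpha>, \<mu>)\<close>, \<open>n\<close> is at least 1, and \<open>C / n\<close> is at
    most \<open>l / 8\<close>.\<close>
  define n0 where "n0 = nat \<lceil>max (R / d^2 + 1) (max 1 (8 * \<bar>C\<bar> / l + 1))\<rceil>"
  have pclose: "\<bar>p n x z - M0\<bar> \<le> \<zeta> / 2" if n: "n0 \<le> n" and xz: "x^2 + z^2 \<le> R" for n x z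
  proof -
    have nn: "R / d^2 + 1 \<le> real n" "1 \<le> real n" using n unfolding n0_def by linarith+
    have "dist (\<alpha> + x / sqrt (real n), \<mu> + z / sqrt (real n)) (\<alpha>, \<mu>) = sqrt ((x^2 + z^2) / real n)"
      using nn by (simp add: dist_prod_def dist_real_def power_divide add_divide_distrib)
    also have "\<dots> < d"
    proof -
      have "R < d^2 * real n" using nn d(1) by (simp add: field_simps) (smt (verit) zero_less_power)
      then have "(x^2 + z^2) / real n < d^2" using xz nn by (simp add: field_simps)
      then show ?thesis using d(1) by (simp add: real_less_lsqrt)
    qed
    finally show ?thesis using d(2) by (fastforce simp: p_def)
  qed
  have main: "\<exists>w. (\<forall>v. local_obj \<alpha> \<mu> b c n (a2, a1, a0) (\<sigma>1, \<sigma>0) w \<le> local_obj \<alpha> \<mu> b c n (a2, a1, a0) (\<sigma>1, \<sigma>0) v) \<and>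
      (\<forall>w'. (\<forall>v. local_obj \<alpha> \<mu> b c n (a2, a1, a0) (\<sigma>1, \<sigma>0) w' \<le> local_obj \<alpha> \<mu> b c n (a2, a1, a0) (\<sigma>1, \<sigma>0) v) \<longrightarrow> w' = w) \<and>
      \<bar>fst w - (\<sigma>1 - S1 * \<sigma>0) / (S2 - S1^2)\<bar> \<le> \<epsilon> \<and> \<bar>snd w - (S2 * \<sigma>0 - S1 * \<sigma>1) / (S2 - S1^2)\<bar> \<le> \<epsilon>"
    if n: "n0 \<le> n" and a: "\<bar>a2 - S2\<bar> \<le> \<eta>" "\<bar>a1 - S1\<bar> \<le> \<eta>" "\<bar>a0 - 1\<bar> \<le> \<eta>" and \<sigma>: "\<bar>\<sigma>1\<bar> \<le> K" "\<bar>\<sigma>0\<bar> \<le> K" for n a2 a1 a0 \<sigma>1 \<sigma>0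
  proof -
    define q where "q x z = a2 * x^2 + 2 * a1 * x * z + a0 * z^2" for x z
    define obj where "obj w = q (fst w) (snd w) - 2 * (fst w * \<sigma>1 + snd w * \<sigma>0) + p n (fst w) (snd w)" for w
    have obj: "local_obj \<alpha> \<mu> b c n (a2, a1, a0) (\<sigma>1, \<sigma>0) = obj"
      by (simp add: local_obj_def obj_def q_def p_def fun_eq_iff)
    have nn: "1 \<le> real n" "8 * \<bar>C\<bar> / l + 1 \<le> real n" using n unfolding n0_def by linarith+
    have qdiff: "\<bar>q x z - qS x z\<bar> \<le> 2 * \<eta> * (x^2 + z^2)" for x z
    proof -
      have "q x z - qS x z = (a2 - S2) * x^2 + 2 * ((a1 - S1) * (x * z)) + (a0 - 1) * z^2" by (simp add: q_def qS_def algebra_simps)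
      also have "\<bar>\<dots>\<bar> \<le> \<bar>(a2 - S2) * x^2\<bar> + 2 * \<bar>(a1 - S1) * (x * z)\<bar> + \<bar>(a0 - 1) * z^2\<bar>" by linarith
      also have "\<dots> \<le> \<eta> * x^2 + 2 * (\<eta> * \<bar>x * z\<bar>) + \<eta> * z^2"
        unfolding abs_mult using a by (intro add_mono mult_mono mult_left_mono) auto
      also have "2 * (\<eta> * \<bar>x * z\<bar>) \<le> \<eta> * (x^2 + z^2)"
      proof -
        have "0 \<le> (\<bar>x\<bar> - \<bar>z\<bar>)^2" by simp
        then have "2 * \<bar>x * z\<bar> \<le> x^2 + z^2" by (simp add: power2_eq_square abs_mult algebra_simps)
        then show ?thesis using mult_left_mono[of "2 * \<bar>x * z\<bar>" "x^2 + z^2" \<eta>] \<eta>(1) by simp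
      qed
      finally show ?thesis by (simp add: algebra_simps)
    qed
    have ql: "l * (x^2 + z^2) \<le> q x z" for x z
    proof -
      have "2 * \<eta> * (x^2 + z^2) \<le> l * (x^2 + z^2)" using \<eta> by (intro mult_right_mono) auto
      then show ?thesis using qdiff[of x z] qS[of x z] by linarith
    qed
    have p0: "0 \<le> p n x z" for x z unfolding p_def by (rule outlier_profile_nonneg)
    have obj0: "obj 0 = M0" by (simp add: obj_def q_def p_def M0_def)
    have young: "2 * (x * t) \<le> l / 2 * x^2 + 2 * K^2 / l" if "\<bar>t\<bar> \<le> K" for x t
    proof -
      have "2 * (x * t) \<le> l / 2 * x^2 + 2 * t^2 / l"
      proof -
        have "0 \<le> (l * x - 2 * t)^2 / (2 * l)" using l by simp
        also have "\<dots> = l / 2 * x^2 + 2 * t^2 / l - 2 * (x * t)" using l by (simp add: power2_eq_square field_simps)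
        finally show ?thesis by simp
      qed
      also have "2 * t^2 / l \<le> 2 * K^2 / l" using that l K by (intro divide_right_mono) (auto simp: abs_le_square_iff[symmetric])
      finally show ?thesis by simp
    qed
    have inball: "fst w ^ 2 + snd w ^ 2 \<le> R" if "obj w \<le> M0" for w
    proof -
      have "l * (fst w ^ 2 + snd w ^ 2) \<le> M0 + 2 * (fst w * \<sigma>1) + 2 * (snd w * \<sigma>0)"
        using that ql[of "fst w" "snd w"] p0[of "fst w" "snd w"] by (simp add: obj_def)
      also have "\<dots> \<le> M0 + (l / 2 * fst w ^ 2 + 2 * K^2 / l) + (l / 2 * snd w ^ 2 + 2 * K^2 / l)"
        using young[OF \<sigma>(1), of "fst w"] young[OF \<sigma>(2), of "snd w"] by linarith
      finally have "l / 2 * (fst w ^ 2 + snd w ^ 2) \<le> M0 + 4 * K^2 / l" by (simp add: algebra_simps)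
      then show ?thesis using l by (simp add: R_def field_simps)
    qed
    have cont: "continuous_on UNIV obj"
    proof -
      have "continuous_on UNIV (\<lambda>w. p n (fst w) (snd w))" unfolding p_def
        by (rule continuous_on_compose2[OF outlier_profile_continuous[of b c], where f="\<lambda>w. (\<alpha> + fst w / sqrt (real n), \<mu> + snd w / sqrt (real n))", simplified])
          (use nn in \<open>auto intro!: continuous_intros\<close>)
      then show ?thesis unfolding obj_def q_def by (intro continuous_intros)
    qed
    have norm2: "norm w ^ 2 = fst w ^ 2 + snd w ^ 2" for w :: "real \<times> real" by (simp add: norm_prod_def)
    have "\<exists>w\<in>cball 0 (sqrt R). \<forall>v\<in>cball 0 (sqrt R). obj w \<le> obj v"
      by (rule continuous_attains_inf) (use R0 cont in \<open>auto intro: continuous_on_subset\<close>)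
    then obtain w where w: "\<And>v. v \<in> cball 0 (sqrt R) \<Longrightarrow> obj w \<le> obj v" by blast
    have wmin: "obj w \<le> obj v" for v
    proof (cases "fst v ^ 2 + snd v ^ 2 \<le> R")
      case True
      then have "norm v \<le> sqrt R" unfolding norm2[symmetric] using real_le_rsqrt by blast
      then show ?thesis using w[of v] by simp
    next
      case False
      then have "M0 < obj v" using inball[of v] by linarith
      moreover have "obj w \<le> obj 0" using R0 by (intro w) simp
      ultimately show ?thesis using obj0 by linarith
    qed
    define x0 where "x0 = (\<sigma>1 - S1 * \<sigma>0) / \<Delta>"
    define z0 where "z0 = (S2 * \<sigma>0 - S1 * \<sigma>1) / \<Delta>"
    have D0: "\<Delta> \<noteq> 0" using D by (simp add: \<Delta>_def)
    have normal: "S2 * x0 + S1 * z0 = \<sigma>1" "S1 * x0 + z0 = \<sigma>0"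
    proof -
      have x0: "\<Delta> * x0 = \<sigma>1 - S1 * \<sigma>0" and z0: "\<Delta> * z0 = S2 * \<sigma>0 - S1 * \<sigma>1" using D0 by (simp_all add: x0_def z0_def)
      have "\<Delta> * (S2 * x0 + S1 * z0) = S2 * (\<Delta> * x0) + S1 * (\<Delta> * z0)" by (simp add: algebra_simps)
      also have "\<dots> = \<Delta> * \<sigma>1" unfolding x0 z0 by (simp add: \<Delta>_def algebra_simps power2_eq_square)
      finally show "S2 * x0 + S1 * z0 = \<sigma>1" using D0 by simp
      have "\<Delta> * (S1 * x0 + z0) = S1 * (\<Delta> * x0) + \<Delta> * z0" by (simp add: algebra_simps)
      also have "\<dots> = \<Delta> * \<sigma>0" unfolding x0 z0 by (simp add: \<Delta>_def algebra_simps power2_eq_square)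
      finally show "S1 * x0 + z0 = \<sigma>0" using D0 by simp
    qed
    have x0R: "x0^2 + z0^2 \<le> R"
    proof -
      have "2 * l * (x0^2 + z0^2) \<le> x0 * \<sigma>1 + z0 * \<sigma>0"
        using qS[of x0 z0] unfolding normal[symmetric] qS_def by (simp add: algebra_simps power2_eq_square)
      also have "\<dots> \<le> (l / 2 * x0^2 + 2 * K^2 / l + (l / 2 * z0^2 + 2 * K^2 / l)) / 2"
      proof -
        have "s + t \<le> (A + B) / 2" if "2 * s \<le> A" "2 * t \<le> B" for s t A B :: real using that by simp
        from this[OF young[OF \<sigma>(1), of x0] young[OF \<sigma>(2), of z0]] show ?thesis .
      qed
      also have "\<dots> = (l * (x0^2 + z0^2)) / 4 + 2 * K^2 / l" by (simp add: add_divide_distrib distrib_left)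
      finally have "2 * (l * (x0^2 + z0^2)) \<le> (l * (x0^2 + z0^2)) / 4 + 2 * K^2 / l" by simp
      moreover have "0 \<le> l * (x0^2 + z0^2)" using l by simp
      moreover have "2 * K^2 / l \<le> M0 + 4 * K^2 / l" using M0 l by (simp add: field_simps)
      ultimately have "(l * (x0^2 + z0^2)) / 2 \<le> M0 + 4 * K^2 / l" by linarith
      then show ?thesis using l by (simp add: R_def field_simps)
    qed
    have close: "(fst w - x0)^2 + (snd w - z0)^2 \<le> \<epsilon>^2"
    proof -
      have wR: "fst w ^ 2 + snd w ^ 2 \<le> R" using inball[of w] wmin[of 0] obj0 by simp
      \<comment> \<open>The exact quadratic objective is centred at the solution of the normal
        equations, so its excess at \<open>w\<close> is \<open>qS\<close> of the difference. The
        inequality \<open>obj w \<le> obj (x0, z0)\<close> bounds that excess by perturbation errors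
        alone.\<close>
      have "qS (fst w - x0) (snd w - z0) = (qS (fst w) (snd w) - 2 * (fst w * \<sigma>1 + snd w * \<sigma>0)) - (qS x0 z0 - 2 * (x0 * \<sigma>1 + z0 * \<sigma>0))"
        unfolding qS_def normal[symmetric] by (simp add: algebra_simps power2_eq_square)
      moreover have "obj w \<le> obj (x0, z0)" by (rule wmin)
      ultimately have "qS (fst w - x0) (snd w - z0) \<le> \<bar>q (fst w) (snd w) - qS (fst w) (snd w)\<bar> + \<bar>q x0 z0 - qS x0 z0\<bar>
        + \<bar>p n (fst w) (snd w) - M0\<bar> + \<bar>p n x0 z0 - M0\<bar>" by (simp add: obj_def)
      also have "\<dots> \<le> 2 * \<eta> * (fst w ^ 2 + snd w ^ 2) + 2 * \<eta> * (x0^2 + z0^2) + \<zeta> / 2 + \<zeta> / 2"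
        by (intro add_mono qdiff pclose n wR x0R)
      also have "\<dots> \<le> 2 * \<eta> * R + 2 * \<eta> * R + \<zeta> / 2 + \<zeta> / 2"
        using wR x0R \<eta> by (intro add_mono mult_left_mono) auto
      also have "\<dots> = 4 * \<eta> * R + \<zeta>" by simp
      also have "\<dots> \<le> 2 * l * \<epsilon>^2" using \<eta>R \<zeta> by (simp add: \<zeta>_def)
      finally have "2 * l * ((fst w - x0)^2 + (snd w - z0)^2) \<le> 2 * l * \<epsilon>^2" using qS[of "fst w - x0" "snd w - z0"] by linarith
      then show ?thesis using l by simp
    qed
    \<comment> \<open>Two global minimisers are compared with their midpoint: the quadratic part
      gains \<open>l / 4\<close> per unit of squared distance and the profile gives back at most
      \<open>l / 8\<close>.\<close>
    have uniq: "w' = w" if w': "\<And>v. obj w' \<le> obj v" for w'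
    proof -
      define dx dz where "dx = fst w - fst w'" and "dz = snd w - snd w'"
      define mid where "mid = ((fst w + fst w') / 2, (snd w + snd w') / 2)"
      have wR: "fst w ^ 2 + snd w ^ 2 \<le> R" "fst w' ^ 2 + snd w' ^ 2 \<le> R"
        using inball[of w] wmin[of 0] inball[of w'] w'[of 0] obj0 by auto
      have bnd: "\<bar>\<alpha> + x / sqrt (real n)\<bar> \<le> \<bar>\<alpha>\<bar> + \<bar>\<mu>\<bar> + (1 + R)" "\<bar>\<mu> + x / sqrt (real n)\<bar> \<le> \<bar>\<alpha>\<bar> + \<bar>\<mu>\<bar> + (1 + R)" if "x^2 \<le> R" for x
      proof -
        have "0 \<le> (\<bar>x\<bar> - 1)^2" by simp
        then have "2 * \<bar>x\<bar> \<le> 1 + x^2" by (simp add: power2_eq_square algebra_simps)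
        then have "\<bar>x\<bar> \<le> 1 + R" using that by linarith
        moreover have "\<bar>x / sqrt (real n)\<bar> \<le> \<bar>x\<bar> / 1" unfolding abs_divide using nn by (intro divide_left_mono) auto
        ultimately show "\<bar>\<alpha> + x / sqrt (real n)\<bar> \<le> \<bar>\<alpha>\<bar> + \<bar>\<mu>\<bar> + (1 + R)" "\<bar>\<mu> + x / sqrt (real n)\<bar> \<le> \<bar>\<alpha>\<bar> + \<bar>\<mu>\<bar> + (1 + R)" by linarith+
      qed
      have sq: "fst w ^ 2 \<le> R" "snd w ^ 2 \<le> R" "fst w' ^ 2 \<le> R" "snd w' ^ 2 \<le> R"
        using wR zero_le_power2[of "fst w"] zero_le_power2[of "snd w"] zero_le_power2[of "fst w'"] zero_le_power2[of "snd w'"] by linarith+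
      have "p n (fst mid) (snd mid) \<le> (p n (fst w) (snd w) + p n (fst w') (snd w')) / 2 + C * ((dx / sqrt (real n))^2 + (dz / sqrt (real n))^2)"
      proof -
        have m: "\<alpha> + fst mid / sqrt (real n) = ((\<alpha> + fst w / sqrt (real n)) + (\<alpha> + fst w' / sqrt (real n))) / 2"
          "\<mu> + snd mid / sqrt (real n) = ((\<mu> + snd w / sqrt (real n)) + (\<mu> + snd w' / sqrt (real n))) / 2"
          by (simp_all add: mid_def add_divide_distrib)
        have dd: "dx / sqrt (real n) = (\<alpha> + fst w / sqrt (real n)) - (\<alpha> + fst w' / sqrt (real n))"
          "dz / sqrt (real n) = (\<mu> + snd w / sqrt (real n)) - (\<mu> + snd w' / sqrt (real n))"
          by (simp_all add: dx_def dz_def diff_divide_distrib)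
        show ?thesis unfolding p_def m dd by (rule C[OF bnd(1)[OF sq(1)] bnd(2)[OF sq(2)] bnd(1)[OF sq(3)] bnd(2)[OF sq(4)]])
      qed
      also have "C * ((dx / sqrt (real n))^2 + (dz / sqrt (real n))^2) \<le> l / 8 * (dx^2 + dz^2)"
      proof -
        have "C * ((dx / sqrt (real n))^2 + (dz / sqrt (real n))^2) = (C / real n) * (dx^2 + dz^2)"
          using nn by (simp add: power_divide field_simps)
        also have "\<dots> \<le> l / 8 * (dx^2 + dz^2)"
        proof (intro mult_right_mono)
          have "8 * \<bar>C\<bar> \<le> real n * l" using nn(2) l by (simp add: field_simps)
          then show "C / real n \<le> l / 8" using nn(1) by (simp add: field_simps)
        qed simp
        finally show ?thesis .
      qed
      finally have pm: "p n (fst mid) (snd mid) \<le> (p n (fst w) (snd w) + p n (fst w') (snd w')) / 2 + l / 8 * (dx^2 + dz^2)" by simp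
      have "q (fst mid) (snd mid) = (q (fst w) (snd w) + q (fst w') (snd w')) / 2 - q dx dz / 4"
        unfolding q_def mid_def dx_def dz_def by (simp add: field_simps power2_eq_square)
      then have qm: "q (fst mid) (snd mid) \<le> (q (fst w) (snd w) + q (fst w') (snd w')) / 2 - l / 4 * (dx^2 + dz^2)"
        using ql[of dx dz] by simp
      have lin: "fst mid * \<sigma>1 + snd mid * \<sigma>0 = ((fst w * \<sigma>1 + snd w * \<sigma>0) + (fst w' * \<sigma>1 + snd w' * \<sigma>0)) / 2"
        by (simp add: mid_def field_simps)
      have "obj mid \<le> (obj w + obj w') / 2 - l / 8 * (dx^2 + dz^2)"
        using pm qm lin unfolding obj_def by (simp add: field_simps)
      moreover have "obj w \<le> obj mid" "obj w' \<le> obj mid" by (rule wmin, rule w')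
      moreover have "r \<le> 0" if "h \<le> (s + t) / 2 - r" "s \<le> h" "t \<le> h" for h s t r :: real using that by argo
      ultimately have "l / 8 * (dx^2 + dz^2) \<le> 0" by blast
      then have "dx^2 + dz^2 \<le> 0" using l by (simp add: mult_le_0_iff)
      then have "dx = 0" "dz = 0" using sum_power2_le_zero_iff[of dx dz] by auto
      then show ?thesis by (simp add: dx_def dz_def prod_eq_iff)
    qed
    have "(fst w - x0)^2 \<le> \<epsilon>^2" "(snd w - z0)^2 \<le> \<epsilon>^2"
      using close zero_le_power2[of "fst w - x0"] zero_le_power2[of "snd w - z0"] by linarith+
    then have "\<bar>fst w - x0\<bar> \<le> \<epsilon>" "\<bar>snd w - z0\<bar> \<le> \<epsilon>" using \<epsilon> by (simp_all add: abs_le_square_iff[symmetric])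
    then show ?thesis unfolding obj using wmin uniq by (intro exI[of _ w]) (auto simp: x0_def z0_def \<Delta>_def)
  qed
  show ?thesis
  proof (intro exI conjI)
    show "0 < \<eta>" by (rule \<eta>)
  qed (use main in blast)
qed

text \<open>An exact identity: the regular residuals expand into the local quadratic form, while the
  two disturbed equations contribute the profile and a square in \<open>t\<close> with positive
  weight. Minimisation over \<open>t\<close> becomes explicit.\<close>

lemma cls_Q_profile:
  fixes \<alpha> \<mu> :: real and y :: "nat \<Rightarrow> real"
  assumes n: "0 < n" and s: "1 \<le> s"
  defines "G \<equiv> {1..n} - {s, s + 1}"
  defines "r \<equiv> (\<lambda>k. y k - \<alpha> * y (k - 1) - \<mu>)"
  shows "cls_Q n s y (\<alpha> + x / sqrt (real n), \<mu> + z / sqrt (real n), t) = (\<Sum>k\<in>G. (r k)^2)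
    + local_obj \<alpha> \<mu> (y (s - 1)) (y (s + 1)) n ((\<Sum>k\<in>G. y (k - 1) ^ 2) / real n, (\<Sum>k\<in>G. y (k - 1)) / real n, real (card G) / real n)
       ((\<Sum>k\<in>G. y (k - 1) * r k) / sqrt (real n), (\<Sum>k\<in>G. r k) / sqrt (real n)) (x, z)
    + (1 + (\<alpha> + x / sqrt (real n))^2) * (t - (y s - ((\<alpha> + x / sqrt (real n)) * (y (s - 1) + y (s + 1)) + (1 - (\<alpha> + x / sqrt (real n))) * (\<mu> + z / sqrt (real n)))
         / (1 + (\<alpha> + x / sqrt (real n))^2)))^2"
proof -
  define a m where "a = \<alpha> + x / sqrt (real n)" and "m = \<mu> + z / sqrt (real n)"
  define xx zz where "xx = x / sqrt (real n)" and "zz = z / sqrt (real n)"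
  have "(\<Sum>k\<in>G. (y k - a * y (k - 1) - m)^2)
     = (\<Sum>k\<in>G. (r k)^2 - 2 * (xx * (y (k - 1) * r k) + zz * r k) + (xx^2 * y (k - 1) ^ 2 + 2 * xx * zz * y (k - 1) + zz^2))"
    by (intro sum.cong) (auto simp: r_def a_def m_def xx_def zz_def algebra_simps power2_eq_square)
  also have "\<dots> = (\<Sum>k\<in>G. (r k)^2) - 2 * (xx * (\<Sum>k\<in>G. y (k - 1) * r k) + zz * (\<Sum>k\<in>G. r k))
     + (xx^2 * (\<Sum>k\<in>G. y (k - 1) ^ 2) + 2 * xx * zz * (\<Sum>k\<in>G. y (k - 1)) + zz^2 * real (card G))"
    by (simp add: sum.distrib sum_subtractf sum_distrib_left mult.commute)
  also have "\<dots> = (\<Sum>k\<in>G. (r k)^2) - 2 * (x * ((\<Sum>k\<in>G. y (k - 1) * r k) / sqrt (real n)) + z * ((\<Sum>k\<in>G. r k) / sqrt (real n)))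
     + ((\<Sum>k\<in>G. y (k - 1) ^ 2) / real n * x^2 + 2 * ((\<Sum>k\<in>G. y (k - 1)) / real n) * x * z + real (card G) / real n * z^2)"
    using n by (simp add: xx_def zz_def power_divide mult_ac)
  finally have 1: "(\<Sum>k\<in>G. (y k - a * y (k - 1) - m)^2) = \<dots>" .
  define g where "g = y (s + 1) - a^2 * y (s - 1) - (1 + a) * m"
  \<comment> \<open>The residual at \<open>s + 1\<close> depends on \<open>t\<close> only through
    the residual at \<open>s\<close>; this linear relation is what
    \<open>sum_two_squares_profile\<close> requires.\<close>
  have e: "y (s + 1) - a * y s - m + a * t = g - a * (y s - a * y (s - 1) - m - t)"
    by (simp add: g_def algebra_simps power2_eq_square)
  have 2: "(y s - a * y (s - 1) - m - t)^2 + (y (s + 1) - a * y s - m + a * t)^2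
    = outlier_profile (y (s - 1)) (y (s + 1)) a m + (1 + a^2) * (y s - a * y (s - 1) - m - t - a * g / (1 + a^2))^2"
    unfolding e sum_two_squares_profile by (simp add: outlier_profile_def g_def)
  have 3: "y s - a * y (s - 1) - m - t - a * g / (1 + a^2) = - (t - (y s - (a * (y (s - 1) + y (s + 1)) + (1 - a) * m) / (1 + a^2)))"
    using one_plus_square_pos[of a] by (simp add: g_def field_simps power2_eq_square)
  have "cls_Q n s y (a, m, t) = (\<Sum>k\<in>G. (y k - a * y (k - 1) - m)^2) + ((y s - a * y (s - 1) - m - t)^2 + (y (s + 1) - a * y s - m + a * t)^2)"
    by (simp add: cls_Q_def G_def)
  also have "\<dots> = (\<Sum>k\<in>G. (r k)^2) + local_obj \<alpha> \<mu> (y (s - 1)) (y (s + 1)) n ((\<Sum>k\<in>G. y (k - 1) ^ 2) / real n, (\<Sum>k\<in>G. y (k - 1)) / real n, real (card G) / real n)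
       ((\<Sum>k\<in>G. y (k - 1) * r k) / sqrt (real n), (\<Sum>k\<in>G. r k) / sqrt (real n)) (x, z)
    + (1 + a^2) * (t - (y s - (a * (y (s - 1) + y (s + 1)) + (1 - a) * m) / (1 + a^2)))^2"
    unfolding 1 2[unfolded 3 power2_minus] local_obj_def fst_conv snd_conv case_prod_conv a_def[symmetric] m_def[symmetric]
    by (simp only: algebra_simps)
  finally show ?thesis unfolding a_def m_def .
qed

text \<open>No probability enters. For given neighbours \<open>b\<close> and \<open>c\<close> the
  thresholds are independent of \<open>s\<close> and \<open>y\<close>, so the random event on which
  the conclusion holds is described by five inequalities.\<close>

theorem cls_est_deterministic:
  fixes \<alpha> \<mu> b c S2 S1 K \<epsilon> :: real
  assumes D: "0 < S2 - S1^2" and \<epsilon>: "0 < \<epsilon>" and K: "0 \<le> K"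
  shows "\<exists>\<eta>>0. \<exists>n0. \<forall>n\<ge>n0. \<forall>s y. 1 \<le> s \<longrightarrow> y (s - 1) = b \<longrightarrow> y (s + 1) = c \<longrightarrow>
    \<bar>(\<Sum>k\<in>{1..n} - {s, s + 1}. y (k - 1) ^ 2) / real n - S2\<bar> \<le> \<eta> \<longrightarrow>
    \<bar>(\<Sum>k\<in>{1..n} - {s, s + 1}. y (k - 1)) / real n - S1\<bar> \<le> \<eta> \<longrightarrow>
    \<bar>real (card ({1..n} - {s, s + 1})) / real n - 1\<bar> \<le> \<eta> \<longrightarrow>
    \<bar>(\<Sum>k\<in>{1..n} - {s, s + 1}. y (k - 1) * (y k - \<alpha> * y (k - 1) - \<mu>)) / sqrt (real n)\<bar> \<le> K \<longrightarrow>
    \<bar>(\<Sum>k\<in>{1..n} - {s, s + 1}. y k - \<alpha> * y (k - 1) - \<mu>) / sqrt (real n)\<bar> \<le> K \<longrightarrow>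
    (let e = cls_est n s y; \<sigma>1 = (\<Sum>k\<in>{1..n} - {s, s + 1}. y (k - 1) * (y k - \<alpha> * y (k - 1) - \<mu>)) / sqrt (real n);
         \<sigma>0 = (\<Sum>k\<in>{1..n} - {s, s + 1}. y k - \<alpha> * y (k - 1) - \<mu>) / sqrt (real n)
     in \<bar>sqrt (real n) * (fst e - \<alpha>) - (\<sigma>1 - S1 * \<sigma>0) / (S2 - S1^2)\<bar> \<le> \<epsilon> \<and>
        \<bar>sqrt (real n) * (fst (snd e) - \<mu>) - (S2 * \<sigma>0 - S1 * \<sigma>1) / (S2 - S1^2)\<bar> \<le> \<epsilon> \<and>
        snd (snd e) = y s - (fst e * (b + c) + (1 - fst e) * fst (snd e)) / (1 + (fst e)^2))"
proof -
  obtain \<eta> n0 where \<eta>: "0 < \<eta>" and main: "\<And>n a2 a1 a0 \<sigma>1 \<sigma>0. n0 \<le> n \<Longrightarrow> \<bar>a2 - S2\<bar> \<le> \<eta> \<Longrightarrow> \<bar>a1 - S1\<bar> \<le> \<eta> \<Longrightarrow> \<bar>a0 - 1\<bar> \<le> \<eta> \<Longrightarrow> \<bar>\<sigma>1\<bar> \<le> K \<Longrightarrow> \<bar>\<sigma>0\<bar> \<le> K \<Longrightarrow>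
    (\<exists>w. (\<forall>v. local_obj \<alpha> \<mu> b c n (a2, a1, a0) (\<sigma>1, \<sigma>0) w \<le> local_obj \<alpha> \<mu> b c n (a2, a1, a0) (\<sigma>1, \<sigma>0) v) \<and>
      (\<forall>w'. (\<forall>v. local_obj \<alpha> \<mu> b c n (a2, a1, a0) (\<sigma>1, \<sigma>0) w' \<le> local_obj \<alpha> \<mu> b c n (a2, a1, a0) (\<sigma>1, \<sigma>0) v) \<longrightarrow> w' = w) \<and>
      \<bar>fst w - (\<sigma>1 - S1 * \<sigma>0) / (S2 - S1^2)\<bar> \<le> \<epsilon> \<and> \<bar>snd w - (S2 * \<sigma>0 - S1 * \<sigma>1) / (S2 - S1^2)\<bar> \<le> \<epsilon>)"
    using local_obj_minimizer[OF D \<epsilon> K, of \<alpha> \<mu> b c] by blast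
  have est: "let e = cls_est n s y; \<sigma>1 = (\<Sum>k\<in>{1..n} - {s, s + 1}. y (k - 1) * (y k - \<alpha> * y (k - 1) - \<mu>)) / sqrt (real n);
         \<sigma>0 = (\<Sum>k\<in>{1..n} - {s, s + 1}. y k - \<alpha> * y (k - 1) - \<mu>) / sqrt (real n)
     in \<bar>sqrt (real n) * (fst e - \<alpha>) - (\<sigma>1 - S1 * \<sigma>0) / (S2 - S1^2)\<bar> \<le> \<epsilon> \<and>
        \<bar>sqrt (real n) * (fst (snd e) - \<mu>) - (S2 * \<sigma>0 - S1 * \<sigma>1) / (S2 - S1^2)\<bar> \<le> \<epsilon> \<and>
        snd (snd e) = y s - (fst e * (b + c) + (1 - fst e) * fst (snd e)) / (1 + (fst e)^2)"
    if n: "max 1 n0 \<le> n" and s: "1 \<le> s" and bc: "y (s - 1) = b" "y (s + 1) = c"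
      and h: "\<bar>(\<Sum>k\<in>{1..n} - {s, s + 1}. y (k - 1) ^ 2) / real n - S2\<bar> \<le> \<eta>"
        "\<bar>(\<Sum>k\<in>{1..n} - {s, s + 1}. y (k - 1)) / real n - S1\<bar> \<le> \<eta>"
        "\<bar>real (card ({1..n} - {s, s + 1})) / real n - 1\<bar> \<le> \<eta>"
        "\<bar>(\<Sum>k\<in>{1..n} - {s, s + 1}. y (k - 1) * (y k - \<alpha> * y (k - 1) - \<mu>)) / sqrt (real n)\<bar> \<le> K"
        "\<bar>(\<Sum>k\<in>{1..n} - {s, s + 1}. y k - \<alpha> * y (k - 1) - \<mu>) / sqrt (real n)\<bar> \<le> K" for n s and y :: "nat \<Rightarrow> real"
  proof -
    define G where "G = {1..n} - {s, s + 1}"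
    define \<sigma>1 where "\<sigma>1 = (\<Sum>k\<in>G. y (k - 1) * (y k - \<alpha> * y (k - 1) - \<mu>)) / sqrt (real n)"
    define \<sigma>0 where "\<sigma>0 = (\<Sum>k\<in>G. y k - \<alpha> * y (k - 1) - \<mu>) / sqrt (real n)"
    define L where "L = local_obj \<alpha> \<mu> b c n ((\<Sum>k\<in>G. y (k - 1) ^ 2) / real n, (\<Sum>k\<in>G. y (k - 1)) / real n, real (card G) / real n) (\<sigma>1, \<sigma>0)"
    define ts where "ts a m = y s - (a * (b + c) + (1 - a) * m) / (1 + a^2)" for a m
    define c0 where "c0 = (\<Sum>k\<in>G. (y k - \<alpha> * y (k - 1) - \<mu>)^2)"
    have n0: "0 < n" "n0 \<le> n" using n by auto
    have r0: "0 < sqrt (real n)" using n0 by simp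
    obtain w where w: "\<And>v. L w \<le> L v" "\<And>w'. (\<And>v. L w' \<le> L v) \<Longrightarrow> w' = w"
      "\<bar>fst w - (\<sigma>1 - S1 * \<sigma>0) / (S2 - S1^2)\<bar> \<le> \<epsilon>" "\<bar>snd w - (S2 * \<sigma>0 - S1 * \<sigma>1) / (S2 - S1^2)\<bar> \<le> \<epsilon>"
      using main[OF n0(2) h[folded G_def, folded \<sigma>1_def \<sigma>0_def]] unfolding L_def by blast
    have Q: "cls_Q n s y (\<alpha> + x / sqrt (real n), \<mu> + z / sqrt (real n), t) = c0 + L (x, z)
      + (1 + (\<alpha> + x / sqrt (real n))^2) * (t - ts (\<alpha> + x / sqrt (real n)) (\<mu> + z / sqrt (real n)))^2" for x z t
      unfolding cls_Q_profile[OF n0(1) s] c0_def L_def \<sigma>1_def \<sigma>0_def ts_def bc G_def ..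
    \<comment> \<open>The local coordinates cover the whole plane since \<open>sqrt n\<close> is
      nonzero, so a global minimiser of the local objective yields one of the original
      objective.\<close>
    have Q': "cls_Q n s y (a, m, t) = c0 + L (sqrt (real n) * (a - \<alpha>), sqrt (real n) * (m - \<mu>)) + (1 + a^2) * (t - ts a m)^2" for a m t
    proof -
      have "\<alpha> + sqrt (real n) * (a - \<alpha>) / sqrt (real n) = a" "\<mu> + sqrt (real n) * (m - \<mu>) / sqrt (real n) = m" using n0 by simp_all
      then show ?thesis using Q[of "sqrt (real n) * (a - \<alpha>)" "sqrt (real n) * (m - \<mu>)" t] by simp
    qed
    define a m where "a = \<alpha> + fst w / sqrt (real n)" and "m = \<mu> + snd w / sqrt (real n)"
    have Qmin: "cls_Q n s y (a, m, ts a m) = c0 + L w" using Q[of "fst w" "snd w" "ts a m"] by (simp add: a_def m_def)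
    have ge: "c0 + L w \<le> cls_Q n s y q" for q
    proof -
      obtain a' m' t' where q: "q = (a', m', t')" by (cases q) auto
      have "0 \<le> (1 + a'^2) * (t' - ts a' m')^2" using one_plus_square_pos[of a'] by simp
      then show ?thesis unfolding q Q' using w(1) by (smt (verit))
    qed
    have uniq: "q = (a, m, ts a m)" if q: "\<forall>q'. cls_Q n s y q \<le> cls_Q n s y q'" for q
    proof -
      obtain a' m' t' where qe: "q = (a', m', t')" by (cases q) auto
      define w' where "w' = (sqrt (real n) * (a' - \<alpha>), sqrt (real n) * (m' - \<mu>))"
      have le: "c0 + L w' + (1 + a'^2) * (t' - ts a' m')^2 \<le> c0 + L w"
        using q[rule_format, of "(a, m, ts a m)"] unfolding Qmin unfolding qe Q' w'_def .
      have nn: "0 \<le> (1 + a'^2) * (t' - ts a' m')^2" using one_plus_square_pos[of a'] by simp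
      have "w' = w" by (rule w(2)) (use le nn w(1) in \<open>smt (verit)\<close>)
      then have "a' = a" "m' = m" using r0 by (auto simp: w'_def a_def m_def field_simps)
      moreover have "(1 + a'^2) * (t' - ts a' m')^2 \<le> 0" using le \<open>w' = w\<close> by simp
      then have "t' = ts a' m'" using one_plus_square_pos[of a'] by (simp add: mult_le_0_iff)
      ultimately show ?thesis by (simp add: qe)
    qed
    \<comment> \<open>Existence together with uniqueness selects the first branch of
      \<open>cls_est\<close>; the default value does not occur here.\<close>
    have "\<exists>!q. \<forall>q'. cls_Q n s y q \<le> cls_Q n s y q'"
      by (rule ex1I[of _ "(a, m, ts a m)"]) (use ge Qmin uniq in auto)
    moreover have "(THE q. \<forall>q'. cls_Q n s y q \<le> cls_Q n s y q') = (a, m, ts a m)"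
      by (rule the_equality) (use ge Qmin uniq in auto)
    ultimately have e: "cls_est n s y = (a, m, ts a m)" by (simp add: cls_est_def)
    have "sqrt (real n) * (a - \<alpha>) = fst w" "sqrt (real n) * (m - \<mu>) = snd w" using r0 by (simp_all add: a_def m_def)
    then show ?thesis unfolding e G_def[symmetric] Let_def \<sigma>1_def[symmetric] \<sigma>0_def[symmetric] using w(3,4) by (simp add: ts_def)
  qed
  show ?thesis
  proof (intro exI conjI)
    show "0 < \<eta>" by (rule \<eta>)
    show "\<forall>n\<ge>max 1 n0. \<forall>s y. 1 \<le> s \<longrightarrow> y (s - 1) = b \<longrightarrow> y (s + 1) = c \<longrightarrow>
    \<bar>(\<Sum>k\<in>{1..n} - {s, s + 1}. y (k - 1) ^ 2) / real n - S2\<bar> \<le> \<eta> \<longrightarrow>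
    \<bar>(\<Sum>k\<in>{1..n} - {s, s + 1}. y (k - 1)) / real n - S1\<bar> \<le> \<eta> \<longrightarrow>
    \<bar>real (card ({1..n} - {s, s + 1})) / real n - 1\<bar> \<le> \<eta> \<longrightarrow>
    \<bar>(\<Sum>k\<in>{1..n} - {s, s + 1}. y (k - 1) * (y k - \<alpha> * y (k - 1) - \<mu>)) / sqrt (real n)\<bar> \<le> K \<longrightarrow>
    \<bar>(\<Sum>k\<in>{1..n} - {s, s + 1}. y k - \<alpha> * y (k - 1) - \<mu>) / sqrt (real n)\<bar> \<le> K \<longrightarrow>
    (let e = cls_est n s y; \<sigma>1 = (\<Sum>k\<in>{1..n} - {s, s + 1}. y (k - 1) * (y k - \<alpha> * y (k - 1) - \<mu>)) / sqrt (real n);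
         \<sigma>0 = (\<Sum>k\<in>{1..n} - {s, s + 1}. y k - \<alpha> * y (k - 1) - \<mu>) / sqrt (real n)
     in \<bar>sqrt (real n) * (fst e - \<alpha>) - (\<sigma>1 - S1 * \<sigma>0) / (S2 - S1^2)\<bar> \<le> \<epsilon> \<and>
        \<bar>sqrt (real n) * (fst (snd e) - \<mu>) - (S2 * \<sigma>0 - S1 * \<sigma>1) / (S2 - S1^2)\<bar> \<le> \<epsilon> \<and>
        snd (snd e) = y s - (fst e * (b + c) + (1 - fst e) * fst (snd e)) / (1 + (fst e)^2))"
      by (intro allI impI, rule est)
  qed
qed

section \<open>Convergence in probability\<close>

context prob_space begin

definition to_zero_prob :: "(nat \<Rightarrow> 'a \<Rightarrow> real) \<Rightarrow> bool" where
  "to_zero_prob Z \<longleftrightarrow> (\<forall>n. Z n \<in> borel_measurable M) \<and> (\<forall>e>0. (\<lambda>n. prob {\<omega>\<in>space M. e < \<bar>Z n \<omega>\<bar>}) \<longlonglongrightarrow> 0)"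

text \<open>Tightness, required only for large \<open>n\<close> at each level \<open>e\<close>,
  because the moment bounds start at some index.\<close>

definition stoch_bounded :: "(nat \<Rightarrow> 'a \<Rightarrow> real) \<Rightarrow> bool" where
  "stoch_bounded Z \<longleftrightarrow> (\<forall>n. Z n \<in> borel_measurable M) \<and> (\<forall>e>0. \<exists>K\<ge>0. \<forall>\<^sub>F n in sequentially. prob {\<omega>\<in>space M. K < \<bar>Z n \<omega>\<bar>} \<le> e)"

lemma to_zero_probD: "to_zero_prob Z \<Longrightarrow> 0 < e \<Longrightarrow> (\<lambda>n. prob {\<omega>\<in>space M. e < \<bar>Z n \<omega>\<bar>}) \<longlonglongrightarrow> 0"
  by (simp add: to_zero_prob_def)

lemma prob_abs_gt_le:
  assumes "integrable M Z" "0 < e"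
  shows "prob {\<omega>\<in>space M. e < \<bar>Z \<omega>\<bar>} \<le> expectation (\<lambda>\<omega>. \<bar>Z \<omega>\<bar>) / e"
proof -
  have [measurable]: "Z \<in> borel_measurable M" using assms by auto
  have "prob {\<omega>\<in>space M. e < \<bar>Z \<omega>\<bar>} \<le> prob {\<omega>\<in>space M. e \<le> \<bar>Z \<omega>\<bar>}"
    by (intro finite_measure_mono) auto
  also have "\<dots> \<le> expectation (\<lambda>\<omega>. \<bar>Z \<omega>\<bar>) / e"
    by (rule integral_Markov_inequality_measure[where A="{}"]) (use assms in auto)
  finally show ?thesis .
qed

lemma to_zero_probI_L1:
  assumes i: "\<And>n. integrable M (Z n)" and l: "(\<lambda>n. expectation (\<lambda>\<omega>. \<bar>Z n \<omega>\<bar>)) \<longlonglongrightarrow> 0"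
  shows "to_zero_prob Z"
  unfolding to_zero_prob_def
proof (intro conjI allI impI)
  show "Z n \<in> borel_measurable M" for n using i[of n] by auto
  fix e :: real assume e: "0 < e"
  show "(\<lambda>n. prob {\<omega>\<in>space M. e < \<bar>Z n \<omega>\<bar>}) \<longlonglongrightarrow> 0"
  proof (rule Lim_null_comparison[where g="\<lambda>n. expectation (\<lambda>\<omega>. \<bar>Z n \<omega>\<bar>) / e"])
    show "\<forall>\<^sub>F n in sequentially. norm (prob {\<omega>\<in>space M. e < \<bar>Z n \<omega>\<bar>}) \<le> expectation (\<lambda>\<omega>. \<bar>Z n \<omega>\<bar>) / e"
      using prob_abs_gt_le[OF i e] by simp
    show "(\<lambda>n. expectation (\<lambda>\<omega>. \<bar>Z n \<omega>\<bar>) / e) \<longlonglongrightarrow> 0" using tendsto_divide[OF l tendsto_const[of e]] e by simp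
  qed
qed

lemma to_zero_prob_pointwise:
  assumes [measurable]: "\<And>n. Z n \<in> borel_measurable M" and l: "\<And>\<omega>. \<omega> \<in> space M \<Longrightarrow> (\<lambda>n. Z n \<omega>) \<longlonglongrightarrow> 0"
  shows "to_zero_prob Z"
  unfolding to_zero_prob_def
proof (intro conjI allI impI)
  fix e :: real assume e: "0 < e"
  have "(\<lambda>n. expectation (indicator {\<omega>\<in>space M. e < \<bar>Z n \<omega>\<bar>})) \<longlonglongrightarrow> expectation (\<lambda>_. 0 :: real)"
  proof (rule integral_dominated_convergence[where w="\<lambda>_. 1"])
    show "AE \<omega> in M. (\<lambda>n. indicat_real {\<omega>\<in>space M. e < \<bar>Z n \<omega>\<bar>} \<omega>) \<longlonglongrightarrow> 0"
    proof (rule AE_I2)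
      fix \<omega> assume "\<omega> \<in> space M"
      from tendstoD[OF l[OF this] e] have "\<forall>\<^sub>F n in sequentially. indicat_real {\<omega>\<in>space M. e < \<bar>Z n \<omega>\<bar>} \<omega> = 0"
        by eventually_elim (auto simp: indicator_def)
      then show "(\<lambda>n. indicat_real {\<omega>\<in>space M. e < \<bar>Z n \<omega>\<bar>} \<omega>) \<longlonglongrightarrow> 0" by (rule tendsto_eventually)
    qed
  qed (auto simp: indicator_def)
  then show "(\<lambda>n. prob {\<omega>\<in>space M. e < \<bar>Z n \<omega>\<bar>}) \<longlonglongrightarrow> 0" by simp
qed simp

lemma to_zero_prob_add:
  assumes Z: "to_zero_prob Z" and W: "to_zero_prob W"
  shows "to_zero_prob (\<lambda>n \<omega>. Z n \<omega> + W n \<omega>)"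
  unfolding to_zero_prob_def
proof (intro conjI allI impI)
  have [measurable]: "Z n \<in> borel_measurable M" "W n \<in> borel_measurable M" for n
    using Z W by (auto simp: to_zero_prob_def)
  show "(\<lambda>\<omega>. Z n \<omega> + W n \<omega>) \<in> borel_measurable M" for n by measurable
  fix e :: real assume e: "0 < e"
  then have "0 < e / 2" by simp
  then have l: "(\<lambda>n. prob {\<omega>\<in>space M. e / 2 < \<bar>Z n \<omega>\<bar>}) \<longlonglongrightarrow> 0" "(\<lambda>n. prob {\<omega>\<in>space M. e / 2 < \<bar>W n \<omega>\<bar>}) \<longlonglongrightarrow> 0"
    by (rule to_zero_probD[OF Z], rule to_zero_probD[OF W])
  show "(\<lambda>n. prob {\<omega>\<in>space M. e < \<bar>Z n \<omega> + W n \<omega>\<bar>}) \<longlonglongrightarrow> 0"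
  proof (rule Lim_null_comparison[where g="\<lambda>n. prob {\<omega>\<in>space M. e / 2 < \<bar>Z n \<omega>\<bar>} + prob {\<omega>\<in>space M. e / 2 < \<bar>W n \<omega>\<bar>}"])
    show "\<forall>\<^sub>F n in sequentially. norm (prob {\<omega>\<in>space M. e < \<bar>Z n \<omega> + W n \<omega>\<bar>}) \<le> prob {\<omega>\<in>space M. e / 2 < \<bar>Z n \<omega>\<bar>} + prob {\<omega>\<in>space M. e / 2 < \<bar>W n \<omega>\<bar>}"
    proof (rule always_eventually, rule allI)
      fix n
      have "{\<omega>\<in>space M. e < \<bar>Z n \<omega> + W n \<omega>\<bar>} \<subseteq> {\<omega>\<in>space M. e / 2 < \<bar>Z n \<omega>\<bar>} \<union> {\<omega>\<in>space M. e / 2 < \<bar>W n \<omega>\<bar>}" by auto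
      then have "prob {\<omega>\<in>space M. e < \<bar>Z n \<omega> + W n \<omega>\<bar>} \<le> prob ({\<omega>\<in>space M. e / 2 < \<bar>Z n \<omega>\<bar>} \<union> {\<omega>\<in>space M. e / 2 < \<bar>W n \<omega>\<bar>})"
        by (intro finite_measure_mono) auto
      also have "\<dots> \<le> prob {\<omega>\<in>space M. e / 2 < \<bar>Z n \<omega>\<bar>} + prob {\<omega>\<in>space M. e / 2 < \<bar>W n \<omega>\<bar>}"
        by (intro measure_Un_le) auto
      finally show "norm (prob {\<omega>\<in>space M. e < \<bar>Z n \<omega> + W n \<omega>\<bar>}) \<le> prob {\<omega>\<in>space M. e / 2 < \<bar>Z n \<omega>\<bar>} + prob {\<omega>\<in>space M. e / 2 < \<bar>W n \<omega>\<bar>}" by simp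
    qed
    show "(\<lambda>n. prob {\<omega>\<in>space M. e / 2 < \<bar>Z n \<omega>\<bar>} + prob {\<omega>\<in>space M. e / 2 < \<bar>W n \<omega>\<bar>}) \<longlonglongrightarrow> 0"
      using tendsto_add[OF l] by simp
  qed
qed

lemma to_zero_prob_cmult:
  assumes Z: "to_zero_prob Z" shows "to_zero_prob (\<lambda>n \<omega>. c * Z n \<omega>)"
proof (cases "c = 0")
  case True then show ?thesis by (simp add: to_zero_prob_def)
next
  case False
  have [measurable]: "Z n \<in> borel_measurable M" for n using Z by (auto simp: to_zero_prob_def)
  have "(\<lambda>n. prob {\<omega>\<in>space M. e < \<bar>c * Z n \<omega>\<bar>}) \<longlonglongrightarrow> 0" if "0 < e" for e
  proof -
    have "{\<omega>\<in>space M. e < \<bar>c * Z n \<omega>\<bar>} = {\<omega>\<in>space M. e / \<bar>c\<bar> < \<bar>Z n \<omega>\<bar>}" for n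
      using False by (auto simp: abs_mult field_simps)
    then show ?thesis using Z False that by (simp add: to_zero_prob_def)
  qed
  then show ?thesis by (simp add: to_zero_prob_def)
qed

lemma to_zero_prob_cong:
  assumes Z: "to_zero_prob Z" and e: "\<And>n \<omega>. N \<le> n \<Longrightarrow> \<omega> \<in> space M \<Longrightarrow> Z n \<omega> = W n \<omega>" and W: "\<And>n. W n \<in> borel_measurable M"
  shows "to_zero_prob W"
  unfolding to_zero_prob_def
proof (intro conjI allI impI W)
  fix d :: real assume d: "0 < d"
  then have "(\<lambda>n. prob {\<omega>\<in>space M. d < \<bar>Z n \<omega>\<bar>}) \<longlonglongrightarrow> 0" using Z by (auto simp: to_zero_prob_def)
  then show "(\<lambda>n. prob {\<omega>\<in>space M. d < \<bar>W n \<omega>\<bar>}) \<longlonglongrightarrow> 0"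
  proof (rule Lim_transform_eventually)
    show "\<forall>\<^sub>F n in sequentially. prob {\<omega>\<in>space M. d < \<bar>Z n \<omega>\<bar>} = prob {\<omega>\<in>space M. d < \<bar>W n \<omega>\<bar>}"
      using eventually_ge_at_top[of N] by eventually_elim (auto intro!: arg_cong[where f=prob] simp: e)
  qed
qed

lemma stoch_boundedI_L2:
  assumes Z: "\<And>n. Z n \<in> borel_measurable M" "\<And>n. N \<le> n \<Longrightarrow> integrable M (\<lambda>\<omega>. (Z n \<omega>)^2)"
    and B: "\<And>n. N \<le> n \<Longrightarrow> expectation (\<lambda>\<omega>. (Z n \<omega>)^2) \<le> B"
  shows "stoch_bounded Z"
  unfolding stoch_bounded_def
proof (intro conjI allI impI Z(1))
  fix e :: real assume e: "0 < e"
  have B0: "0 \<le> B" using order_trans[OF _ B[OF order_refl]] by (simp add: integral_nonneg_AE)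
  define K where "K = (sqrt B + 1) / e"
  have K: "0 < K" using B0 e by (simp add: K_def add_nonneg_pos)
  have "prob {\<omega>\<in>space M. K < \<bar>Z n \<omega>\<bar>} \<le> e" if n: "N \<le> n" for n
  proof -
    have "prob {\<omega>\<in>space M. K < \<bar>Z n \<omega>\<bar>} \<le> expectation (\<lambda>\<omega>. \<bar>Z n \<omega>\<bar>) / K"
      by (rule prob_abs_gt_le[OF expectation_abs_le_sqrt(1)[OF Z(1) Z(2)[OF n]] K])
    also have "\<dots> \<le> sqrt B / K"
      using expectation_abs_le_sqrt(2)[OF Z(1) Z(2)[OF n]] B[OF n] K
      by (intro divide_right_mono) (auto intro: order_trans[OF _ real_sqrt_le_mono])
    also have "\<dots> \<le> e" using B0 e K by (simp add: K_def field_simps)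
    finally show ?thesis .
  qed
  then show "\<exists>K\<ge>0. \<forall>\<^sub>F n in sequentially. prob {\<omega>\<in>space M. K < \<bar>Z n \<omega>\<bar>} \<le> e"
    using K by (intro exI[of _ K]) (auto simp: eventually_sequentially)
qed

lemma stoch_bounded_perturb:
  assumes Z: "stoch_bounded Z" and W: "to_zero_prob (\<lambda>n \<omega>. W n \<omega> - Z n \<omega>)" and m: "\<And>n. W n \<in> borel_measurable M"
  shows "stoch_bounded W"
  unfolding stoch_bounded_def
proof (intro conjI allI impI m)
  fix e :: real assume e: "0 < e"
  have [measurable]: "Z n \<in> borel_measurable M" "W n \<in> borel_measurable M" for n using Z m by (auto simp: stoch_bounded_def)
  obtain K where K: "0 \<le> K" "\<forall>\<^sub>F n in sequentially. prob {\<omega>\<in>space M. K < \<bar>Z n \<omega>\<bar>} \<le> e / 2"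
    using Z half_gt_zero[OF e] unfolding stoch_bounded_def by blast
  have "(\<lambda>n. prob {\<omega>\<in>space M. 1 < \<bar>W n \<omega> - Z n \<omega>\<bar>}) \<longlonglongrightarrow> 0" by (rule to_zero_probD[OF W]) simp
  then have "\<forall>\<^sub>F n in sequentially. prob {\<omega>\<in>space M. 1 < \<bar>W n \<omega> - Z n \<omega>\<bar>} < e / 2"
    by (rule order_tendstoD(2)) (use e in simp)
  with K(2) have "\<forall>\<^sub>F n in sequentially. prob {\<omega>\<in>space M. K + 1 < \<bar>W n \<omega>\<bar>} \<le> e"
  proof eventually_elim
    case (elim n)
    have "prob {\<omega>\<in>space M. K + 1 < \<bar>W n \<omega>\<bar>} \<le> prob ({\<omega>\<in>space M. K < \<bar>Z n \<omega>\<bar>} \<union> {\<omega>\<in>space M. 1 < \<bar>W n \<omega> - Z n \<omega>\<bar>})"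
      by (intro finite_measure_mono) auto
    also have "\<dots> \<le> prob {\<omega>\<in>space M. K < \<bar>Z n \<omega>\<bar>} + prob {\<omega>\<in>space M. 1 < \<bar>W n \<omega> - Z n \<omega>\<bar>}"
      by (intro measure_Un_le) auto
    finally show ?case using elim by linarith
  qed
  then show "\<exists>K\<ge>0. \<forall>\<^sub>F n in sequentially. prob {\<omega>\<in>space M. K < \<bar>W n \<omega>\<bar>} \<le> e" using K(1) by (intro exI[of _ "K + 1"]) auto
qed

text \<open>Slutsky's theorem at the level of weighted characteristic functions: the exponentials
  differ by at most \<open>e\<close> off a rare event and by at most 2 on it. The weight
  \<open>F\<close> carries the conditioning.\<close>

lemma to_zero_prob_iexp:
  assumes D: "to_zero_prob (\<lambda>n \<omega>. Z n \<omega> - W n \<omega>)" and F: "\<And>\<omega>. norm (F \<omega>) \<le> 1" "F \<in> borel_measurable M"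
    and m: "\<And>n. Z n \<in> borel_measurable M" "\<And>n. W n \<in> borel_measurable M"
    and l: "(\<lambda>n. \<integral>\<omega>. F \<omega> * iexp (W n \<omega>) \<partial>M) \<longlonglongrightarrow> L"
  shows "(\<lambda>n. \<integral>\<omega>. F \<omega> * iexp (Z n \<omega>) \<partial>M) \<longlonglongrightarrow> L"
proof -
  note [measurable] = m F(2)
  have i: "integrable M (\<lambda>\<omega>. F \<omega> * iexp (Z n \<omega>))" "integrable M (\<lambda>\<omega>. F \<omega> * iexp (W n \<omega>))" for n
    by (rule integrable_const_bound[where B=1], use F in \<open>auto simp: norm_mult\<close>)+
  have le: "norm ((\<integral>\<omega>. F \<omega> * iexp (Z n \<omega>) \<partial>M) - (\<integral>\<omega>. F \<omega> * iexp (W n \<omega>) \<partial>M)) \<le> e + 2 * prob {\<omega>\<in>space M. e < \<bar>Z n \<omega> - W n \<omega>\<bar>}"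
    if e: "0 < e" for n e
  proof -
    have iI: "integrable M (indicat_real {\<omega>\<in>space M. e < \<bar>Z n \<omega> - W n \<omega>\<bar>})"
      by (rule integrable_real_indicator) (auto simp: less_top[symmetric])
    have q: "(\<integral>\<omega>. F \<omega> * iexp (Z n \<omega>) \<partial>M) - (\<integral>\<omega>. F \<omega> * iexp (W n \<omega>) \<partial>M) = (\<integral>\<omega>. F \<omega> * iexp (Z n \<omega>) - F \<omega> * iexp (W n \<omega>) \<partial>M)"
      using i by simp
    have "norm ((\<integral>\<omega>. F \<omega> * iexp (Z n \<omega>) \<partial>M) - (\<integral>\<omega>. F \<omega> * iexp (W n \<omega>) \<partial>M)) \<le> (\<integral>\<omega>. norm (F \<omega> * iexp (Z n \<omega>) - F \<omega> * iexp (W n \<omega>)) \<partial>M)"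
      unfolding q by (rule integral_norm_bound)
    also have "\<dots> \<le> (\<integral>\<omega>. e + 2 * indicator {\<omega>\<in>space M. e < \<bar>Z n \<omega> - W n \<omega>\<bar>} \<omega> \<partial>M)"
    proof (rule integral_mono)
      show "integrable M (\<lambda>\<omega>. norm (F \<omega> * iexp (Z n \<omega>) - F \<omega> * iexp (W n \<omega>)))"
        by (intro integrable_norm Bochner_Integration.integrable_diff i)
      show "integrable M (\<lambda>\<omega>. e + 2 * indicator {\<omega>\<in>space M. e < \<bar>Z n \<omega> - W n \<omega>\<bar>} \<omega>)" using iI by simp
      fix \<omega> assume w: "\<omega> \<in> space M"
      have "norm (F \<omega> * iexp (Z n \<omega>) - F \<omega> * iexp (W n \<omega>)) = norm (F \<omega>) * norm (iexp (Z n \<omega>) - iexp (W n \<omega>))"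
        unfolding norm_mult[symmetric] by (simp add: right_diff_distrib)
      also have "\<dots> \<le> 1 * norm (iexp (Z n \<omega>) - iexp (W n \<omega>))" by (intro mult_right_mono F) auto
      finally have 1: "norm (F \<omega> * iexp (Z n \<omega>) - F \<omega> * iexp (W n \<omega>)) \<le> norm (iexp (Z n \<omega>) - iexp (W n \<omega>))" by simp
      show "norm (F \<omega> * iexp (Z n \<omega>) - F \<omega> * iexp (W n \<omega>)) \<le> e + 2 * indicator {\<omega>\<in>space M. e < \<bar>Z n \<omega> - W n \<omega>\<bar>} \<omega>"
      proof (cases "e < \<bar>Z n \<omega> - W n \<omega>\<bar>")
        case True
        have "norm (iexp (Z n \<omega>) - iexp (W n \<omega>)) \<le> norm (iexp (Z n \<omega>)) + norm (iexp (W n \<omega>))" by (rule norm_triangle_ineq4)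
        then show ?thesis using 1 True w e by simp
      next
        case False
        then show ?thesis using 1 norm_iexp_diff[of "Z n \<omega>" "W n \<omega>"] by (simp add: indicator_def)
      qed
    qed
    also have "\<dots> = e + 2 * prob {\<omega>\<in>space M. e < \<bar>Z n \<omega> - W n \<omega>\<bar>}"
      using iI by (simp add: prob_space)
    finally show ?thesis .
  qed
  have "(\<lambda>n. (\<integral>\<omega>. F \<omega> * iexp (Z n \<omega>) \<partial>M) - (\<integral>\<omega>. F \<omega> * iexp (W n \<omega>) \<partial>M)) \<longlonglongrightarrow> 0"
  proof (rule LIMSEQ_I)
    fix r :: real assume r: "0 < r"
    have "(\<lambda>n. prob {\<omega>\<in>space M. r / 2 < \<bar>Z n \<omega> - W n \<omega>\<bar>}) \<longlonglongrightarrow> 0" by (rule to_zero_probD[OF D half_gt_zero[OF r]])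
    then have "\<forall>\<^sub>F n in sequentially. prob {\<omega>\<in>space M. r / 2 < \<bar>Z n \<omega> - W n \<omega>\<bar>} < r / 4"
      by (rule order_tendstoD(2)) (use r in simp)
    then have "\<forall>\<^sub>F n in sequentially. norm ((\<integral>\<omega>. F \<omega> * iexp (Z n \<omega>) \<partial>M) - (\<integral>\<omega>. F \<omega> * iexp (W n \<omega>) \<partial>M)) < r"
    proof eventually_elim
      case (elim n)
      have "norm ((\<integral>\<omega>. F \<omega> * iexp (Z n \<omega>) \<partial>M) - (\<integral>\<omega>. F \<omega> * iexp (W n \<omega>) \<partial>M)) \<le> r / 2 + 2 * prob {\<omega>\<in>space M. r / 2 < \<bar>Z n \<omega> - W n \<omega>\<bar>}"
        by (rule le) (use r in simp)
      then show ?case using elim by linarith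
    qed
    then show "\<exists>no. \<forall>n\<ge>no. norm ((\<integral>\<omega>. F \<omega> * iexp (Z n \<omega>) \<partial>M) - (\<integral>\<omega>. F \<omega> * iexp (W n \<omega>) \<partial>M) - 0) < r"
      by (simp add: eventually_sequentially)
  qed
  from tendsto_add[OF this l] show ?thesis by simp
qed

end

locale inar_outlier = inar_process +
  fixes s \<theta> :: nat
  assumes s: "1 \<le> s"
begin

definition Y :: "nat \<Rightarrow> 'a \<Rightarrow> real" where "Y k \<omega> = real (X k \<omega>) + (if k = s then real \<theta> else 0)"
definition est :: "nat \<Rightarrow> 'a \<Rightarrow> real \<times> real \<times> real" where "est n \<omega> = cls_est n s (\<lambda>k. Y k \<omega>)"

text \<open>Starts at \<open>s + 1\<close> because the state \<open>X (s + 1)\<close> is then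
  already known: every increment in the sum is centred given the conditioning pair.\<close>

definition score :: "(nat \<Rightarrow> real) \<Rightarrow> nat \<Rightarrow> 'a \<Rightarrow> real" where
  "score g n \<omega> = (\<Sum>k\<in>{s+1..<n}. incr g k \<omega>) / sqrt (real n)"

text \<open>The score appearing in the estimator. In terms of increments, the omitted residual times
  \<open>s\<close> and \<open>s + 1\<close> are the indices \<open>s - 1\<close> and
  \<open>s\<close>.\<close>

definition fullscore :: "(nat \<Rightarrow> real) \<Rightarrow> nat \<Rightarrow> 'a \<Rightarrow> real" where
  "fullscore g n \<omega> = (\<Sum>k\<in>{..<n} - {s - 1, s}. incr g k \<omega>) / sqrt (real n)"

section \<open>Asymptotic variance and limit of the score\<close>

lemma cubic_poly: "cubic (\<lambda>x. c3 * real x ^ 3 + c2 * real x ^ 2 + c1 * real x + c0)"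
  unfolding cubic_def
proof (intro exI allI)
  fix x :: nat
  have p: "real x ^ j \<le> 1 + real x ^ 3" if "j \<le> 3" for j
    using power_increasing[OF that, of "real x"] by (cases "x = 0") (auto simp: power_0_left)
  have "\<bar>c * real x ^ j\<bar> \<le> \<bar>c\<bar> * (1 + real x ^ 3)" if "j \<le> 3" for c j
    unfolding abs_mult using p[OF that] by (intro mult_mono) auto
  from this[of 3 c3] this[of 2 c2] this[of 1 c1] this[of 0 c0]
  have b: "\<bar>c3 * real x ^ 3\<bar> \<le> \<bar>c3\<bar> * (1 + real x ^ 3)" "\<bar>c2 * real x ^ 2\<bar> \<le> \<bar>c2\<bar> * (1 + real x ^ 3)"
    "\<bar>c1 * real x\<bar> \<le> \<bar>c1\<bar> * (1 + real x ^ 3)" "\<bar>c0\<bar> \<le> \<bar>c0\<bar> * (1 + real x ^ 3)" by simp_all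
  have "\<bar>c3 * real x ^ 3 + c2 * real x ^ 2 + c1 * real x + c0\<bar> \<le> \<bar>c3 * real x ^ 3\<bar> + \<bar>c2 * real x ^ 2\<bar> + \<bar>c1 * real x\<bar> + \<bar>c0\<bar>"
    by (intro order_trans[OF abs_triangle_ineq] add_mono order_refl)
  also have "\<dots> \<le> \<bar>c3\<bar> * (1 + real x ^ 3) + \<bar>c2\<bar> * (1 + real x ^ 3) + \<bar>c1\<bar> * (1 + real x ^ 3) + \<bar>c0\<bar> * (1 + real x ^ 3)"
    by (intro add_mono b)
  also have "\<dots> = (\<bar>c3\<bar> + \<bar>c2\<bar> + \<bar>c1\<bar> + \<bar>c0\<bar>) * (1 + real x ^ 3)" by (simp add: algebra_simps)
  finally show "\<bar>c3 * real x ^ 3 + c2 * real x ^ 2 + c1 * real x + c0\<bar> \<le> cubic_bound (\<bar>c3\<bar> + \<bar>c2\<bar> + \<bar>c1\<bar> + \<bar>c0\<bar>) x"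
    unfolding cubic_bound_def .
qed

abbreviation aff :: "real \<Rightarrow> real \<Rightarrow> nat \<Rightarrow> real" where "aff u1 u0 \<equiv> (\<lambda>x. u1 * real x + u0)"

text \<open>The quadratic form of \<open>inar_A\<close> at the vector \<open>(u1, u0)\<close>; it is
  the stationary mean of the conditional variance for an affine predictable factor.\<close>

definition asym_var :: "real \<Rightarrow> real \<Rightarrow> real" where
  "asym_var u1 u0 = u1^2 * (\<alpha> * (1 - \<alpha>) * l3 + \<sigma>2 * l2) + 2 * u1 * u0 * (\<alpha> * (1 - \<alpha>) * l2 + \<sigma>2 * l1) + u0^2 * (\<alpha> * (1 - \<alpha>) * l1 + \<sigma>2)"

lemma condvar_aff: "condvar (aff u1 u0) x = (u1^2 * (\<alpha> * (1 - \<alpha>))) * real x ^ 3 + (u1^2 * \<sigma>2 + 2 * u1 * u0 * (\<alpha> * (1 - \<alpha>))) * real x ^ 2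
    + (2 * u1 * u0 * \<sigma>2 + u0^2 * (\<alpha> * (1 - \<alpha>))) * real x + u0^2 * \<sigma>2"
  by (simp add: condvar_def power2_eq_square power3_eq_cube algebra_simps)

lemma cubic_condvar_aff: "cubic (condvar (aff u1 u0))"
  unfolding condvar_aff[abs_def] by (rule cubic_poly)

lemma Epi_condvar_aff: "stat_mean (condvar (aff u1 u0)) = asym_var u1 u0"
  unfolding condvar_aff[abs_def] using stat_law1 stat_law2 stat_law3 by (simp add: stat_law_moments asym_var_def algebra_simps)

lemma asym_var_nonneg: "0 \<le> asym_var u1 u0"
  unfolding Epi_condvar_aff[symmetric] by (intro integral_nonneg_AE AE_I2 condvar_nonneg)

lemma measurable_score [measurable]: "score g n \<in> borel_measurable M" "fullscore g n \<in> borel_measurable M"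
  unfolding score_def[abs_def] fullscore_def[abs_def] by measurable

lemma score_stoch_bounded: "stoch_bounded (score (aff u1 u0))"
proof -
  have "(\<lambda>k. expectation (\<lambda>\<omega>. condvar (aff u1 u0) (X k \<omega>))) \<longlonglongrightarrow> stat_mean (condvar (aff u1 u0))"
    by (rule law_cubic_tendsto[OF cubic_condvar_aff])
  then obtain B where B: "\<And>k. expectation (\<lambda>\<omega>. condvar (aff u1 u0) (X k \<omega>)) \<le> B" using LIMSEQ_upper_bound by blast
  have B0: "0 \<le> B" using B[of 0] by (rule order_trans[rotated]) (intro integral_nonneg_AE AE_I2 condvar_nonneg)
  show ?thesis
  proof (rule stoch_boundedI_L2[where N="s + 1" and B=B])
    fix n assume n: "s + 1 \<le> n"
    note sm = second_moment[OF n cubic_condvar_aff[of u1 u0]]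
    show "integrable M (\<lambda>\<omega>. (score (aff u1 u0) n \<omega>)^2)" using sm(1) by (simp add: score_def power_divide)
    have "expectation (\<lambda>\<omega>. (score (aff u1 u0) n \<omega>)^2) = (\<Sum>k\<in>{s+1..<n}. expectation (\<lambda>\<omega>. condvar (aff u1 u0) (X k \<omega>))) / real n"
      using sm(2) by (simp add: score_def power_divide)
    also have "\<dots> \<le> (real n * B) / real n"
    proof (intro divide_right_mono)
      have "(\<Sum>k\<in>{s+1..<n}. expectation (\<lambda>\<omega>. condvar (aff u1 u0) (X k \<omega>))) \<le> real (card {s+1..<n}) * B"
        by (intro sum_bounded_above B)
      also have "\<dots> \<le> real n * B" using B0 by (intro mult_right_mono) auto
      finally show "(\<Sum>k\<in>{s+1..<n}. expectation (\<lambda>\<omega>. condvar (aff u1 u0) (X k \<omega>))) \<le> real n * B" .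
    qed simp
    also have "\<dots> = B" using n by simp
    finally show "expectation (\<lambda>\<omega>. (score (aff u1 u0) n \<omega>)^2) \<le> B" .
  qed measurable
qed

lemma const_over_sqrt_tendsto: "(\<lambda>n. c / sqrt (real n)) \<longlonglongrightarrow> 0"
proof -
  have "(\<lambda>n. c * sqrt (1 / real n)) \<longlonglongrightarrow> c * sqrt 0" by (intro tendsto_intros lim_const_over_n)
  then show ?thesis by (simp add: real_sqrt_divide)
qed

text \<open>The two differ by the increments with index below \<open>s - 1\<close>, a fixed finite
  sum, divided by \<open>sqrt n\<close>.\<close>

lemma fullscore_score: "to_zero_prob (\<lambda>n \<omega>. fullscore g n \<omega> - score g n \<omega>)"
proof (rule to_zero_prob_cong[where N="s + 1"])
  show "to_zero_prob (\<lambda>n \<omega>. (\<Sum>k<s - 1. incr g k \<omega>) / sqrt (real n))"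
    by (rule to_zero_prob_pointwise) (measurable, rule const_over_sqrt_tendsto)
  fix n \<omega> assume n: "s + 1 \<le> n"
  have e: "{..<n} - {s - 1, s} = {..<s - 1} \<union> {s+1..<n}" using n s by auto
  have "(\<Sum>k\<in>{..<n} - {s - 1, s}. incr g k \<omega>) = (\<Sum>k<s - 1. incr g k \<omega>) + (\<Sum>k\<in>{s+1..<n}. incr g k \<omega>)"
    unfolding e by (rule sum.union_disjoint) auto
  then show "(\<Sum>k<s - 1. incr g k \<omega>) / sqrt (real n) = fullscore g n \<omega> - score g n \<omega>"
    by (simp add: fullscore_def score_def add_divide_distrib)
qed measurable

lemma fullscore_stoch_bounded: "stoch_bounded (fullscore (aff u1 u0))"
  by (rule stoch_bounded_perturb[OF score_stoch_bounded fullscore_score]) measurable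

lemma fullscore_aff: "fullscore (aff u1 u0) n \<omega> = u1 * fullscore real n \<omega> + u0 * fullscore (\<lambda>_. 1) n \<omega>"
  by (simp add: fullscore_def incr_def sum.distrib sum_distrib_left add_divide_distrib algebra_simps del: inar.simps)

text \<open>Complex valued so as to multiply a characteristic exponential. The neighbours of time
  \<open>s\<close> are free of the outlier, hence states may replace observations.\<close>

definition pair_event :: "(nat \<times> nat) set \<Rightarrow> 'a \<Rightarrow> complex" where
  "pair_event E \<omega> = indicator E (X (s - 1) \<omega>, X (s + 1) \<omega>)"

text \<open>The event is a function of the history up to \<open>s + 1\<close>, where the martingale
  part begins, so the weighted limit theorem applies and the limit factorises.\<close>

lemma fullscore_clt:
  "(\<lambda>n. \<integral>\<omega>. pair_event E \<omega> * iexp (fullscore (aff u1 u0) n \<omega>) \<partial>M)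
     \<longlonglongrightarrow> (\<integral>\<omega>. pair_event E \<omega> \<partial>M) * complex_of_real (exp (- asym_var u1 u0 / 2))"
proof -
  define F :: "nat list \<Rightarrow> complex" where "F h = indicator E (h ! (s - 1), h ! (s + 1))" for h
  have F: "F (hist (s + 1) \<omega>) = pair_event E \<omega>" for \<omega>
    by (simp add: F_def pair_event_def nth_hist del: inar.simps)
  have nF: "norm (F h) \<le> 1" for h by (simp add: F_def indicator_def)
  have c: "(\<lambda>n. \<integral>\<omega>. pair_event E \<omega> * iexp (score (aff u1 u0) n \<omega>) \<partial>M)
     \<longlonglongrightarrow> (\<integral>\<omega>. pair_event E \<omega> \<partial>M) * complex_of_real (exp (- asym_var u1 u0 / 2))"
    using clt[of "aff u1 u0" F "s + 1", OF cubic_condvar_aff nF] unfolding F Epi_condvar_aff score_def .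
  show ?thesis
  proof (rule to_zero_prob_iexp[OF fullscore_score _ _ _ _ c])
    show "norm (pair_event E \<omega>) \<le> 1" for \<omega> by (simp add: pair_event_def indicator_def)
    show "pair_event E \<in> borel_measurable M"
    proof -
      have "(\<lambda>\<omega>. F (hist (s + 1) \<omega>)) \<in> borel_measurable M" by (rule measurable_compose[OF measurable_hist]) simp
      then show ?thesis unfolding F .
    qed
  qed measurable
qed

section \<open>From observed residuals to score increments\<close>

lemma sum_shift: "(\<Sum>k\<in>{1..n} - {s, s + 1}. f (k - 1)) = (\<Sum>k\<in>{..<n} - {s - 1, s}. f k)"
  by (rule sum.reindex_bij_witness[where i=Suc and j="\<lambda>k. k - 1"]) (use s in auto)

text \<open>Excluding both \<open>s\<close> and \<open>s + 1\<close> keeps \<open>k\<close> as well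
  as \<open>k - 1\<close> away from the outlier time. The form \<open>Suc (k - 1)\<close> matches
  the indices of \<open>incr\<close>.\<close>

lemma Y_clean:
  assumes "k \<in> {1..n} - {s, s + 1}"
  shows "Y (k - 1) \<omega> = real (X (k - 1) \<omega>)" "Y k \<omega> = real (X (Suc (k - 1)) \<omega>)"
  using assms s by (auto simp: Y_def simp del: inar.simps)

lemma Y_sum1: "(\<Sum>k\<in>{1..n} - {s, s + 1}. Y (k - 1) \<omega> * (Y k \<omega> - \<alpha> * Y (k - 1) \<omega> - \<mu>)) / sqrt (real n) = fullscore real n \<omega>"
proof -
  have "(\<Sum>k\<in>{1..n} - {s, s + 1}. Y (k - 1) \<omega> * (Y k \<omega> - \<alpha> * Y (k - 1) \<omega> - \<mu>)) = (\<Sum>k\<in>{1..n} - {s, s + 1}. incr real (k - 1) \<omega>)"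
    by (rule sum.cong[OF refl]) (simp only: Y_clean incr_def res_def)
  then show ?thesis by (simp only: sum_shift[of "\<lambda>k. incr real k \<omega>"] fullscore_def)
qed

lemma Y_sum0: "(\<Sum>k\<in>{1..n} - {s, s + 1}. Y k \<omega> - \<alpha> * Y (k - 1) \<omega> - \<mu>) / sqrt (real n) = fullscore (\<lambda>_. 1) n \<omega>"
proof -
  have "(\<Sum>k\<in>{1..n} - {s, s + 1}. Y k \<omega> - \<alpha> * Y (k - 1) \<omega> - \<mu>) = (\<Sum>k\<in>{1..n} - {s, s + 1}. incr (\<lambda>_. 1) (k - 1) \<omega>)"
    by (rule sum.cong[OF refl]) (simp only: Y_clean incr_def res_def mult_1_left)
  then show ?thesis by (simp only: sum_shift[of "\<lambda>k. incr (\<lambda>_. 1) k \<omega>"] fullscore_def)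
qed

lemma Y_power_sum: "(\<Sum>k\<in>{1..n} - {s, s + 1}. Y (k - 1) \<omega> ^ j) = (\<Sum>k\<in>{..<n} - {s - 1, s}. real (X k \<omega>) ^ j)"
proof -
  have "(\<Sum>k\<in>{1..n} - {s, s + 1}. Y (k - 1) \<omega> ^ j) = (\<Sum>k\<in>{1..n} - {s, s + 1}. real (X (k - 1) \<omega>) ^ j)"
    by (rule sum.cong[OF refl]) (simp only: Y_clean)
  then show ?thesis by (simp only: sum_shift[of "\<lambda>k. real (X k \<omega>) ^ j"])
qed

text \<open>The two deleted terms vanish after division by \<open>n\<close>, so the law of large
  numbers carries over. The case \<open>j = 0\<close> covers the proportion of regular
  residuals.\<close>

lemma power_mean_to_zero:
  assumes "j \<le> 3"
  shows "to_zero_prob (\<lambda>n \<omega>. (\<Sum>k\<in>{1..n} - {s, s + 1}. Y (k - 1) \<omega> ^ j) / real n - stat_mean (\<lambda>x. real x ^ j))"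
proof (rule to_zero_prob_cong[where N="s + 1"])
  have c: "cubic (\<lambda>x. real x ^ j)"
  proof -
    consider "j = 0" | "j = 1" | "j = 2" | "j = 3" using assms by linarith
    then show ?thesis
      using cubic_poly[of 0 0 0 1] cubic_poly[of 0 0 1 0] cubic_poly[of 0 1 0 0] cubic_poly[of 1 0 0 0] by cases auto
  qed
  have 1: "to_zero_prob (\<lambda>n \<omega>. (\<Sum>k<n. real (X k \<omega>) ^ j) / real n - stat_mean (\<lambda>x. real x ^ j))"
    by (rule to_zero_probI_L1[OF _ lln[OF c]]) (use integrable_cubic_X[OF c] in simp)
  have 2: "to_zero_prob (\<lambda>n \<omega>. (- (real (X (s - 1) \<omega>) ^ j + real (X s \<omega>) ^ j)) / real n)"
    by (rule to_zero_prob_pointwise) (measurable, rule lim_const_over_n)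
  show "to_zero_prob (\<lambda>n \<omega>. ((\<Sum>k<n. real (X k \<omega>) ^ j) / real n - stat_mean (\<lambda>x. real x ^ j)) + (- (real (X (s - 1) \<omega>) ^ j + real (X s \<omega>) ^ j)) / real n)"
    by (rule to_zero_prob_add[OF 1 2])
  fix n \<omega> assume n: "s + 1 \<le> n"
  have "(\<Sum>k\<in>{..<n} - {s - 1, s}. real (X k \<omega>) ^ j) = (\<Sum>k<n. real (X k \<omega>) ^ j) - (\<Sum>k\<in>{s - 1, s}. real (X k \<omega>) ^ j)"
    by (rule sum_diff) (use n s in auto)
  also have "(\<Sum>k\<in>{s - 1, s}. real (X k \<omega>) ^ j) = real (X (s - 1) \<omega>) ^ j + real (X s \<omega>) ^ j"
    using s by (subst sum.insert) auto
  finally show "((\<Sum>k<n. real (X k \<omega>) ^ j) / real n - stat_mean (\<lambda>x. real x ^ j)) + (- (real (X (s - 1) \<omega>) ^ j + real (X s \<omega>) ^ j)) / real n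
    = (\<Sum>k\<in>{1..n} - {s, s + 1}. Y (k - 1) \<omega> ^ j) / real n - stat_mean (\<lambda>x. real x ^ j)"
    unfolding Y_power_sum by (simp add: diff_divide_distrib add_divide_distrib)
next
  show "(\<lambda>\<omega>. (\<Sum>k\<in>{1..n} - {s, s + 1}. Y (k - 1) \<omega> ^ j) / real n - stat_mean (\<lambda>x. real x ^ j)) \<in> borel_measurable M" for n
    unfolding Y_power_sum by measurable
qed

text \<open>For small \<open>n\<close> the objective still reads the observation at
  \<open>s + 1\<close>; hence the maximum.\<close>

lemma cls_Q_cong:
  assumes "\<And>k. k \<le> max n (s + 1) \<Longrightarrow> y k = y' k"
  shows "cls_Q n s y = cls_Q n s y'"
proof (rule ext)
  fix p :: "real \<times> real \<times> real"
  obtain a m t where p: "p = (a, m, t)" by (cases p) auto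
  have "(\<Sum>k\<in>{1..n} - {s, s+1}. (y k - a * y (k-1) - m)^2) = (\<Sum>k\<in>{1..n} - {s, s+1}. (y' k - a * y' (k-1) - m)^2)"
    by (intro sum.cong refl) (use assms in auto)
  then show "cls_Q n s y p = cls_Q n s y' p"
    using assms[of s] assms[of "s - 1"] assms[of "s + 1"] by (simp add: cls_Q_def p)
qed

text \<open>The estimator is a function of a finite history in a countable type, so measurability of
  the minimiser and of its default branch is automatic.\<close>

lemma measurable_est: "est n \<in> measurable M cs"
proof -
  define u where "u h = cls_est n s (\<lambda>k. real (h ! k) + (if k = s then real \<theta> else 0))" for h :: "nat list"
  have "est n \<omega> = u (hist (max n (s + 1)) \<omega>)" for \<omega>
  proof -
    have "cls_Q n s (\<lambda>k. Y k \<omega>) = cls_Q n s (\<lambda>k. real (hist (max n (s + 1)) \<omega> ! k) + (if k = s then real \<theta> else 0))"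
      by (rule cls_Q_cong) (simp add: Y_def nth_hist del: inar.simps)
    then show ?thesis by (simp add: est_def u_def cls_est_def)
  qed
  then show ?thesis using measurable_of_hist[of u "max n (s + 1)"] by (simp cong: measurable_cong)
qed

lemma measurable_est_components [measurable]:
  "(\<lambda>\<omega>. fst (est n \<omega>)) \<in> borel_measurable M" "(\<lambda>\<omega>. fst (snd (est n \<omega>))) \<in> borel_measurable M" "(\<lambda>\<omega>. snd (snd (est n \<omega>))) \<in> borel_measurable M"
  by (rule measurable_compose[OF measurable_est], simp)+

end

section \<open>Asymptotics of the estimators\<close>

lemma mat2_mult_vec: "(mat2 a b c d *v t) $ 1 = a * t $ 1 + b * t $ 2" "(mat2 a b c d *v t) $ 2 = c * t $ 1 + d * t $ 2"
  by (simp_all add: mat2_def matrix_vector_mult_def sum_2)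

lemma mat2_inverse:
  assumes "a * d - b * c \<noteq> 0"
  shows "matrix_inv (mat2 a b c d) = mat2 (d / (a * d - b * c)) (- b / (a * d - b * c)) (- c / (a * d - b * c)) (a / (a * d - b * c))"
proof -
  define D where "D = a * d - b * c"
  have D: "D \<noteq> 0" "a * d - b * c = D" using assms by (simp_all add: D_def)
  define A where "A = mat2 a b c d"
  define A' where "A' = mat2 (d / D) (- b / D) (- c / D) (a / D)"
  have q: "(a * d - b * c) / D = 1" "(d * a - b * c) / D = 1" "(a * d - c * b) / D = 1" "(d * a - c * b) / D = 1"
    unfolding mult.commute[of d a] mult.commute[of c b] D(2) using D(1) by simp_all
  have 1: "A ** A' = mat 1" and 2: "A' ** A = mat 1"
    using q by (simp_all add: A_def A'_def mat2_def matrix_matrix_mult_def vec_eq_iff forall_2 sum_2 mat_def diff_divide_distrib mult.commute)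
  have "A ** matrix_inv A = mat 1"
    \<comment> \<open>\<open>matrix_inv\<close> is defined by choice; multiplying by the explicit
      inverse from the left shows that the two agree.\<close>
    unfolding matrix_inv_def by (rule someI2[of _ A']) (use 1 2 in auto)
  then have "A' ** (A ** matrix_inv A) = A'" by simp
  then have "matrix_inv A = A'" unfolding matrix_mul_assoc 2 by simp
  then show ?thesis by (simp add: A_def A'_def D_def)
qed

lemma inner_vec2: "(t :: real^2) \<bullet> x = t $ 1 * x $ 1 + t $ 2 * x $ 2"
  by (simp add: inner_vec_def sum_2)

lemma (in prob_space) integral_uniform_measure_complex:
  fixes f :: "'a \<Rightarrow> complex"
  assumes A: "A \<in> sets M" "0 < prob A" and f: "f \<in> borel_measurable M"
  shows "(\<integral>x. f x \<partial>uniform_measure M A) = (\<integral>x. indicator A x * f x \<partial>M) / complex_of_real (prob A)"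
proof -
  have "(indicator A x / emeasure M A :: ennreal) = ennreal (indicat_real A x / prob A)" for x
    using A(2) divide_ennreal[of 1 "prob A"] by (auto simp: emeasure_eq_measure indicator_def)
  then have "uniform_measure M A = density M (\<lambda>x. ennreal (indicat_real A x / prob A))"
    by (simp add: uniform_measure_def)
  then have "(\<integral>x. f x \<partial>uniform_measure M A) = (\<integral>x. (indicat_real A x / prob A) *\<^sub>R f x \<partial>M)"
    using f A by (simp add: integral_density)
  also have "\<dots> = (\<integral>x. (indicator A x * f x) / complex_of_real (prob A) \<partial>M)"
    by (intro Bochner_Integration.integral_cong) (auto simp: indicator_def scaleR_conv_of_real)
  finally show ?thesis by simp
qed

context inar_outlier begin

definition "disc = l2 - l1^2"
text \<open>\<open>lim1\<close> and \<open>lim0\<close> are the components of the inverse of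
  \<open>inar_S\<close> applied to the score vector, and \<open>disc\<close> is the determinant of
  \<open>inar_S\<close>.\<close>

definition "lim1 n \<omega> = fullscore (aff (1 / disc) (- l1 / disc)) n \<omega>"
definition "lim0 n \<omega> = fullscore (aff (- l1 / disc) (l2 / disc)) n \<omega>"
definition "err1 n \<omega> = sqrt (real n) * (fst (est n \<omega>) - \<alpha>)"
definition "err0 n \<omega> = sqrt (real n) * (fst (snd (est n \<omega>)) - \<mu>)"

lemma disc_pos: "0 < disc" unfolding disc_def by (rule variance_pi_pos)

text \<open>The third condition is an exact equation. It holds for a genuine minimiser and may fail
  for the default value, so it has to be part of the event.\<close>

definition good :: "real \<Rightarrow> nat \<Rightarrow> 'a \<Rightarrow> bool" where
  "good e n \<omega> \<longleftrightarrow> \<bar>err1 n \<omega> - lim1 n \<omega>\<bar> \<le> e \<and> \<bar>err0 n \<omega> - lim0 n \<omega>\<bar> \<le> e \<and>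
     snd (snd (est n \<omega>)) = Y s \<omega> - (fst (est n \<omega>) * (Y (s - 1) \<omega> + Y (s + 1) \<omega>) + (1 - fst (est n \<omega>)) * fst (snd (est n \<omega>))) / (1 + (fst (est n \<omega>))^2)"

lemma measurable_err [measurable]: "err1 n \<in> borel_measurable M" "err0 n \<in> borel_measurable M" "lim1 n \<in> borel_measurable M" "lim0 n \<in> borel_measurable M"
  unfolding err1_def[abs_def] err0_def[abs_def] lim1_def[abs_def] lim0_def[abs_def] by measurable

lemma measurable_Y [measurable]: "Y k \<in> borel_measurable M"
  unfolding Y_def[abs_def] by measurable

lemma measurable_good [measurable]: "Measurable.pred M (good e n)"
proof -
  define r where "r \<omega> = snd (snd (est n \<omega>)) - (Y s \<omega> - (fst (est n \<omega>) * (Y (s - 1) \<omega> + Y (s + 1) \<omega>) + (1 - fst (est n \<omega>)) * fst (snd (est n \<omega>))) / (1 + (fst (est n \<omega>))^2))" for \<omega>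
  have "r \<in> borel_measurable M" unfolding r_def[abs_def]
    by (intro borel_measurable_diff borel_measurable_add borel_measurable_divide borel_measurable_times borel_measurable_power
        measurable_est_components measurable_Y borel_measurable_const)
  moreover have "good e n = (\<lambda>\<omega>. \<bar>err1 n \<omega> - lim1 n \<omega>\<bar> \<le> e \<and> \<bar>err0 n \<omega> - lim0 n \<omega>\<bar> \<le> e \<and> \<bar>r \<omega>\<bar> \<le> 0)"
    by (auto simp: good_def r_def fun_eq_iff)
  ultimately show ?thesis by simp
qed

lemma real_of_X_tail: "\<exists>b. prob {\<omega>\<in>space M. real b < \<bar>real (X k \<omega>)\<bar>} \<le> e" if e: "0 < e"
proof -
  have i: "integrable M (\<lambda>\<omega>. real (X k \<omega>))"
    using integrable_power_le3[OF integrable_law3[OF p03, of k], of 1] by (simp add: integrable_X)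
  define m where "m = expectation (\<lambda>\<omega>. \<bar>real (X k \<omega>)\<bar>)"
  obtain b where b: "m / e < real b" using reals_Archimedean2 by blast
  have m0: "0 \<le> m" unfolding m_def by (rule integral_nonneg_AE) simp
  have b0: "0 < real b" using b m0 e by (metis divide_nonneg_pos order_le_less_trans)
  have "prob {\<omega>\<in>space M. real b < \<bar>real (X k \<omega>)\<bar>} \<le> m / real b"
    unfolding m_def by (rule prob_abs_gt_le[OF i b0])
  also have "\<dots> \<le> e" using b b0 e by (simp add: field_simps less_imp_le)
  finally show ?thesis by blast
qed

text \<open>The thresholds of the deterministic theorem vary with the two neighbouring states.
  Confining those to finite ranges costs probability at most \<open>d / 4\<close> and leaves
  finitely many thresholds, of which the worst is taken.\<close>

lemma bad_prob_tendsto: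
  assumes e: "0 < e"
  shows "(\<lambda>n. prob {\<omega>\<in>space M. \<not> good e n \<omega>}) \<longlonglongrightarrow> 0"
proof (rule LIMSEQ_I)
  fix d :: real assume d: "0 < d"
  then have d8: "0 < d / 8" by simp
  have "stoch_bounded (fullscore real)" "stoch_bounded (fullscore (\<lambda>_. 1))"
    using fullscore_stoch_bounded[of 1 0] fullscore_stoch_bounded[of 0 1] by simp_all
  then obtain K1 K0 where K: "0 \<le> K1" "\<forall>\<^sub>F n in sequentially. prob {\<omega>\<in>space M. K1 < \<bar>fullscore real n \<omega>\<bar>} \<le> d / 8"
    "0 \<le> K0" "\<forall>\<^sub>F n in sequentially. prob {\<omega>\<in>space M. K0 < \<bar>fullscore (\<lambda>_. 1) n \<omega>\<bar>} \<le> d / 8"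
    unfolding stoch_bounded_def using d8 by meson
  define K where "K = max K1 K0"
  have K0: "0 \<le> K" using K by (simp add: K_def)
  obtain b1 where b1: "prob {\<omega>\<in>space M. real b1 < \<bar>real (X (s - 1) \<omega>)\<bar>} \<le> d / 8"
    using real_of_X_tail[OF d8, of "s - 1"] by blast
  obtain b2 where b2: "prob {\<omega>\<in>space M. real b2 < \<bar>real (X (s + 1) \<omega>)\<bar>} \<le> d / 8"
    using real_of_X_tail[OF d8, of "s + 1"] by blast
  define Q where "Q \<eta> n p \<longleftrightarrow> (\<forall>y. y (s - 1) = real (fst p) \<longrightarrow> y (s + 1) = real (snd p) \<longrightarrow>
    \<bar>(\<Sum>k\<in>{1..n} - {s, s + 1}. y (k - 1) ^ 2) / real n - l2\<bar> \<le> \<eta> \<longrightarrow>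
    \<bar>(\<Sum>k\<in>{1..n} - {s, s + 1}. y (k - 1)) / real n - l1\<bar> \<le> \<eta> \<longrightarrow>
    \<bar>real (card ({1..n} - {s, s + 1})) / real n - 1\<bar> \<le> \<eta> \<longrightarrow>
    \<bar>(\<Sum>k\<in>{1..n} - {s, s + 1}. y (k - 1) * (y k - \<alpha> * y (k - 1) - \<mu>)) / sqrt (real n)\<bar> \<le> K \<longrightarrow>
    \<bar>(\<Sum>k\<in>{1..n} - {s, s + 1}. y k - \<alpha> * y (k - 1) - \<mu>) / sqrt (real n)\<bar> \<le> K \<longrightarrow>
    (let e' = cls_est n s y; \<sigma>1 = (\<Sum>k\<in>{1..n} - {s, s + 1}. y (k - 1) * (y k - \<alpha> * y (k - 1) - \<mu>)) / sqrt (real n);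
         \<sigma>0 = (\<Sum>k\<in>{1..n} - {s, s + 1}. y k - \<alpha> * y (k - 1) - \<mu>) / sqrt (real n)
     in \<bar>sqrt (real n) * (fst e' - \<alpha>) - (\<sigma>1 - l1 * \<sigma>0) / (l2 - l1^2)\<bar> \<le> e \<and>
        \<bar>sqrt (real n) * (fst (snd e') - \<mu>) - (l2 * \<sigma>0 - l1 * \<sigma>1) / (l2 - l1^2)\<bar> \<le> e \<and>
        snd (snd e') = y s - (fst e' * (real (fst p) + real (snd p)) + (1 - fst e') * fst (snd e')) / (1 + (fst e')^2)))" for \<eta> n p
  have ex: "\<exists>\<eta>>0. \<exists>n0. \<forall>n\<ge>n0. Q \<eta> n p" for p
    unfolding Q_def using cls_est_deterministic[OF variance_pi_pos e K0, of "real (fst p)" "real (snd p)" \<alpha> \<mu>] s by blast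
  have mono: "Q \<eta> n p" if "Q \<eta>' n p" "\<eta> \<le> \<eta>'" for \<eta> \<eta>' n p
    using that(1) unfolding Q_def using that(2) by (meson order_trans)
  \<comment> \<open>The property passes to smaller \<open>\<eta>\<close>, so a minimum of the
    tolerances and a maximum of the indices serve a finite set of pairs.\<close>
  have fin: "\<exists>\<eta>>0. \<exists>n0. \<forall>n\<ge>n0. \<forall>p\<in>S. Q \<eta> n p" if "finite S" for S
    using that
  proof (induction rule: finite_induct)
    case empty then show ?case by (intro exI[of _ 1]) auto
  next
    case (insert p S)
    obtain \<eta> n0 where 1: "0 < \<eta>" "\<And>n p. n0 \<le> n \<Longrightarrow> p \<in> S \<Longrightarrow> Q \<eta> n p" using insert.IH by blast
    obtain \<eta>' n0' where 2: "0 < \<eta>'" "\<And>n. n0' \<le> n \<Longrightarrow> Q \<eta>' n p" using ex[of p] by blast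
    have "Q (min \<eta> \<eta>') n q" if "max n0 n0' \<le> n" "q \<in> insert p S" for n q
    proof (cases "q = p")
      case True then show ?thesis using mono[OF 2(2)[of n]] that by simp
    next
      case False then show ?thesis using mono[OF 1(2)[of n q]] that by simp
    qed
    then show ?case using 1(1) 2(1) by (intro exI[of _ "min \<eta> \<eta>'"] conjI exI[of _ "max n0 n0'"]) auto
  qed
  have "\<exists>\<eta>>0. \<exists>n0. \<forall>n\<ge>n0. \<forall>p\<in>{..b1} \<times> {..b2}. Q \<eta> n p" by (rule fin) simp
  then obtain \<eta> n0 where \<eta>: "0 < \<eta>" and Q': "\<forall>n\<ge>n0. \<forall>p\<in>{..b1} \<times> {..b2}. Q \<eta> n p" by blast
  have Q: "Q \<eta> n (m1, m2)" if "n0 \<le> n" "m1 \<le> b1" "m2 \<le> b2" for n m1 m2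
    using Q' that by blast
  define Z where "Z j n \<omega> = (\<Sum>k\<in>{1..n} - {s, s + 1}. Y (k - 1) \<omega> ^ j) / real n - stat_mean (\<lambda>x. real x ^ j)" for j n \<omega>
  have Zm [measurable]: "Z j n \<in> borel_measurable M" if "j \<le> 3" for j n
    using power_mean_to_zero[OF that] by (simp add: to_zero_prob_def Z_def[abs_def])
  have Z: "\<forall>\<^sub>F n in sequentially. prob {\<omega>\<in>space M. \<eta> < \<bar>Z j n \<omega>\<bar>} < d / 8" if "j \<le> 3" for j
    using order_tendstoD(2)[OF to_zero_probD[OF power_mean_to_zero[OF that] \<eta>] d8] by (simp add: Z_def)
  have "\<forall>\<^sub>F n in sequentially. prob {\<omega>\<in>space M. \<not> good e n \<omega>} < d"
    using K(2) K(4) Z[of 0, simplified] Z[of 1, simplified] Z[of 2, simplified] eventually_ge_at_top[of n0]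
  proof eventually_elim
    case (elim n)
    \<comment> \<open>Seven exceptional events of probability at most \<open>d / 8\<close> each, so
      the total stays strictly below \<open>d\<close>.\<close>
    define B where "B = [{\<omega>\<in>space M. K1 < \<bar>fullscore real n \<omega>\<bar>}, {\<omega>\<in>space M. K0 < \<bar>fullscore (\<lambda>_. 1) n \<omega>\<bar>}, {\<omega>\<in>space M. \<eta> < \<bar>Z 0 n \<omega>\<bar>},
      {\<omega>\<in>space M. \<eta> < \<bar>Z 1 n \<omega>\<bar>}, {\<omega>\<in>space M. \<eta> < \<bar>Z 2 n \<omega>\<bar>}, {\<omega>\<in>space M. real b1 < \<bar>real (X (s - 1) \<omega>)\<bar>}, {\<omega>\<in>space M. real b2 < \<bar>real (X (s + 1) \<omega>)\<bar>}]"
    have un: "prob (\<Union> (set L)) \<le> (\<Sum>A\<leftarrow>L. prob A)" if "set L \<subseteq> sets M" for L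
      using that
    proof (induction L)
      case (Cons A L)
      have "\<Union> (set L) \<in> sets M" using Cons.prems by (intro sets.finite_Union) auto
      then have "prob (A \<union> \<Union> (set L)) \<le> prob A + prob (\<Union> (set L))" using Cons.prems by (intro measure_Un_le) auto
      then show ?case using Cons by simp
    qed simp
    have sB: "set B \<subseteq> sets M" unfolding B_def using Zm[of 0 n] Zm[of 1 n] Zm[of 2 n] by (simp del: inar.simps)
    have "{\<omega>\<in>space M. \<not> good e n \<omega>} \<subseteq> \<Union> (set B)"
    proof
      fix \<omega> assume w: "\<omega> \<in> {\<omega>\<in>space M. \<not> good e n \<omega>}"
      show "\<omega> \<in> \<Union> (set B)"
      proof (rule ccontr)
        assume "\<omega> \<notin> \<Union> (set B)"
        then have h: "\<bar>fullscore real n \<omega>\<bar> \<le> K" "\<bar>fullscore (\<lambda>_. 1) n \<omega>\<bar> \<le> K" "\<bar>Z 0 n \<omega>\<bar> \<le> \<eta>" "\<bar>Z 1 n \<omega>\<bar> \<le> \<eta>" "\<bar>Z 2 n \<omega>\<bar> \<le> \<eta>"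
          "X (s - 1) \<omega> \<le> b1" "X (s + 1) \<omega> \<le> b2"
          using w unfolding B_def K_def by (auto simp: not_less simp del: inar.simps)
        have z0: "Z 0 n \<omega> = real (card ({1..n} - {s, s + 1})) / real n - 1" by (simp add: Z_def)
        have z1: "Z 1 n \<omega> = (\<Sum>k\<in>{1..n} - {s, s + 1}. Y (k - 1) \<omega>) / real n - l1" by (simp add: Z_def stat_law_moments)
        have z2: "Z 2 n \<omega> = (\<Sum>k\<in>{1..n} - {s, s + 1}. Y (k - 1) \<omega> ^ 2) / real n - l2" by (simp add: Z_def stat_law_moments)
        have Ys: "Y (s - 1) \<omega> = real (fst (X (s - 1) \<omega>, X (s + 1) \<omega>))" "Y (s + 1) \<omega> = real (snd (X (s - 1) \<omega>, X (s + 1) \<omega>))"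
          using s by (simp_all add: Y_def del: inar.simps)
        have "good e n \<omega>"
          using Q[OF elim(6) h(6,7), unfolded Q_def, rule_format, of "\<lambda>k. Y k \<omega>", OF Ys h(5)[unfolded z2] h(4)[unfolded z1] h(3)[unfolded z0]
              h(1)[folded Y_sum1] h(2)[folded Y_sum0]]
          unfolding Let_def Y_sum1 Y_sum0 Ys[symmetric] est_def[symmetric] good_def err1_def err0_def lim1_def lim0_def
            fullscore_aff disc_def[symmetric]
          by (simp add: diff_divide_distrib)
        then show False using w by simp
      qed
    qed
    then have "prob {\<omega>\<in>space M. \<not> good e n \<omega>} \<le> prob (\<Union> (set B))"
      by (rule finite_measure_mono) (use sB in \<open>intro sets.finite_Union; auto\<close>)
    also have "\<dots> \<le> (\<Sum>A\<leftarrow>B. prob A)" by (rule un[OF sB])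
    also have "\<dots> < d" using elim b1 b2 d unfolding B_def by (simp del: inar.simps)
    finally show ?case .
  qed
  then show "\<exists>no. \<forall>n\<ge>no. norm (prob {\<omega>\<in>space M. \<not> good e n \<omega>} - 0) < d" by (simp add: eventually_sequentially)
qed

lemma err_lim: "to_zero_prob (\<lambda>n \<omega>. err1 n \<omega> - lim1 n \<omega>)" "to_zero_prob (\<lambda>n \<omega>. err0 n \<omega> - lim0 n \<omega>)"
proof -
  have *: "(\<lambda>n. prob {\<omega>\<in>space M. e < \<bar>Z n \<omega>\<bar>}) \<longlonglongrightarrow> 0" if e: "0 < e" and Z: "\<And>n \<omega>. good e n \<omega> \<Longrightarrow> \<bar>Z n \<omega>\<bar> \<le> e" for e and Z :: "nat \<Rightarrow> 'a \<Rightarrow> real"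
  proof (rule Lim_null_comparison[OF _ bad_prob_tendsto[OF e]])
    show "\<forall>\<^sub>F n in sequentially. norm (prob {\<omega>\<in>space M. e < \<bar>Z n \<omega>\<bar>}) \<le> prob {\<omega>\<in>space M. \<not> good e n \<omega>}"
    proof (rule always_eventually, rule allI)
      fix n
      have "{\<omega>\<in>space M. e < \<bar>Z n \<omega>\<bar>} \<subseteq> {\<omega>\<in>space M. \<not> good e n \<omega>}" using Z by (auto simp: not_le[symmetric])
      then show "norm (prob {\<omega>\<in>space M. e < \<bar>Z n \<omega>\<bar>}) \<le> prob {\<omega>\<in>space M. \<not> good e n \<omega>}" by (simp add: finite_measure_mono)
    qed
  qed
  show "to_zero_prob (\<lambda>n \<omega>. err1 n \<omega> - lim1 n \<omega>)" "to_zero_prob (\<lambda>n \<omega>. err0 n \<omega> - lim0 n \<omega>)"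
    unfolding to_zero_prob_def by (auto intro!: * simp: good_def)
qed

lemma err_stoch_bounded: "stoch_bounded err1" "stoch_bounded err0"
proof -
  have "stoch_bounded lim1" "stoch_bounded lim0"
    unfolding lim1_def[abs_def] lim0_def[abs_def] by (rule fullscore_stoch_bounded)+
  then show "stoch_bounded err1" "stoch_bounded err0"
    by (auto intro: stoch_bounded_perturb err_lim)
qed

lemma pair_event_bound: "norm (pair_event E \<omega>) \<le> 1" by (simp add: pair_event_def indicator_def)

lemma measurable_pair_event [measurable]: "pair_event E \<in> borel_measurable M"
proof -
  have "(\<lambda>\<omega>. (\<lambda>h. indicator E (h ! (s - 1), h ! (s + 1)) :: complex) (hist (s + 1) \<omega>)) \<in> borel_measurable M"
    by (rule measurable_compose[OF measurable_hist]) simp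
  then show ?thesis by (simp add: pair_event_def[abs_def] nth_hist del: inar.simps)
qed

text \<open>The quadratic form of \<open>inar_B\<close>: the score form evaluated at the inverse of
  \<open>inar_S\<close> applied to the vector \<open>(t1, t0)\<close>.\<close>

definition err_var :: "real \<Rightarrow> real \<Rightarrow> real" where
  "err_var t1 t0 = asym_var ((t1 - l1 * t0) / disc) ((l2 * t0 - l1 * t1) / disc)"

text \<open>Cramer-Wold: a linear combination of the two errors is, up to a vanishing term, one
  score with an affine factor, for which the scalar limit theorem suffices.\<close>

lemma err_clt:
  "(\<lambda>n. \<integral>\<omega>. pair_event E \<omega> * iexp (t1 * err1 n \<omega> + t0 * err0 n \<omega>) \<partial>M)
     \<longlonglongrightarrow> (\<integral>\<omega>. pair_event E \<omega> \<partial>M) * complex_of_real (exp (- err_var t1 t0 / 2))"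
proof (rule to_zero_prob_iexp[OF _ pair_event_bound measurable_pair_event])
  have l: "t1 * lim1 n \<omega> + t0 * lim0 n \<omega> = fullscore (aff ((t1 - l1 * t0) / disc) ((l2 * t0 - l1 * t1) / disc)) n \<omega>" for n \<omega>
    unfolding lim1_def lim0_def fullscore_aff by (simp add: diff_divide_distrib algebra_simps)
  show "(\<lambda>n. \<integral>\<omega>. pair_event E \<omega> * iexp (t1 * lim1 n \<omega> + t0 * lim0 n \<omega>) \<partial>M) \<longlonglongrightarrow> (\<integral>\<omega>. pair_event E \<omega> \<partial>M) * complex_of_real (exp (- err_var t1 t0 / 2))"
    unfolding l err_var_def by (rule fullscore_clt)
  have "to_zero_prob (\<lambda>n \<omega>. t1 * (err1 n \<omega> - lim1 n \<omega>) + t0 * (err0 n \<omega> - lim0 n \<omega>))"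
    by (intro to_zero_prob_add to_zero_prob_cmult err_lim)
  then show "to_zero_prob (\<lambda>n \<omega>. (t1 * err1 n \<omega> + t0 * err0 n \<omega>) - (t1 * lim1 n \<omega> + t0 * lim0 n \<omega>))"
    by (simp add: algebra_simps)
qed measurable

text \<open>The size estimator minus the observation at \<open>s\<close>, as a function of the two
  other estimates; \<open>c\<close> is the sum of the neighbours. \<open>dcoef1 c\<close> and
  \<open>dcoef0\<close> are its partial derivatives at the true parameters, the entries of the
  vector \<open>d\<close> in the claim.\<close>

definition sizefun :: "real \<Rightarrow> real \<times> real \<Rightarrow> real" where
  "sizefun c z = - (fst z * c + (1 - fst z) * snd z) / (1 + (fst z)^2)"

definition dcoef1 :: "real \<Rightarrow> real" where "dcoef1 c = ((\<alpha>^2 - 1) * c + (2 * \<alpha> + 1 - \<alpha>^2) * \<mu>) / (1 + \<alpha>^2)^2"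
definition dcoef0 :: real where "dcoef0 = - (1 + \<alpha>^2) * (1 - \<alpha>) / (1 + \<alpha>^2)^2"

lemma sizefun_derivative: "(sizefun c has_derivative (\<lambda>z. dcoef1 c * fst z + dcoef0 * snd z)) (at (\<alpha>, \<mu>))"
proof -
  define D where "D = 1 + \<alpha>^2"
  have D: "D \<noteq> 0" unfolding D_def by simp
  have "(sizefun c has_derivative (\<lambda>z. (- (fst z * c + (- fst z) * \<mu> + (1 - \<alpha>) * snd z)) / D
      + (\<alpha> * c + (1 - \<alpha>) * \<mu>) * (2 * \<alpha> * fst z) / D^2)) (at (\<alpha>, \<mu>))"
  proof -
    have "(sizefun c has_derivative (\<lambda>h. - (- (fst (\<alpha>, \<mu>) * c + (1 - fst (\<alpha>, \<mu>)) * snd (\<alpha>, \<mu>))) *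
          (inverse (1 + (fst (\<alpha>, \<mu>))\<^sup>2) * (0 + real 2 * fst h * fst (\<alpha>, \<mu>) ^ (2 - 1)) * inverse (1 + (fst (\<alpha>, \<mu>))\<^sup>2)) +
          - (fst h * c + ((1 - fst (\<alpha>, \<mu>)) * snd h + (0 - fst h) * snd (\<alpha>, \<mu>))) / (1 + (fst (\<alpha>, \<mu>))\<^sup>2))) (at (\<alpha>, \<mu>))"
      unfolding sizefun_def[abs_def] by (rule derivative_eq_intros refl one_plus_square_nz)+
    then show ?thesis unfolding fst_conv snd_conv D_def[symmetric]
      by (rule has_derivative_eq_rhs) (simp add: fun_eq_iff divide_inverse power2_eq_square algebra_simps)
  qed
  moreover have "(- (x * c + (- x) * \<mu> + (1 - \<alpha>) * z)) / D + (\<alpha> * c + (1 - \<alpha>) * \<mu>) * (2 * \<alpha> * x) / D^2 = dcoef1 c * x + dcoef0 * z" for x z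
  proof -
    have "(- (x * c + (- x) * \<mu> + (1 - \<alpha>) * z)) / D = (- (x * c + (- x) * \<mu> + (1 - \<alpha>) * z)) * D / D^2"
      using D by (simp add: power2_eq_square)
    then have "(- (x * c + (- x) * \<mu> + (1 - \<alpha>) * z)) / D + (\<alpha> * c + (1 - \<alpha>) * \<mu>) * (2 * \<alpha> * x) / D^2
      = ((- (x * c + (- x) * \<mu> + (1 - \<alpha>) * z)) * D + (\<alpha> * c + (1 - \<alpha>) * \<mu>) * (2 * \<alpha> * x)) / D^2"
      by (simp add: add_divide_distrib)
    also have "(- (x * c + (- x) * \<mu> + (1 - \<alpha>) * z)) * D + (\<alpha> * c + (1 - \<alpha>) * \<mu>) * (2 * \<alpha> * x)
      = ((\<alpha>^2 - 1) * c + (2 * \<alpha> + 1 - \<alpha>^2) * \<mu>) * x + (- (1 + \<alpha>^2) * (1 - \<alpha>)) * z"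
      unfolding D_def by (simp add: algebra_simps power2_eq_square)
    also have "\<dots> / D^2 = dcoef1 c * x + dcoef0 * z"
      unfolding dcoef1_def dcoef0_def D_def[symmetric] by (simp only: add_divide_distrib[where c="D^2" and b="- D * (1 - \<alpha>) * z"] times_divide_eq_left)
    finally show ?thesis .
  qed
  ultimately show ?thesis by simp
qed

definition size_err :: "nat \<Rightarrow> 'a \<Rightarrow> real" where
  "size_err n \<omega> = sqrt (real n) * (snd (snd (est n \<omega>)) - (Y s \<omega> - \<alpha> / (1 + \<alpha>^2) * (Y (s - 1) \<omega> + Y (s + 1) \<omega>) - (1 - \<alpha>) / (1 + \<alpha>^2) * \<mu>))"

lemma measurable_size_err [measurable]: "size_err n \<in> borel_measurable M"
  unfolding size_err_def[abs_def] by measurable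

text \<open>Delta method on the event that the neighbours take the values \<open>m1\<close> and
  \<open>m2\<close>. Off this event the \<open>if\<close> makes the difference 0, so convergence in
  probability can be stated without changing the measure.\<close>

lemma size_err_linear:
  fixes m1 m2 :: nat
  defines "c \<equiv> real m1 + real m2"
  defines "lin \<equiv> (\<lambda>n \<omega>. dcoef1 c * err1 n \<omega> + dcoef0 * err0 n \<omega>)"
  shows "to_zero_prob (\<lambda>n \<omega>. (if X (s - 1) \<omega> = m1 \<and> X (s + 1) \<omega> = m2 then size_err n \<omega> else lin n \<omega>) - lin n \<omega>)"
  unfolding to_zero_prob_def
proof (intro conjI allI impI)
  have mE [measurable]: "Measurable.pred M (\<lambda>\<omega>. X (s - 1) \<omega> = m1 \<and> X (s + 1) \<omega> = m2)" by measurable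
  have ml [measurable]: "lin n \<in> borel_measurable M" for n unfolding lin_def by measurable
  show "(\<lambda>\<omega>. (if X (s - 1) \<omega> = m1 \<and> X (s + 1) \<omega> = m2 then size_err n \<omega> else lin n \<omega>) - lin n \<omega>) \<in> borel_measurable M" for n
    by measurable
  fix e :: real assume e: "0 < e"
  define Z where "Z n \<omega> = (if X (s - 1) \<omega> = m1 \<and> X (s + 1) \<omega> = m2 then size_err n \<omega> else lin n \<omega>) - lin n \<omega>" for n \<omega>
  have [measurable]: "Z n \<in> borel_measurable M" for n unfolding Z_def[abs_def] by measurable
  have "(\<lambda>n. prob {\<omega>\<in>space M. e < \<bar>Z n \<omega>\<bar>}) \<longlonglongrightarrow> 0"
  proof (rule LIMSEQ_I)
    fix d :: real assume d: "0 < d"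
    then have d4: "0 < d / 4" by simp
    obtain K1 K0 where K: "0 \<le> K1" "\<forall>\<^sub>F n in sequentially. prob {\<omega>\<in>space M. K1 < \<bar>err1 n \<omega>\<bar>} \<le> d / 4"
      "0 \<le> K0" "\<forall>\<^sub>F n in sequentially. prob {\<omega>\<in>space M. K0 < \<bar>err0 n \<omega>\<bar>} \<le> d / 4"
      using err_stoch_bounded d4 unfolding stoch_bounded_def by meson
    \<comment> \<open>Bounds the sum of both errors; the added 1 keeps it positive, so that
      \<open>e / K\<close> can serve as the accuracy of the linear approximation.\<close>
    define K where "K = K1 + K0 + 1"
    have Kp: "0 < K" using K by (simp add: K_def)
    have eK: "0 < e / K" using e Kp by simp
    obtain \<delta> where \<delta>: "0 < \<delta>" "\<And>z. norm (z - (\<alpha>, \<mu>)) < \<delta> \<Longrightarrow> norm (sizefun c z - sizefun c (\<alpha>, \<mu>) - (dcoef1 c * fst (z - (\<alpha>, \<mu>)) + dcoef0 * snd (z - (\<alpha>, \<mu>)))) \<le> e / K * norm (z - (\<alpha>, \<mu>))"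
      using sizefun_derivative[of c, unfolded has_derivative_at_alt] eK by blast
    have "\<forall>\<^sub>F n in sequentially. K / sqrt (real n) < \<delta>"
      by (rule order_tendstoD(2)[OF const_over_sqrt_tendsto \<delta>(1)])
    moreover have "\<forall>\<^sub>F n in sequentially. prob {\<omega>\<in>space M. \<not> good 1 n \<omega>} < d / 4"
      by (rule order_tendstoD(2)[OF bad_prob_tendsto d4]) simp
    ultimately have "\<forall>\<^sub>F n in sequentially. prob {\<omega>\<in>space M. e < \<bar>Z n \<omega>\<bar>} < d"
      using K(2) K(4) eventually_gt_at_top[of 0]
    proof eventually_elim
      case (elim n)
      have n: "0 < sqrt (real n)" using elim by simp
      have "\<bar>Z n \<omega>\<bar> \<le> e" if g: "good 1 n \<omega>" and k: "\<bar>err1 n \<omega>\<bar> \<le> K1" "\<bar>err0 n \<omega>\<bar> \<le> K0" for \<omega>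
      proof (cases "X (s - 1) \<omega> = m1 \<and> X (s + 1) \<omega> = m2")
        case True
        define z where "z = (fst (est n \<omega>), fst (snd (est n \<omega>)))"
        have zd: "z - (\<alpha>, \<mu>) = (err1 n \<omega> / sqrt (real n), err0 n \<omega> / sqrt (real n))"
          using n by (simp add: z_def err1_def err0_def)
        have "norm (z - (\<alpha>, \<mu>)) \<le> \<bar>err1 n \<omega> / sqrt (real n)\<bar> + \<bar>err0 n \<omega> / sqrt (real n)\<bar>"
          unfolding zd using norm_Pair_le[of "err1 n \<omega> / sqrt (real n)" "err0 n \<omega> / sqrt (real n)"] by simp
        also have "\<dots> = (\<bar>err1 n \<omega>\<bar> + \<bar>err0 n \<omega>\<bar>) / sqrt (real n)" using n by (simp add: abs_divide add_divide_distrib)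
        also have "\<dots> \<le> K / sqrt (real n)" using k n by (intro divide_right_mono) (auto simp: K_def)
        finally have nz: "norm (z - (\<alpha>, \<mu>)) \<le> K / sqrt (real n)" .
        have Yc: "Y (s - 1) \<omega> + Y (s + 1) \<omega> = c" using True s by (simp add: Y_def c_def del: inar.simps)
        have "size_err n \<omega> = sqrt (real n) * (sizefun c z - sizefun c (\<alpha>, \<mu>))"
        proof -
          have t: "snd (snd (est n \<omega>)) = Y s \<omega> - (fst (est n \<omega>) * c + (1 - fst (est n \<omega>)) * fst (snd (est n \<omega>))) / (1 + (fst (est n \<omega>))^2)"
            using g unfolding good_def Yc by blast
          have 1: "snd (snd (est n \<omega>)) = Y s \<omega> + sizefun c z" unfolding t by (simp add: sizefun_def z_def minus_divide_left)
          have 2: "\<alpha> / (1 + \<alpha>^2) * c + (1 - \<alpha>) / (1 + \<alpha>^2) * \<mu> = - sizefun c (\<alpha>, \<mu>)"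
            by (simp add: sizefun_def add_divide_distrib minus_divide_left)
          show ?thesis unfolding size_err_def Yc 1 using 2 by (simp add: algebra_simps)
        qed
        moreover have "lin n \<omega> = sqrt (real n) * (dcoef1 c * fst (z - (\<alpha>, \<mu>)) + dcoef0 * snd (z - (\<alpha>, \<mu>)))"
          unfolding zd lin_def using n by (simp add: distrib_left)
        ultimately have "Z n \<omega> = sqrt (real n) * (sizefun c z - sizefun c (\<alpha>, \<mu>) - (dcoef1 c * fst (z - (\<alpha>, \<mu>)) + dcoef0 * snd (z - (\<alpha>, \<mu>))))"
          using True by (simp add: Z_def right_diff_distrib)
        then have "\<bar>Z n \<omega>\<bar> = sqrt (real n) * norm (sizefun c z - sizefun c (\<alpha>, \<mu>) - (dcoef1 c * fst (z - (\<alpha>, \<mu>)) + dcoef0 * snd (z - (\<alpha>, \<mu>))))"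
          using n by (simp add: abs_mult)
        also have "\<dots> \<le> sqrt (real n) * (e / K * (K / sqrt (real n)))"
        proof (rule mult_left_mono)
          have "norm (sizefun c z - sizefun c (\<alpha>, \<mu>) - (dcoef1 c * fst (z - (\<alpha>, \<mu>)) + dcoef0 * snd (z - (\<alpha>, \<mu>)))) \<le> e / K * norm (z - (\<alpha>, \<mu>))"
            by (rule \<delta>(2)) (use nz elim(1) in linarith)
          also have "\<dots> \<le> e / K * (K / sqrt (real n))" using nz eK by (intro mult_left_mono) auto
          finally show "norm (sizefun c z - sizefun c (\<alpha>, \<mu>) - (dcoef1 c * fst (z - (\<alpha>, \<mu>)) + dcoef0 * snd (z - (\<alpha>, \<mu>)))) \<le> e / K * (K / sqrt (real n))" .
        qed simp
        also have "\<dots> = e" using n Kp by simp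
        finally show ?thesis .
      qed (use e in \<open>auto simp: Z_def\<close>)
      then have "{\<omega>\<in>space M. e < \<bar>Z n \<omega>\<bar>} \<subseteq> {\<omega>\<in>space M. \<not> good 1 n \<omega>} \<union> ({\<omega>\<in>space M. K1 < \<bar>err1 n \<omega>\<bar>} \<union> {\<omega>\<in>space M. K0 < \<bar>err0 n \<omega>\<bar>})"
        by (auto simp: not_le[symmetric])
      then have "prob {\<omega>\<in>space M. e < \<bar>Z n \<omega>\<bar>} \<le> prob ({\<omega>\<in>space M. \<not> good 1 n \<omega>} \<union> ({\<omega>\<in>space M. K1 < \<bar>err1 n \<omega>\<bar>} \<union> {\<omega>\<in>space M. K0 < \<bar>err0 n \<omega>\<bar>}))"
        by (rule finite_measure_mono) measurable
      also have "\<dots> \<le> prob {\<omega>\<in>space M. \<not> good 1 n \<omega>} + prob ({\<omega>\<in>space M. K1 < \<bar>err1 n \<omega>\<bar>} \<union> {\<omega>\<in>space M. K0 < \<bar>err0 n \<omega>\<bar>})"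
        by (rule measure_Un_le) measurable
      also have "\<dots> \<le> prob {\<omega>\<in>space M. \<not> good 1 n \<omega>} + (prob {\<omega>\<in>space M. K1 < \<bar>err1 n \<omega>\<bar>} + prob {\<omega>\<in>space M. K0 < \<bar>err0 n \<omega>\<bar>})"
        by (rule add_left_mono, rule measure_Un_le) measurable
      finally show ?case using elim d by linarith
    qed
    then show "\<exists>no. \<forall>n\<ge>no. norm (prob {\<omega>\<in>space M. e < \<bar>Z n \<omega>\<bar>} - 0) < d" by (simp add: eventually_sequentially)
  qed
  then show "(\<lambda>n. prob {\<omega>\<in>space M. e < \<bar>(if X (s - 1) \<omega> = m1 \<and> X (s + 1) \<omega> = m2 then size_err n \<omega> else lin n \<omega>) - lin n \<omega>\<bar>}) \<longlonglongrightarrow> 0"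
    unfolding Z_def .
qed

lemma size_err_clt:
  "(\<lambda>n. \<integral>\<omega>. pair_event {(m1, m2)} \<omega> * iexp (t * size_err n \<omega>) \<partial>M)
     \<longlonglongrightarrow> (\<integral>\<omega>. pair_event {(m1, m2)} \<omega> \<partial>M) * complex_of_real (exp (- err_var (t * dcoef1 (real m1 + real m2)) (t * dcoef0) / 2))"
proof -
  define lin where "lin n \<omega> = dcoef1 (real m1 + real m2) * err1 n \<omega> + dcoef0 * err0 n \<omega>" for n \<omega>
  define Z where "Z n \<omega> = (if X (s - 1) \<omega> = m1 \<and> X (s + 1) \<omega> = m2 then size_err n \<omega> else lin n \<omega>)" for n \<omega>
  have [measurable]: "lin n \<in> borel_measurable M" for n unfolding lin_def[abs_def] by measurable
  have [measurable]: "Z n \<in> borel_measurable M" for n unfolding Z_def[abs_def] by measurable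
  have c: "(\<lambda>n. \<integral>\<omega>. pair_event {(m1, m2)} \<omega> * iexp (t * Z n \<omega>) \<partial>M)
     \<longlonglongrightarrow> (\<integral>\<omega>. pair_event {(m1, m2)} \<omega> \<partial>M) * complex_of_real (exp (- err_var (t * dcoef1 (real m1 + real m2)) (t * dcoef0) / 2))"
  proof (rule to_zero_prob_iexp[OF _ pair_event_bound measurable_pair_event])
    have l: "t * lin n \<omega> = (t * dcoef1 (real m1 + real m2)) * err1 n \<omega> + (t * dcoef0) * err0 n \<omega>" for n \<omega>
      by (simp add: lin_def algebra_simps)
    show "(\<lambda>n. \<integral>\<omega>. pair_event {(m1, m2)} \<omega> * iexp (t * lin n \<omega>) \<partial>M)
      \<longlonglongrightarrow> (\<integral>\<omega>. pair_event {(m1, m2)} \<omega> \<partial>M) * complex_of_real (exp (- err_var (t * dcoef1 (real m1 + real m2)) (t * dcoef0) / 2))"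
      unfolding l by (rule err_clt)
    have "to_zero_prob (\<lambda>n \<omega>. t * (Z n \<omega> - lin n \<omega>))"
      unfolding Z_def lin_def by (rule to_zero_prob_cmult[OF size_err_linear])
    then show "to_zero_prob (\<lambda>n \<omega>. t * Z n \<omega> - t * lin n \<omega>)" by (simp add: right_diff_distrib)
  qed measurable
  \<comment> \<open>The indicator vanishes where \<open>Z\<close> and \<open>size_err\<close>
    differ.\<close>
  have e: "pair_event {(m1, m2)} \<omega> * iexp (t * Z n \<omega>) = pair_event {(m1, m2)} \<omega> * iexp (t * size_err n \<omega>)" for n \<omega>
    by (simp add: pair_event_def Z_def indicator_def)
  from c show ?thesis unfolding e .
qed

section \<open>Identification of the covariance and the limit laws\<close>

lemma S_inverse: "matrix_inv (inar_S \<alpha> pe) = mat2 (1 / disc) (- l1 / disc) (- l1 / disc) (l2 / disc)"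
proof -
  have "l2 * 1 - l1 * l1 = disc" by (simp add: disc_def power2_eq_square)
  then show ?thesis unfolding inar_S_def stat_moment_eq using mat2_inverse[of l2 1 l1 l1] disc_pos by simp
qed

text \<open>By symmetry of the inverse of \<open>inar_S\<close>, the form is that of
  \<open>inar_A\<close> at the transformed vector.\<close>

lemma B_quadratic_form: "t \<bullet> (inar_B \<alpha> pe *v t) = err_var (t $ 1) (t $ 2)"
proof -
  define u where "u = matrix_inv (inar_S \<alpha> pe) *v t"
  have u: "u $ 1 = (t $ 1 - l1 * t $ 2) / disc" "u $ 2 = (l2 * t $ 2 - l1 * t $ 1) / disc"
    unfolding u_def S_inverse mat2_mult_vec by (simp_all add: diff_divide_distrib)
  define v where "v = inar_A \<alpha> pe *v u"
  have A: "inar_A \<alpha> pe = (\<alpha> * (1 - \<alpha>)) *\<^sub>R mat2 l3 l2 l2 l1 + \<sigma>2 *\<^sub>R mat2 l2 l1 l1 1"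
    unfolding inar_A_def inar_S_def stat_moment_eq \<sigma>2_def ..
  have v: "v $ 1 = (\<alpha> * (1 - \<alpha>)) * (l3 * u $ 1 + l2 * u $ 2) + \<sigma>2 * (l2 * u $ 1 + l1 * u $ 2)"
    "v $ 2 = (\<alpha> * (1 - \<alpha>)) * (l2 * u $ 1 + l1 * u $ 2) + \<sigma>2 * (l1 * u $ 1 + u $ 2)"
    unfolding v_def A by (simp_all add: matrix_vector_mult_add_rdistrib scaleR_matrix_vector_assoc[symmetric] mat2_mult_vec)
  have "inar_B \<alpha> pe *v t = matrix_inv (inar_S \<alpha> pe) *v v"
    unfolding inar_B_def v_def u_def by (simp add: matrix_vector_mul_assoc matrix_mul_assoc)
  then have "t \<bullet> (inar_B \<alpha> pe *v t) = t $ 1 * (v $ 1 / disc - l1 / disc * v $ 2) + t $ 2 * (- l1 / disc * v $ 1 + l2 / disc * v $ 2)"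
    unfolding S_inverse inner_vec2 by (simp add: mat2_mult_vec)
  also have "\<dots> = u $ 1 * v $ 1 + u $ 2 * v $ 2"
    unfolding u by (simp add: diff_divide_distrib algebra_simps)
  also have "\<dots> = asym_var (u $ 1) (u $ 2)"
    unfolding v asym_var_def by (simp add: algebra_simps power2_eq_square)
  finally show ?thesis by (simp add: u err_var_def)
qed

text \<open>A Cholesky factorisation of \<open>inar_A\<close>, composed with the inverse of
  \<open>inar_S\<close>, writes the form as a sum of two squares. Semidefiniteness is read off from
  nonnegativity of \<open>asym_var\<close>; the determinant may be zero.\<close>

lemma gaussian_limit_ex: "\<exists>N :: (real^2) measure. centered_gaussian (\<lambda>t. t \<bullet> (inar_B \<alpha> pe *v t)) N"
proof -
  define p q r where "p = \<alpha> * (1 - \<alpha>) * l3 + \<sigma>2 * l2" and "q = \<alpha> * (1 - \<alpha>) * l2 + \<sigma>2 * l1" and "r = \<alpha> * (1 - \<alpha>) * l1 + \<sigma>2"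
  have V: "asym_var x z = p * x^2 + 2 * q * x * z + r * z^2" for x z
    by (simp add: asym_var_def p_def q_def r_def algebra_simps)
  have "l1 \<le> l3"
  proof -
    have "real x \<le> real x ^ 3" for x :: nat
      using self_le_power[of "real x" 3] by (cases "x = 0") auto
    then show ?thesis unfolding stat_law_moments[symmetric] using stat_law1 stat_law3 by (intro integral_mono) auto
  qed
  then have l3: "0 < l3" using l1_pos by linarith
  have l2: "0 < l2" using variance_pi_pos zero_le_power2[of l1] by linarith
  have p: "0 < p" unfolding p_def using \<alpha> l3 l2 \<sigma>2_nonneg by (intro add_pos_nonneg mult_pos_pos mult_nonneg_nonneg) auto
  \<comment> \<open>The vector \<open>(q, - p)\<close> is orthogonal to the first row of the matrix,
    which makes the form equal to \<open>p\<close> times the determinant.\<close>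
  have "0 \<le> asym_var q (- p)" by (rule asym_var_nonneg)
  also have "asym_var q (- p) = p * (p * r - q^2)" unfolding V by (simp add: algebra_simps power2_eq_square)
  finally have D: "0 \<le> p * r - q^2" using p by (simp add: zero_le_mult_iff)
  define k where "k = sqrt ((p * r - q^2) / p)"
  \<comment> \<open>\<open>u\<close> and \<open>w\<close> are chosen so that their inner products
    with \<open>t\<close> become the two linear forms of the factorisation in the transformed
    variables \<open>x\<close> and \<open>z\<close>.\<close>
  define u :: "real^2" where "u = vector [(sqrt p - q / sqrt p * l1) / disc, (q / sqrt p * l2 - sqrt p * l1) / disc]"
  define w :: "real^2" where "w = vector [- k * l1 / disc, k * l2 / disc]"
  have "t \<bullet> (inar_B \<alpha> pe *v t) = (t \<bullet> u)^2 + (t \<bullet> w)^2" for t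
  proof -
    define x z where "x = (t $ 1 - l1 * t $ 2) / disc" and "z = (l2 * t $ 2 - l1 * t $ 1) / disc"
    have tu: "t \<bullet> u = sqrt p * x + q / sqrt p * z" unfolding inner_vec2 u_def x_def z_def by (simp add: diff_divide_distrib algebra_simps)
    have tw: "t \<bullet> w = k * z" unfolding inner_vec2 w_def z_def by (simp add: diff_divide_distrib algebra_simps)
    have sp: "sqrt p * sqrt p = p" "sqrt p \<noteq> 0" using p by simp_all
    have "(t \<bullet> u)^2 = p * x^2 + 2 * q * x * z + q^2 / p * z^2"
    proof -
      have "(t \<bullet> u)^2 = (sqrt p * sqrt p) * x^2 + 2 * q * x * z * (sqrt p / sqrt p) + q^2 / (sqrt p * sqrt p) * z^2"
        unfolding tu by (simp add: power2_eq_square algebra_simps)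
      then show ?thesis using sp by simp
    qed
    moreover have "(t \<bullet> w)^2 = (p * r - q^2) / p * z^2" unfolding tw power_mult_distrib k_def using D p by simp
    moreover have "q^2 / p * z^2 + (p * r - q^2) / p * z^2 = r * z^2" using p by (simp add: field_simps)
    ultimately have "(t \<bullet> u)^2 + (t \<bullet> w)^2 = asym_var x z" unfolding V by simp
    then show ?thesis unfolding B_quadratic_form err_var_def x_def z_def by simp
  qed
  then show ?thesis using centered_gaussian_ex[of u w] by simp
qed

theorem estimator_clt:
  "\<exists>N. centered_gaussian (\<lambda>t. t \<bullet> (inar_B \<alpha> pe *v t)) N \<and>
     weak_conv_vec (\<lambda>n. distr M borel (\<lambda>\<omega>. vector [err1 n \<omega>, err0 n \<omega>] :: real^2)) N"
proof -
  obtain N :: "(real^2) measure" where N: "centered_gaussian (\<lambda>t. t \<bullet> (inar_B \<alpha> pe *v t)) N" using gaussian_limit_ex by blast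
  have m: "(\<lambda>\<omega>. vector [err1 n \<omega>, err0 n \<omega>] :: real^2) \<in> borel_measurable M" for n
  proof (rule borel_measurable_euclidean_space[THEN iffD2], rule ballI)
    fix b :: "real^2" assume "b \<in> Basis"
    then show "(\<lambda>\<omega>. vector [err1 n \<omega>, err0 n \<omega>] \<bullet> b) \<in> borel_measurable M"
      unfolding inner_vec2 by simp
  qed
  have "weak_conv_vec (\<lambda>n. distr M borel (\<lambda>\<omega>. vector [err1 n \<omega>, err0 n \<omega>] :: real^2)) N"
  proof (rule weak_conv_vecI_char)
    show "prob_space (distr M borel (\<lambda>\<omega>. vector [err1 n \<omega>, err0 n \<omega>] :: real^2))" for n by (rule prob_space_distr[OF m])
    show "prob_space N" "sets N = sets borel" using N by (auto simp: centered_gaussian_def)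
    fix t :: "real^2"
    \<comment> \<open>The unconditional case: the event is everything and its weight integrates to
      1.\<close>
    have "(CLINT x|distr M borel (\<lambda>\<omega>. vector [err1 n \<omega>, err0 n \<omega>] :: real^2). iexp (t \<bullet> x)) = (\<integral>\<omega>. pair_event UNIV \<omega> * iexp (t $ 1 * err1 n \<omega> + t $ 2 * err0 n \<omega>) \<partial>M)" for n
      by (subst integral_distr[OF m]) (auto simp: inner_vec2 pair_event_def)
    moreover have "(\<integral>\<omega>. pair_event UNIV \<omega> \<partial>M) = 1" by (simp add: pair_event_def prob_space)
    moreover have "(CLINT x|N. iexp (t \<bullet> x)) = complex_of_real (exp (- err_var (t $ 1) (t $ 2) / 2))"
      using N by (simp only: centered_gaussian_def B_quadratic_form)
    ultimately show "(\<lambda>n. CLINT x|distr M borel (\<lambda>\<omega>. vector [err1 n \<omega>, err0 n \<omega>] :: real^2). iexp (t \<bullet> x)) \<longlonglongrightarrow> (CLINT x|N. iexp (t \<bullet> x))"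
      using err_clt[of UNIV "t $ 1" "t $ 2"] by simp
  qed simp
  with N show ?thesis by blast
qed

text \<open>The conditional characteristic function is the weighted one divided by the probability
  of the event. The limit law is the image of the vector Gaussian under the inner product with
  \<open>d\<close>.\<close>

theorem size_estimator_clt:
  fixes m1 m2 :: nat
  defines "A \<equiv> {\<omega> \<in> space M. Y (s - 1) \<omega> = real m1 \<and> Y (s + 1) \<omega> = real m2}"
  defines "d \<equiv> (1 / (1 + \<alpha>^2)^2) *\<^sub>R (vector [(\<alpha>^2 - 1) * (real m1 + real m2) + (2 * \<alpha> + 1 - \<alpha>^2) * \<mu>, - (1 + \<alpha>^2) * (1 - \<alpha>)] :: real^2)"
  assumes pos: "prob A > 0"
  shows "\<exists>N. centered_gaussian (\<lambda>t. (d \<bullet> (inar_B \<alpha> pe *v d)) * t^2) N \<and> weak_conv_m (\<lambda>n. distr (uniform_measure M A) borel (size_err n)) N"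
proof -
  obtain N2 :: "(real^2) measure" where N2: "centered_gaussian (\<lambda>t. t \<bullet> (inar_B \<alpha> pe *v t)) N2" using gaussian_limit_ex by blast
  then interpret N2: prob_space N2 by (simp add: centered_gaussian_def)
  have sN2: "sets N2 = sets borel" using N2 by (simp add: centered_gaussian_def)
  have d: "d $ 1 = dcoef1 (real m1 + real m2)" "d $ 2 = dcoef0" by (simp_all add: d_def dcoef1_def dcoef0_def)
  have mN: "(\<lambda>x. x \<bullet> d) \<in> measurable N2 borel" using sN2 by (simp cong: measurable_cong_sets)
  define N where "N = distr N2 borel (\<lambda>x. x \<bullet> d)"
  have cN: "char N t = complex_of_real (exp (- ((d \<bullet> (inar_B \<alpha> pe *v d)) * t^2) / 2))" for t
  proof -
    have "char N t = complex_of_real (exp (- ((t *\<^sub>R d) \<bullet> (inar_B \<alpha> pe *v (t *\<^sub>R d))) / 2))"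
      unfolding N_def char_distr_inner[OF sN2] using N2 by (simp only: centered_gaussian_def)
    also have "(t *\<^sub>R d) \<bullet> (inar_B \<alpha> pe *v (t *\<^sub>R d)) = (d \<bullet> (inar_B \<alpha> pe *v d)) * t^2"
      by (simp add: matrix_vector_mult_scaleR power2_eq_square)
    finally show ?thesis .
  qed
  have G: "centered_gaussian (\<lambda>t. (d \<bullet> (inar_B \<alpha> pe *v d)) * t^2) N"
    unfolding centered_gaussian_def using cN N2.prob_space_distr[OF mN] by (simp add: N_def char_def)
  have As: "A \<in> sets M" unfolding A_def by measurable
  have ind: "complex_of_real (indicator A \<omega>) = pair_event {(m1, m2)} \<omega>" if "\<omega> \<in> space M" for \<omega>
    using that s by (auto simp: A_def pair_event_def Y_def indicator_def simp del: inar.simps)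
  interpret U: prob_space "uniform_measure M A"
    by (rule prob_space_uniform_measure) (use pos in \<open>auto simp: emeasure_eq_measure\<close>)
  have mU: "size_err n \<in> measurable (uniform_measure M A) borel" for n by simp
  have "weak_conv_m (\<lambda>n. distr (uniform_measure M A) borel (size_err n)) N"
  proof (rule levy_continuity)
    show "real_distribution (distr (uniform_measure M A) borel (size_err n))" for n
      by (rule U.real_distribution_distr[OF mU])
    show "real_distribution N" unfolding N_def by (rule N2.real_distribution_distr[OF mN])
    fix t
    have PA: "(\<integral>\<omega>. pair_event {(m1, m2)} \<omega> \<partial>M) = complex_of_real (prob A)"
    proof -
      have "(\<integral>\<omega>. pair_event {(m1, m2)} \<omega> \<partial>M) = (\<integral>\<omega>. complex_of_real (indicator A \<omega>) \<partial>M)"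
        by (rule Bochner_Integration.integral_cong[OF refl]) (simp add: ind)
      also have "\<dots> = complex_of_real (prob A)" using As by (simp add: integral_complex_of_real)
      finally show ?thesis .
    qed
    have "char (distr (uniform_measure M A) borel (size_err n)) t = (\<integral>\<omega>. pair_event {(m1, m2)} \<omega> * iexp (t * size_err n \<omega>) \<partial>M) / complex_of_real (prob A)" for n
    proof -
      have "char (distr (uniform_measure M A) borel (size_err n)) t = (\<integral>\<omega>. iexp (t * size_err n \<omega>) \<partial>uniform_measure M A)"
        unfolding char_def by (rule integral_distr[OF mU]) simp
      also have "\<dots> = (\<integral>\<omega>. indicator A \<omega> * iexp (t * size_err n \<omega>) \<partial>M) / complex_of_real (prob A)"
        by (rule integral_uniform_measure_complex[OF As pos]) measurable
      also have "(\<integral>\<omega>. indicator A \<omega> * iexp (t * size_err n \<omega>) \<partial>M) = (\<integral>\<omega>. pair_event {(m1, m2)} \<omega> * iexp (t * size_err n \<omega>) \<partial>M)"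
        by (rule Bochner_Integration.integral_cong[OF refl]) (simp add: ind[symmetric] indicator_def)
      finally show ?thesis .
    qed
    moreover have "char N t = (\<integral>\<omega>. pair_event {(m1, m2)} \<omega> \<partial>M) * complex_of_real (exp (- err_var (t * dcoef1 (real m1 + real m2)) (t * dcoef0) / 2)) / complex_of_real (prob A)"
    proof -
      have "(d \<bullet> (inar_B \<alpha> pe *v d)) * t^2 = (t *\<^sub>R d) \<bullet> (inar_B \<alpha> pe *v (t *\<^sub>R d))"
        by (simp add: matrix_vector_mult_scaleR power2_eq_square)
      also have "\<dots> = err_var (t * dcoef1 (real m1 + real m2)) (t * dcoef0)" unfolding B_quadratic_form by (simp add: d)
      finally show ?thesis unfolding cN PA using pos by simp
    qed
    ultimately show "(\<lambda>n. char (distr (uniform_measure M A) borel (size_err n)) t) \<longlonglongrightarrow> char N t"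
      using pos by (simp only:) (intro tendsto_divide size_err_clt tendsto_const, simp)
  qed
  with G show ?thesis by blast
qed

end

theorem theorem3p3p2:
  fixes M :: "'a measure" and \<alpha> :: real and pe :: "nat pmf"
    and X0 :: "'a \<Rightarrow> nat" and eps :: "nat \<Rightarrow> 'a \<Rightarrow> nat" and xi :: "nat \<Rightarrow> nat \<Rightarrow> 'a \<Rightarrow> nat"
    and s \<theta> :: nat
  defines "X \<equiv> inar X0 eps xi"
  defines "Y \<equiv> (\<lambda>k \<omega>. real (X k \<omega>) + (if k = s then real \<theta> else 0))"
  defines "\<mu> \<equiv> measure_pmf.expectation pe real"
  defines "B \<equiv> inar_B \<alpha> pe"
  defines "est \<equiv> (\<lambda>n \<omega>. cls_est n s (\<lambda>k. Y k \<omega>))"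
  assumes M: "prob_space M"
    and \<alpha>: "0 < \<alpha>" "\<alpha> < 1"
    and indep: "prob_space.indep_vars M (\<lambda>_. count_space UNIV) (inar_family X0 eps xi) inar_index"
    and eps_law: "\<And>k. 1 \<le> k \<Longrightarrow> distr M (count_space UNIV) (eps k) = measure_pmf pe"
    and xi_law: "\<And>k j. 1 \<le> k \<Longrightarrow> 1 \<le> j \<Longrightarrow>
                   distr M (count_space UNIV) (xi k j) = measure_pmf (map_pmf of_bool (bernoulli_pmf \<alpha>))"
    and eps2: "integrable (measure_pmf pe) (\<lambda>x. real x ^ 2)"
    and eps3: "integrable (measure_pmf pe) (\<lambda>x. real x ^ 3)"
    and eps_nz: "prob_space.prob M {\<omega> \<in> space M. eps 1 \<omega> \<noteq> 0} > 0"
    and X02: "integrable M (\<lambda>\<omega>. real (X0 \<omega>) ^ 2)"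
    and X03: "integrable M (\<lambda>\<omega>. real (X0 \<omega>) ^ 3)"
    and s: "1 \<le> s" and \<theta>: "1 \<le> \<theta>"
  shows
    "(\<exists>N. centered_gaussian (\<lambda>t. t \<bullet> (B *v t)) N \<and>
        weak_conv_vec
          (\<lambda>n. distr M borel (\<lambda>\<omega>. vector [sqrt (real n) * (fst (est n \<omega>) - \<alpha>),
                                             sqrt (real n) * (fst (snd (est n \<omega>)) - \<mu>)] :: real^2))
          N)
     \<and>
     (\<forall>m1 m2 :: nat.
        prob_space.prob M {\<omega> \<in> space M. Y (s-1) \<omega> = real m1 \<and> Y (s+1) \<omega> = real m2} > 0 \<longrightarrow>
        (let A = {\<omega> \<in> space M. Y (s-1) \<omega> = real m1 \<and> Y (s+1) \<omega> = real m2};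
             d = (1 / (1 + \<alpha>^2)^2) *\<^sub>R
                   (vector [(\<alpha>^2 - 1) * (real m1 + real m2) + (2*\<alpha> + 1 - \<alpha>^2) * \<mu>,
                            - (1 + \<alpha>^2) * (1 - \<alpha>)] :: real^2)
         in \<exists>N. centered_gaussian (\<lambda>t. (d \<bullet> (B *v d)) * t^2) N \<and>
              weak_conv_m
                (\<lambda>n. distr (uniform_measure M A) borel
                   (\<lambda>\<omega>. sqrt (real n) * (snd (snd (est n \<omega>))
                      - (Y s \<omega> - \<alpha> / (1 + \<alpha>^2) * (Y (s-1) \<omega> + Y (s+1) \<omega>)
                         - (1 - \<alpha>) / (1 + \<alpha>^2) * \<mu>))))
                N))"
proof -
  interpret prob_space M by (rule M)
  have eps1: "eps 1 \<in> measurable M (count_space UNIV)"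
  proof -
    have "inar_family X0 eps xi (Inl 1) \<in> measurable M (count_space UNIV)"
      using indep unfolding indep_vars_def by (auto simp: inar_index_def)
    then show ?thesis by (simp add: inar_family_def[abs_def])
  qed
  \<comment> \<open>A nonnegative variable with mean 0 vanishes almost surely, which would
    contradict \<open>eps_nz\<close>.\<close>
  have mean: "0 < measure_pmf.expectation pe real"
  proof (rule ccontr)
    assume "\<not> ?thesis"
    moreover have "0 \<le> measure_pmf.expectation pe real" by (rule integral_nonneg_AE) simp
    ultimately have "measure_pmf.expectation pe real = 0" by simp
    moreover have "integrable (measure_pmf pe) real" using integrable_power_le3[OF eps3, of 1] by simp
    ultimately have "AE x in measure_pmf pe. x = 0" by (simp add: integral_nonneg_eq_0_iff_AE)
    then have "AE x in distr M (count_space UNIV) (eps 1). x = 0" unfolding eps_law[OF order_refl] .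
    then have "AE \<omega> in M. eps 1 \<omega> = 0" using eps1 by (simp add: AE_distr_iff)
    then have "prob {\<omega> \<in> space M. eps 1 \<omega> \<noteq> 0} = 0" by (intro prob_eq_0_AE) (auto elim: AE_mp)
    with eps_nz show False by simp
  qed
  interpret P: inar_outlier M \<alpha> pe X0 eps xi s \<theta>
    by unfold_locales (use \<alpha> eps3 mean indep eps_law xi_law X03 s in auto)
  have Y: "Y = P.Y" by (simp add: Y_def P.Y_def X_def fun_eq_iff)
  have \<mu>: "\<mu> = P.\<mu>" by (simp add: \<mu>_def P.\<mu>_def)
  have est: "est = P.est" by (simp add: est_def P.est_def Y fun_eq_iff)
  show ?thesis
    unfolding B_def Y \<mu> est Let_def
    using P.estimator_clt[unfolded P.err1_def P.err0_def]
      P.size_estimator_clt[unfolded P.size_err_def[abs_def]]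
    by blast
qed

end
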